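(* Assume that there exists a further basis projection $P$ of $\mathcal K$ which commutes with $P_1$ and with $G$, and let $p_+=PP_1$, $p_-=PP_2$. Assume further that there exists a unitary operator $\mathcal C_{+-}$ from $\mathcal K_-=p_-(\mathcal K)$ onto $\mathcal K_+=p_+(\mathcal K)$ which commutes with $G$, and let $\mathcal C$ be the unique Bogoliubov operator which commutes with $P$ and which is given on $P(\mathcal K)=\mathcal K_+\oplus\mathcal K_-$ by the matrix $$P\mathcal CP=\begin{pmatrix}0&\mathcal C_{+-}\\{\mathcal C_{+-}}^*&0\end{pmatrix}.$$ Then $\mathcal C$ is gauge invariant (commutes with $G$), unitary and self-adjoint, and the map $$V\mapsto V^c=\mathcal CV\mathcal C$$ is an involutive automorphism of the semigroup $\mathcal I_{P_1}(\mathcal K)^G$ which preserves the statistics dimension $d_V=2^{-\frac12\operatorname{ind}V}$. In addition, one has $$\mathfrak h_{V^c}=\mathcal C({\mathfrak h_V}^* ),\qquad\mathfrak k_{V^c}=\mathcal C({\mathfrak k_V}^* ),$$ so that the representation $\mathcal U_{V^c}$ of $G$ on $H(\varrho_{V^c})$ is unitarily equivalent to the complex conjugate of $\mathcal U_V$.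
   Context: Let $\mathcal K$ be an infinite-dimensional separable complex Hilbert space (inner product linear in the second argument) with a complex conjugation $f\mapsto f^*$ (antiunitary involution); $\mathcal H^*=\{f^*:f\in\mathcal H\}$ for subspaces $\mathcal H$. The (selfdual) CAR algebra $\mathfrak C(\mathcal K)$ is the unique (simple) unital $C^*$-algebra generated by $\mathbf 1$ and the elements of $\mathcal K$ (embedded linearly, the involution extending the conjugation) with $f^*g+gf^*=\langle f,g\rangle\mathbf 1$. For bounded $A$ put $\overline Af=(A(f^* ))^*$. $\mathcal I(\mathcal K)=\{V\in\mathfrak B(\mathcal K):V^*V=\mathbf 1,\overline V=V\}$ (Bogoliubov operators, $-\operatorname{ind}V=\dim\ker V^*$); $\varrho_V$ is the unital $*$-endomorphism of $\mathfrak C(\mathcal K)$ with $\varrho_V(f)=Vf$. A basis projection is an orthogonal projection $P$ with $P+\overline P=\mathbf 1$. Fix a basis projection $P_1$; $P_2=\mathbf 1-P_1$, $\mathcal K_n=P_n(\mathcal K)$, $A_{mn}=P_mAP_n:\mathcal K_n\to\mathcal K_m$. $\pi_{P_1}(f)=a(P_1f)^*+a(P_1(f^* ))$ is the Fock representation on the antisymmetric Fock space $\mathcal F_a(\mathcal K_1)$. $\mathcal I_{P_1}(\mathcal K)=\{V\in\mathcal I(\mathcal K):V_{12}\text{ Hilbert–Schmidt}\}$. $G$ is a group of unitary Bogoliubov operators commuting with $P_1$; $\Gamma(U)$ is the usual second quantization of $U_{11}$, $U\in G$. $\mathcal I_{P_1}(\mathcal K)^G=\{V\in\mathcal I_{P_1}(\mathcal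 K):[V,U]=0\ \forall U\in G\}$. For $V\in\mathcal I_{P_1}(\mathcal K)$: ${V_{jj}}^{-1}$ is the inverse of $V_{jj}$ on its (closed) range with values in $\operatorname{ran}{V_{jj}}^*$, extended by zero on $\ker{V_{jj}}^*$; $p_{\mathcal H}$ is the orthogonal projection onto $\mathcal H$; $T_V=V_{21}{V_{11}}^{-1}-({V_{22}}^{-1})^*{V_{12}}^*p_{\ker{V_{11}}^*}$; $\mathfrak h_V=V_{12}(\ker V_{22})$; $P_V=(P_1+T_V)(P_1+T_V^*T_V)^{-1}(P_1+T_V^* )-p_{\mathfrak h_V}+\overline{p_{\mathfrak h_V}}$; $\mathfrak k_V=P_V(\ker V^* )$. $H(\varrho_V)=\{\Psi\in\mathfrak B(\mathcal F_a(\mathcal K_1)):\Psi\pi_{P_1}(a)=\pi_{P_1}(\varrho_V(a))\Psi\ \forall a\in\mathfrak C(\mathcal K)\}$, a Hilbert space with inner product $\langle\Psi,\Psi'\rangle\mathbf 1=\Psi^*\Psi'$ (it implements $\varrho_V$). For $V\in\mathcal I_{P_1}(\mathcal K)^G$, $\mathcal U_V(U)\Psi=\Gamma(U)\Psi\Gamma(U)^*$, $U\in G$, $\Psi\in H(\varrho_V)$. *)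

theory Defs
  imports "HOL-Analysis.Analysis"
begin

section \<open>Complex Hilbert spaces and C*-algebras\<close>

class complex_vector = real_vector +
  fixes scaleC :: "complex \<Rightarrow> 'a \<Rightarrow> 'a"  (infixr "*\<^sub>C" 75)
  assumes scaleC_add_right: "c *\<^sub>C (x + y) = c *\<^sub>C x + c *\<^sub>C y"
    and scaleC_add_left: "(c + d) *\<^sub>C x = c *\<^sub>C x + d *\<^sub>C x"
    and scaleC_scaleC: "c *\<^sub>C d *\<^sub>C x = (c * d) *\<^sub>C x"
    and scaleR_eq_scaleC: "r *\<^sub>R x = complex_of_real r *\<^sub>C x"

lemma scaleC_one: "(1::complex) *\<^sub>C x = (x::'a::complex_vector)"
  by (metis of_real_1 scaleR_eq_scaleC scaleR_one)

global_interpretation cvec: vector_space "scaleC :: complex \<Rightarrow> 'a \<Rightarrow> 'a::complex_vector"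
  defines cspan = cvec.span and cdim = cvec.dim
  by unfold_locales (auto simp: scaleC_add_right scaleC_add_left scaleC_scaleC scaleC_one)

abbreviation clinear :: "('a::complex_vector \<Rightarrow> 'b::complex_vector) \<Rightarrow> bool"
  where "clinear \<equiv> Vector_Spaces.linear (*\<^sub>C) (*\<^sub>C)"

text \<open>The inner product is linear in the second argument; norm and topology are those of the
  underlying real Hilbert space.\<close>

class chilbert_space = complex_vector + real_inner + complete_space +
  fixes cinner :: "'a \<Rightarrow> 'a \<Rightarrow> complex"
  assumes cinner_add_right: "cinner x (y + z) = cinner x y + cinner x z"
    and cinner_scaleC_right: "cinner x (c *\<^sub>C y) = c * cinner x y"
    and cinner_commute: "cinner y x = cnj (cinner x y)"
    and inner_eq_Re_cinner: "inner x y = Re (cinner x y)"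

class cstar_algebra = complex_vector + real_normed_algebra_1 + complete_space +
  fixes star :: "'a \<Rightarrow> 'a"
  assumes scaleC_mult_left: "(c *\<^sub>C x) * y = c *\<^sub>C (x * y)"
    and scaleC_mult_right: "x * (c *\<^sub>C y) = c *\<^sub>C (x * y)"
    and norm_scaleC: "norm (c *\<^sub>C x) = cmod c * norm x"
    and star_add: "star (x + y) = star x + star y"
    and star_scaleC: "star (c *\<^sub>C x) = cnj c *\<^sub>C star x"
    and star_mult: "star (x * y) = star y * star x"
    and star_star: "star (star x) = x"
    and cstar_identity: "norm (star x * x) = norm x ^ 2"


section \<open>Operators on a Hilbert space\<close>

text \<open>Definite description with a default; the default is never attained in the situations
  where the notions below are mathematically defined.\<close>

definition the_or :: "'a \<Rightarrow> ('a \<Rightarrow> bool) \<Rightarrow> 'a"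
  where "the_or d Q = (if \<exists>!x. Q x then THE x. Q x else d)"

definition bop :: "('k::chilbert_space \<Rightarrow> 'k) set"
  where "bop = {A. bounded_linear A \<and> clinear A}"

definition adj :: "('k::chilbert_space \<Rightarrow> 'k) \<Rightarrow> 'k \<Rightarrow> 'k"
  where "adj A y = the_or 0 (\<lambda>x. \<forall>z. cinner x z = cinner y (A z))"

definition orth_proj :: "'k::chilbert_space set \<Rightarrow> 'k \<Rightarrow> 'k"
  where "orth_proj S x = the_or 0 (\<lambda>y. y \<in> S \<and> (\<forall>s\<in>S. cinner s (x - y) = 0))"

definition is_onb :: "'k::chilbert_space set \<Rightarrow> 'k set \<Rightarrow> bool"
  where "is_onb S E \<longleftrightarrow> E \<subseteq> S \<and> (\<forall>e\<in>E. \<forall>f\<in>E. cinner e f = (if e = f then 1 else 0)) \<and>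
    S = closure (cspan E)"

text \<open>Hilbert--Schmidt operators on the closed subspace \<open>S\<close>; the condition does not depend on
  the orthonormal basis.\<close>

definition hilbert_schmidt_on :: "'k::chilbert_space set \<Rightarrow> ('k \<Rightarrow> 'k) \<Rightarrow> bool"
  where "hilbert_schmidt_on S A \<longleftrightarrow> (\<exists>E. is_onb S E \<and> (\<lambda>e. norm (A e) ^ 2) summable_on E)"

definition unitary_between :: "'k::chilbert_space set \<Rightarrow> 'k set \<Rightarrow> ('k \<Rightarrow> 'k) \<Rightarrow> bool"
  where "unitary_between S T A \<longleftrightarrow> A ` S = T \<and>
    (\<forall>x\<in>S. \<forall>y\<in>S. A (x + y) = A x + A y) \<and>
    (\<forall>x\<in>S. \<forall>c. A (c *\<^sub>C x) = c *\<^sub>C A x) \<and>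
    (\<forall>x\<in>S. \<forall>y\<in>S. cinner (A x) (A y) = cinner x y)"

text \<open>The adjoint of an operator with domain the closed subspace \<open>S\<close>.\<close>

definition adj_on :: "'k::chilbert_space set \<Rightarrow> ('k \<Rightarrow> 'k) \<Rightarrow> 'k \<Rightarrow> 'k"
  where "adj_on S A y = the_or 0 (\<lambda>x. x \<in> S \<and> (\<forall>z\<in>S. cinner x z = cinner y (A z)))"


section \<open>Bogoliubov operators and basis projections\<close>

text \<open>\<open>J\<close> is the complex conjugation $f \mapsto f^*$ throughout.\<close>

definition complex_conjugation :: "('k::chilbert_space \<Rightarrow> 'k) \<Rightarrow> bool"
  where "complex_conjugation J \<longleftrightarrow> (\<forall>x y. J (x + y) = J x + J y) \<and>
    (\<forall>c x. J (c *\<^sub>C x) = cnj c *\<^sub>C J x) \<and> (\<forall>x. J (J x) = x) \<and>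
    (\<forall>x y. cinner (J x) (J y) = cinner y x)"

definition bar :: "('k \<Rightarrow> 'k) \<Rightarrow> ('k \<Rightarrow> 'k) \<Rightarrow> 'k \<Rightarrow> 'k"
  where "bar J A f = J (A (J f))"

definition bogoliubov :: "('k::chilbert_space \<Rightarrow> 'k) \<Rightarrow> ('k \<Rightarrow> 'k) set"
  where "bogoliubov J = {V \<in> bop. adj V \<circ> V = id \<and> bar J V = V}"

definition is_unitary :: "('k::chilbert_space \<Rightarrow> 'k) \<Rightarrow> bool"
  where "is_unitary U \<longleftrightarrow> U \<in> bop \<and> adj U \<circ> U = id \<and> U \<circ> adj U = id"

definition basis_projection :: "('k::chilbert_space \<Rightarrow> 'k) \<Rightarrow> ('k \<Rightarrow> 'k) \<Rightarrow> bool"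
  where "basis_projection J P \<longleftrightarrow> P \<in> bop \<and> P \<circ> P = P \<and> adj P = P \<and> (\<forall>f. P f + bar J P f = f)"

definition compl :: "('k::chilbert_space \<Rightarrow> 'k) \<Rightarrow> 'k \<Rightarrow> 'k"
  where "compl P f = f - P f"

text \<open>The corner $A_{mn} = P_m A P_n$, regarded as an operator on the whole space which vanishes
  on the orthogonal complement of the range of $P_n$.\<close>

definition corner :: "('k \<Rightarrow> 'k) \<Rightarrow> ('k \<Rightarrow> 'k) \<Rightarrow> ('k \<Rightarrow> 'k) \<Rightarrow> 'k \<Rightarrow> 'k"
  where "corner P A Q = P \<circ> A \<circ> Q"

definition ker_on :: "'k::chilbert_space set \<Rightarrow> ('k \<Rightarrow> 'k) \<Rightarrow> 'k set"
  where "ker_on S A = {x \<in> S. A x = 0}"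

definition implementable :: "('k::chilbert_space \<Rightarrow> 'k) \<Rightarrow> ('k \<Rightarrow> 'k) \<Rightarrow> ('k \<Rightarrow> 'k) set"
  where "implementable J P1 =
    {V \<in> bogoliubov J. hilbert_schmidt_on (range (compl P1)) (corner P1 V (compl P1))}"

definition gauge_group :: "('k::chilbert_space \<Rightarrow> 'k) \<Rightarrow> ('k \<Rightarrow> 'k) \<Rightarrow> ('k \<Rightarrow> 'k) set \<Rightarrow> bool"
  where "gauge_group J P1 G \<longleftrightarrow>
    (\<forall>U\<in>G. U \<in> bogoliubov J \<and> is_unitary U \<and> U \<circ> P1 = P1 \<circ> U) \<and>
    id \<in> G \<and> (\<forall>U\<in>G. \<forall>W\<in>G. U \<circ> W \<in> G) \<and> (\<forall>U\<in>G. adj U \<in> G)"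

definition implementable_inv ::
    "('k::chilbert_space \<Rightarrow> 'k) \<Rightarrow> ('k \<Rightarrow> 'k) \<Rightarrow> ('k \<Rightarrow> 'k) set \<Rightarrow> ('k \<Rightarrow> 'k) set"
  where "implementable_inv J P1 G = {V \<in> implementable J P1. \<forall>U\<in>G. V \<circ> U = U \<circ> V}"

definition hilbert_dim :: "'k::chilbert_space set \<Rightarrow> enat"
  where "hilbert_dim S = (if \<exists>B. finite B \<and> cspan B = S then enat (cdim S) else \<infinity>)"

text \<open>$-\mathrm{ind}\, V = \dim\ker V^*$, as Bogoliubov operators are injective.\<close>

definition minus_ind :: "('k::chilbert_space \<Rightarrow> 'k) \<Rightarrow> enat"
  where "minus_ind V = hilbert_dim (ker_on UNIV (adj V))"

definition statistics_dim :: "('k::chilbert_space \<Rightarrow> 'k) \<Rightarrow> ereal"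
  where "statistics_dim V =
    (case minus_ind V of enat n \<Rightarrow> ereal (2 powr (real n / 2)) | \<infinity> \<Rightarrow> \<infinity>)"

text \<open>For an operator \<open>A\<close> with closed range: the inverse of \<open>A\<close> on its range with values in the
  range of its adjoint, extended by zero on the kernel of its adjoint.  For \<open>A = corner P V P\<close> this
  kernel contains the orthogonal complement of the range of \<open>P\<close>.\<close>

definition pseudo_inv :: "('k::chilbert_space \<Rightarrow> 'k) \<Rightarrow> 'k \<Rightarrow> 'k"
  where "pseudo_inv A y =
    the_or 0 (\<lambda>x. x \<in> range (adj A) \<and> (\<exists>k. adj A k = 0 \<and> y = A x + k))"

definition T_op :: "('k::chilbert_space \<Rightarrow> 'k) \<Rightarrow> ('k \<Rightarrow> 'k) \<Rightarrow> 'k \<Rightarrow> 'k"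
  where "T_op P1 V = (let P2 = compl P1;
      V11 = corner P1 V P1; V12 = corner P1 V P2; V21 = corner P2 V P1; V22 = corner P2 V P2 in
    (\<lambda>f. V21 (pseudo_inv V11 f) -
      adj (pseudo_inv V22) (adj V12 (orth_proj (ker_on (range P1) (adj V11)) f))))"

definition frak_h :: "('k::chilbert_space \<Rightarrow> 'k) \<Rightarrow> ('k \<Rightarrow> 'k) \<Rightarrow> 'k set"
  where "frak_h P1 V = (let P2 = compl P1 in
    corner P1 V P2 ` ker_on (range P2) (corner P2 V P2))"

text \<open>The inverse of an operator on the subspace \<open>S\<close>.\<close>

definition inv_on :: "'k::chilbert_space set \<Rightarrow> ('k \<Rightarrow> 'k) \<Rightarrow> 'k \<Rightarrow> 'k"
  where "inv_on S A y = the_or 0 (\<lambda>x. x \<in> S \<and> A x = y)"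

definition P_op :: "('k::chilbert_space \<Rightarrow> 'k) \<Rightarrow> ('k \<Rightarrow> 'k) \<Rightarrow> ('k \<Rightarrow> 'k) \<Rightarrow> 'k \<Rightarrow> 'k"
  where "P_op J P1 V = (let T = T_op P1 V; p = orth_proj (frak_h P1 V);
      R = inv_on (range P1) (\<lambda>x. P1 x + adj T (T x));
      Q = (\<lambda>x. P1 x + T x) \<circ> R \<circ> (\<lambda>x. P1 x + adj T x) in
    (\<lambda>f. Q f - p f + bar J p f))"

definition frak_k :: "('k::chilbert_space \<Rightarrow> 'k) \<Rightarrow> ('k \<Rightarrow> 'k) \<Rightarrow> ('k \<Rightarrow> 'k) \<Rightarrow> 'k set"
  where "frak_k J P1 V = P_op J P1 V ` ker_on UNIV (adj V)"


section \<open>Hilbert spaces on a carrier set\<close>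

text \<open>For spaces that depend on terms: Fock space over a subspace, spaces of implementing
  operators, and complex conjugate spaces.  Operators are extensional functions.\<close>

record 'v hspace =
  hcarrier :: "'v set"
  hadd :: "'v \<Rightarrow> 'v \<Rightarrow> 'v"
  hscale :: "complex \<Rightarrow> 'v \<Rightarrow> 'v"
  hip :: "'v \<Rightarrow> 'v \<Rightarrow> complex"

definition hnorm :: "'v hspace \<Rightarrow> 'v \<Rightarrow> real"
  where "hnorm H x = sqrt (Re (hip H x x))"

definition hbop :: "'v hspace \<Rightarrow> ('v \<Rightarrow> 'v) set"
  where "hbop H = {A \<in> hcarrier H \<rightarrow>\<^sub>E hcarrier H.
    (\<forall>x\<in>hcarrier H. \<forall>y\<in>hcarrier H. A (hadd H x y) = hadd H (A x) (A y)) \<and>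
    (\<forall>x\<in>hcarrier H. \<forall>c. A (hscale H c x) = hscale H c (A x)) \<and>
    (\<exists>M. \<forall>x\<in>hcarrier H. hnorm H (A x) \<le> M * hnorm H x)}"

definition hcomp :: "'v hspace \<Rightarrow> ('v \<Rightarrow> 'v) \<Rightarrow> ('v \<Rightarrow> 'v) \<Rightarrow> 'v \<Rightarrow> 'v"
  where "hcomp H A B = compose (hcarrier H) A B"

definition hadj :: "'v hspace \<Rightarrow> ('v \<Rightarrow> 'v) \<Rightarrow> 'v \<Rightarrow> 'v"
  where "hadj H A = (\<lambda>y\<in>hcarrier H.
    the_or (hscale H 0 y)
      (\<lambda>x. x \<in> hcarrier H \<and> (\<forall>z\<in>hcarrier H. hip H x z = hip H y (A z))))"

definition hconj :: "'v hspace \<Rightarrow> 'v hspace"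
  where "hconj H = H\<lparr>hscale := (\<lambda>c. hscale H (cnj c)), hip := (\<lambda>x y. hip H y x)\<rparr>"

text \<open>The complex conjugate of a representation \<open>\<pi>\<close> on \<open>H\<close> is given by the same maps \<open>\<pi> g\<close>,
  acting on \<open>hconj H\<close>.\<close>

definition hunitary :: "'v hspace \<Rightarrow> 'w hspace \<Rightarrow> ('v \<Rightarrow> 'w) \<Rightarrow> bool"
  where "hunitary H H' W \<longleftrightarrow> bij_betw W (hcarrier H) (hcarrier H') \<and>
    (\<forall>x\<in>hcarrier H. \<forall>y\<in>hcarrier H. W (hadd H x y) = hadd H' (W x) (W y)) \<and>
    (\<forall>x\<in>hcarrier H. \<forall>c. W (hscale H c x) = hscale H' c (W x)) \<and>
    (\<forall>x\<in>hcarrier H. \<forall>y\<in>hcarrier H. hip H' (W x) (W y) = hip H x y)"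

definition unitarily_equivalent ::
    "'g set \<Rightarrow> 'v hspace \<Rightarrow> ('g \<Rightarrow> 'v \<Rightarrow> 'v) \<Rightarrow> 'w hspace \<Rightarrow> ('g \<Rightarrow> 'w \<Rightarrow> 'w) \<Rightarrow> bool"
  where "unitarily_equivalent G H \<pi> H' \<pi>' \<longleftrightarrow>
    (\<exists>W. hunitary H H' W \<and> (\<forall>g\<in>G. \<forall>x\<in>hcarrier H. W (\<pi> g x) = \<pi>' g (W x)))"


section \<open>Antisymmetric Fock space\<close>

text \<open>The Hilbert tensor power $S^{\otimes n}$ is realized as the space of bounded multi-antilinear
  Hilbert--Schmidt forms on $S^n$, where $f_1 \otimes \dots \otimes f_n$ is the form
  $(g_1,\dots,g_n) \mapsto \langle g_1, f_1\rangle \cdots \langle g_n, f_n\rangle$; the inner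
  product is the sum over an orthonormal basis, whose choice is immaterial.  A vector of the
  antisymmetric Fock space is a function on lists whose restriction to lists of length \<open>n\<close> is its
  \<open>n\<close>-particle component.\<close>

type_synonym 'k fock = "'k list \<Rightarrow> complex"

definition some_onb :: "'k::chilbert_space set \<Rightarrow> 'k set"
  where "some_onb S = (SOME E. is_onb S E)"

definition fock_vectors :: "'k::chilbert_space set \<Rightarrow> 'k fock set"
  where "fock_vectors S = {\<Phi>.
    (\<forall>xs. \<not> set xs \<subseteq> S \<longrightarrow> \<Phi> xs = 0) \<and>
    (\<forall>xs\<in>lists S. \<forall>ys\<in>lists S. \<forall>x\<in>S. \<forall>y\<in>S.
      \<Phi> (xs @ (x + y) # ys) = \<Phi> (xs @ x # ys) + \<Phi> (xs @ y # ys)) \<and>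
    (\<forall>xs\<in>lists S. \<forall>ys\<in>lists S. \<forall>x\<in>S. \<forall>c. \<Phi> (xs @ (c *\<^sub>C x) # ys) = cnj c * \<Phi> (xs @ x # ys)) \<and>
    (\<forall>xs\<in>lists S. \<forall>ys\<in>lists S. \<forall>x\<in>S. \<forall>y\<in>S. \<Phi> (xs @ x # y # ys) = - \<Phi> (xs @ y # x # ys)) \<and>
    (\<forall>n. \<exists>M. \<forall>xs\<in>lists S. length xs = n \<longrightarrow> cmod (\<Phi> xs) \<le> M * prod_list (map norm xs)) \<and>
    (\<lambda>xs. cmod (\<Phi> xs) ^ 2) summable_on lists (some_onb S)}"

definition fock_space :: "'k::chilbert_space set \<Rightarrow> 'k fock hspace"
  where "fock_space S = \<lparr>hcarrier = fock_vectors S,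
    hadd = (\<lambda>\<Phi> \<Psi> xs. \<Phi> xs + \<Psi> xs),
    hscale = (\<lambda>c \<Phi> xs. c * \<Phi> xs),
    hip = (\<lambda>\<Phi> \<Psi>. \<Sum>\<^sub>\<infinity>xs\<in>lists (some_onb S). cnj (\<Phi> xs) * \<Psi> xs)\<rparr>"

text \<open>On tensors this is
  $a(f)\, f_1 \otimes \dots \otimes f_n = \sqrt n\, \langle f, f_1\rangle\, f_2 \otimes \dots \otimes f_n$.\<close>

definition annihilator :: "'k::chilbert_space set \<Rightarrow> 'k \<Rightarrow> 'k fock \<Rightarrow> 'k fock"
  where "annihilator S f = (\<lambda>\<Phi>\<in>fock_vectors S. \<lambda>xs. sqrt (real (length xs + 1)) * \<Phi> (f # xs))"

text \<open>On tensors this is $f_1 \otimes \dots \otimes f_n \mapsto U_{11} f_1 \otimes \dots \otimes U_{11} f_n$.\<close>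

definition second_quant :: "('k::chilbert_space \<Rightarrow> 'k) \<Rightarrow> ('k \<Rightarrow> 'k) \<Rightarrow> 'k fock \<Rightarrow> 'k fock"
  where "second_quant P1 U = (\<lambda>\<Phi>\<in>fock_vectors (range P1). \<lambda>xs.
    if set xs \<subseteq> range P1 then \<Phi> (map (adj (corner P1 U P1)) xs) else 0)"


section \<open>The CAR algebra, the Fock representation and implementers\<close>

definition CAR_algebra :: "('k::chilbert_space \<Rightarrow> 'k) \<Rightarrow> ('k \<Rightarrow> 'a::cstar_algebra) \<Rightarrow> bool"
  where "CAR_algebra J car \<longleftrightarrow> clinear car \<and>
    (\<forall>f. star (car f) = car (J f)) \<and>
    (\<forall>f g. star (car f) * car g + car g * star (car f) = cinner f g *\<^sub>C 1) \<and>
    (\<forall>S. 1 \<in> S \<and> range car \<subseteq> S \<and> (\<forall>x\<in>S. \<forall>y\<in>S. x + y \<in> S) \<and> (\<forall>x\<in>S. \<forall>c. c *\<^sub>C x \<in> S) \<and>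
      (\<forall>x\<in>S. \<forall>y\<in>S. x * y \<in> S) \<and> (\<forall>x\<in>S. star x \<in> S) \<and> closed S \<longrightarrow> S = UNIV)"

text \<open>Contractivity is automatic for *-homomorphisms between C*-algebras.\<close>

definition unital_star_endo :: "('a::cstar_algebra \<Rightarrow> 'a) \<Rightarrow> bool"
  where "unital_star_endo \<rho> \<longleftrightarrow> clinear \<rho> \<and> (\<forall>x y. \<rho> (x * y) = \<rho> x * \<rho> y) \<and> \<rho> 1 = 1 \<and>
    (\<forall>x. \<rho> (star x) = star (\<rho> x)) \<and> (\<forall>x. norm (\<rho> x) \<le> norm x)"

definition unital_star_rep :: "'v hspace \<Rightarrow> ('a::cstar_algebra \<Rightarrow> 'v \<Rightarrow> 'v) \<Rightarrow> bool"
  where "unital_star_rep H \<pi> \<longleftrightarrow> (\<forall>x. \<pi> x \<in> hbop H) \<and>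
    (\<forall>x y. \<forall>v\<in>hcarrier H. \<pi> (x + y) v = hadd H (\<pi> x v) (\<pi> y v)) \<and>
    (\<forall>c x. \<forall>v\<in>hcarrier H. \<pi> (c *\<^sub>C x) v = hscale H c (\<pi> x v)) \<and>
    (\<forall>x y. \<pi> (x * y) = hcomp H (\<pi> x) (\<pi> y)) \<and>
    (\<forall>v\<in>hcarrier H. \<pi> 1 v = v) \<and>
    (\<forall>x. \<pi> (star x) = hadj H (\<pi> x)) \<and>
    (\<forall>x. \<forall>v\<in>hcarrier H. hnorm H (\<pi> x v) \<le> norm x * hnorm H v)"

definition car_endo :: "('k::chilbert_space \<Rightarrow> 'a::cstar_algebra) \<Rightarrow> ('k \<Rightarrow> 'k) \<Rightarrow> 'a \<Rightarrow> 'a"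
  where "car_endo car V = (THE \<rho>. unital_star_endo \<rho> \<and> (\<forall>f. \<rho> (car f) = car (V f)))"

definition fock_rep :: "('k::chilbert_space \<Rightarrow> 'k) \<Rightarrow> ('k \<Rightarrow> 'k) \<Rightarrow> ('k \<Rightarrow> 'a::cstar_algebra) \<Rightarrow>
    'a \<Rightarrow> 'k fock \<Rightarrow> 'k fock"
  where "fock_rep J P1 car = (let S = range P1; F = fock_space S in
    (THE \<pi>. unital_star_rep F \<pi> \<and> (\<forall>f. \<forall>\<Phi>\<in>hcarrier F. \<pi> (car f) \<Phi> =
      hadd F (hadj F (annihilator S (P1 f)) \<Phi>) (annihilator S (P1 (J f)) \<Phi>))))"

text \<open>$H(\varrho_V)$ with inner product determined by
  $\langle\Psi,\Psi'\rangle \mathbf 1 = \Psi^* \Psi'$.\<close>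

definition implementer_space :: "('k::chilbert_space \<Rightarrow> 'k) \<Rightarrow> ('k \<Rightarrow> 'k) \<Rightarrow>
    ('k \<Rightarrow> 'a::cstar_algebra) \<Rightarrow> ('k \<Rightarrow> 'k) \<Rightarrow> ('k fock \<Rightarrow> 'k fock) hspace"
  where "implementer_space J P1 car V =
    (let F = fock_space (range P1); \<pi> = fock_rep J P1 car; \<rho> = car_endo car V in
    \<lparr>hcarrier = {\<Psi> \<in> hbop F. \<forall>x. hcomp F \<Psi> (\<pi> x) = hcomp F (\<pi> (\<rho> x)) \<Psi>},
     hadd = (\<lambda>\<Psi> \<Psi>'. \<lambda>\<Phi>\<in>hcarrier F. hadd F (\<Psi> \<Phi>) (\<Psi>' \<Phi>)),
     hscale = (\<lambda>c \<Psi>. \<lambda>\<Phi>\<in>hcarrier F. hscale F c (\<Psi> \<Phi>)),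
     hip = (\<lambda>\<Psi> \<Psi>'. the_or 0 (\<lambda>c. hcomp F (hadj F \<Psi>) \<Psi>' = (\<lambda>\<Phi>\<in>hcarrier F. hscale F c \<Phi>)))\<rparr>)"

definition gauge_action :: "('k::chilbert_space \<Rightarrow> 'k) \<Rightarrow> ('k \<Rightarrow> 'k) \<Rightarrow>
    ('k fock \<Rightarrow> 'k fock) \<Rightarrow> 'k fock \<Rightarrow> 'k fock"
  where "gauge_action P1 U \<Psi> = (let F = fock_space (range P1); \<Gamma> = second_quant P1 U in
    hcomp F \<Gamma> (hcomp F \<Psi> (hadj F \<Gamma>)))"


section \<open>Charge conjugation\<close>

text \<open>The Bogoliubov operators commuting with \<open>P\<close> whose restriction to the range of \<open>P\<close> has, with
  respect to the decomposition into the ranges of $p_+ = P P_1$ and $p_- = P P_2$, the off-diagonal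
  matrix with entries \<open>Cpm\<close> and its adjoint.\<close>

definition charge_conjugation :: "('k::chilbert_space \<Rightarrow> 'k) \<Rightarrow> ('k \<Rightarrow> 'k) \<Rightarrow> ('k \<Rightarrow> 'k) \<Rightarrow>
    ('k \<Rightarrow> 'k) \<Rightarrow> ('k \<Rightarrow> 'k) \<Rightarrow> bool"
  where "charge_conjugation J P1 P Cpm C \<longleftrightarrow>
    (let pp = P \<circ> P1; pm = P \<circ> compl P1 in
    C \<in> bogoliubov J \<and> C \<circ> P = P \<circ> C \<and>
    (\<forall>f. P (C (P f)) = Cpm (pm f) + adj_on (range pm) Cpm (pp f)))"

end

theory Submission
  imports Defs "HOL-Library.Function_Algebras"
begin

text \<open>The charge conjugation \<open>C\<close> exchanges the ranges of $P_1$ and $\mathbf 1 - P_1$, and so does the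
  complex conjugation \<open>J\<close>.  Hence $K = \mathcal C J$ is an antiunitary involution which commutes with
  $P_1$, with \<open>J\<close> and with the gauge group, and $V^c = \mathcal CV\mathcal C = KVK$ because Bogoliubov
  operators are real.  All assertions about $V^c$ are transport of structure along \<open>K\<close>.  For the
  spaces $\mathfrak h_V$ and $\mathfrak k_V$ and for the statistics dimension this is immediate, since
  they are built from $P_1$, $V$, \<open>J\<close> and the inner product alone (\<open>frak_h_bar\<close>, \<open>frak_k_bar\<close>,
  \<open>statistics_dim_bar\<close>).

  For the implementers, let $\Theta$ be the antiunitary second quantization of \<open>K\<close> on Fock space.  It
  satisfies $\Theta\,\pi_{P_1}(f)\,\Theta = \pi_{P_1}(Kf)$ and commutes with every $\Gamma(U)$.  Therefore
  $\Psi \mapsto \Theta\Psi\Theta$ maps $H(\varrho_{V^c})$ antiunitarily onto $H(\varrho_V)$ and intertwines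
  the two gauge actions (\<open>implementers_conjugate\<close>).

  This argument only looks at the generators of the CAR algebra.  That the intertwining relation on
  the whole algebra reduces to generators (\<open>implementer_carrier\<close>) presupposes that the Fock
  representation and the endomorphisms $\varrho_V$ exist, that is, the universal property of the CAR
  algebra.  It rests on one estimate (\<open>cl_contraction\<close>): a polynomial in the generators has no larger
  norm in a realization of the relations than in the given $C^*$-algebra.  In a Clifford algebra with
  finitely many generators the coefficients are controlled by the norm up to a factor depending on
  the number of generators, and the $C^*$-identity, applied to the powers
  $(x^*x)^{2^k}$, removes this factor.

  On Fock space, two facts carry the proof.  The square sum of a multi-antilinear form over an
  orthonormal basis does not depend on the basis (\<open>mform_basis_change\<close>), which makes $\Theta$ and
  $\Gamma(U)$ isometric.  The alternating sum which defines the creation operator is adjoint to the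
  annihilation operator at each particle number (\<open>cr_pairing\<close>), and together with the anticommutation
  relation this gives boundedness of both.  Adjoints of implementers come from the Riesz theorem, for
  which completeness of the Fock space is established.\<close>

section \<open>Hilbert spaces on a carrier set and the Riesz representation theorem\<close>

text \<open>The Riesz theorem is needed for $\mathcal K$, for its closed subspaces and for Fock space, so the
  Hilbert space structure is put on a subset of an abelian group.  Scalar multiplication is that of
  an ambient vector space, which leaves only membership side conditions to the axioms.\<close>

locale hilbert_on =
  fixes W :: "'w::ab_group_add set" and sc :: "complex \<Rightarrow> 'w \<Rightarrow> 'w" and ip :: "'w \<Rightarrow> 'w \<Rightarrow> complex"
  assumes vector_space_sc: "vector_space sc"
    and zero_mem: "0 \<in> W"
    and add_mem: "x \<in> W \<Longrightarrow> y \<in> W \<Longrightarrow> x + y \<in> W"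
    and sc_mem: "x \<in> W \<Longrightarrow> sc c x \<in> W"
    and ip_add_right: "x \<in> W \<Longrightarrow> y \<in> W \<Longrightarrow> z \<in> W \<Longrightarrow> ip x (y + z) = ip x y + ip x z"
    and ip_sc_right: "x \<in> W \<Longrightarrow> y \<in> W \<Longrightarrow> ip x (sc c y) = c * ip x y"
    and ip_commute: "x \<in> W \<Longrightarrow> y \<in> W \<Longrightarrow> ip y x = cnj (ip x y)"
    and ip_nonneg: "x \<in> W \<Longrightarrow> 0 \<le> Re (ip x x)"
    and ip_definite: "x \<in> W \<Longrightarrow> ip x x = 0 \<Longrightarrow> x = 0"
    and ip_complete: "(\<And>n. X n \<in> W) \<Longrightarrow>
      (\<And>e::real. e > 0 \<Longrightarrow> \<exists>N. \<forall>m\<ge>N. \<forall>n\<ge>N. sqrt (Re (ip (X m - X n) (X m - X n))) < e) \<Longrightarrow>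
      \<exists>x\<in>W. (\<lambda>n. sqrt (Re (ip (X n - x) (X n - x)))) \<longlonglongrightarrow> 0"
begin

sublocale vs: vector_space sc by (rule vector_space_sc)

definition nrm :: "'w \<Rightarrow> real" where "nrm x = sqrt (Re (ip x x))"

lemma minus_mem: "x \<in> W \<Longrightarrow> - x \<in> W"
  using sc_mem[of x "-1"] by simp

lemma diff_mem: "x \<in> W \<Longrightarrow> y \<in> W \<Longrightarrow> x - y \<in> W"
  using add_mem[of x "- y"] minus_mem by simp

lemma ip_add_left: "x \<in> W \<Longrightarrow> y \<in> W \<Longrightarrow> z \<in> W \<Longrightarrow> ip (x + y) z = ip x z + ip y z"
  by (metis add_mem complex_cnj_add ip_add_right ip_commute)

lemma ip_sc_left: "x \<in> W \<Longrightarrow> y \<in> W \<Longrightarrow> ip (sc c x) y = cnj c * ip x y"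
  by (metis complex_cnj_mult ip_commute ip_sc_right sc_mem)

lemma ip_minus_right: "x \<in> W \<Longrightarrow> y \<in> W \<Longrightarrow> ip x (- y) = - ip x y"
  using ip_sc_right[of x y "-1"] by simp

lemma ip_minus_left: "x \<in> W \<Longrightarrow> y \<in> W \<Longrightarrow> ip (- x) y = - ip x y"
  using ip_sc_left[of x y "-1"] by simp

lemma ip_diff_right: "x \<in> W \<Longrightarrow> y \<in> W \<Longrightarrow> z \<in> W \<Longrightarrow> ip x (y - z) = ip x y - ip x z"
  using ip_add_right[of x y "- z"] by (simp add: minus_mem ip_minus_right)

lemma ip_diff_left: "x \<in> W \<Longrightarrow> y \<in> W \<Longrightarrow> z \<in> W \<Longrightarrow> ip (x - y) z = ip x z - ip y z"
  using ip_add_left[of x "- y" z] by (simp add: minus_mem ip_minus_left)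

lemma ip_zero_right: "x \<in> W \<Longrightarrow> ip x 0 = 0"
  using ip_sc_right[of x 0 0] zero_mem by simp

lemma ip_zero_left: "x \<in> W \<Longrightarrow> ip 0 x = 0"
  using ip_sc_left[of 0 x 0] zero_mem by simp

lemma Im_ip_self: "x \<in> W \<Longrightarrow> Im (ip x x) = 0"
  using ip_commute[of x x] by (metis Reals_cnj_iff complex_is_Real_iff)

lemma nrm_nonneg: "x \<in> W \<Longrightarrow> 0 \<le> nrm x"
  by (simp add: nrm_def ip_nonneg)

lemma nrm_sq: "x \<in> W \<Longrightarrow> (nrm x)\<^sup>2 = Re (ip x x)"
  by (simp add: nrm_def ip_nonneg)

lemma ip_self: "x \<in> W \<Longrightarrow> ip x x = complex_of_real ((nrm x)\<^sup>2)"
  by (simp add: nrm_sq complex_eq_iff Im_ip_self del: of_real_power)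

lemma nrm_eq_0: "x \<in> W \<Longrightarrow> nrm x = 0 \<Longrightarrow> x = 0"
  using ip_definite[of x] ip_self[of x] by simp

lemma nrm_sc: "x \<in> W \<Longrightarrow> nrm (sc c x) = cmod c * nrm x"
proof -
  assume x: "x \<in> W"
  have "ip (sc c x) (sc c x) = (c * cnj c) * ip x x"
    using x by (simp add: ip_sc_left ip_sc_right sc_mem)
  also have "\<dots> = complex_of_real ((cmod c)\<^sup>2 * (nrm x)\<^sup>2)"
    by (simp only: ip_self[OF x] complex_norm_square[symmetric] of_real_mult)
  finally have "Re (ip (sc c x) (sc c x)) = (cmod c * nrm x)\<^sup>2"
    by (simp only: Re_complex_of_real power_mult_distrib)
  then show ?thesis
    using nrm_nonneg[OF x] by (simp add: nrm_def[of "sc c x"])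
qed

lemma nrm_minus: "x \<in> W \<Longrightarrow> nrm (- x) = nrm x"
  using nrm_sc[of x "-1"] by simp

lemma nrm_sq_add: "x \<in> W \<Longrightarrow> y \<in> W \<Longrightarrow> (nrm (x + y))\<^sup>2 = (nrm x)\<^sup>2 + (nrm y)\<^sup>2 + 2 * Re (ip x y)"
  using ip_commute[of x y]
  by (simp add: nrm_sq add_mem ip_add_left ip_add_right)

lemma nrm_sq_diff: "x \<in> W \<Longrightarrow> y \<in> W \<Longrightarrow> (nrm (x - y))\<^sup>2 = (nrm x)\<^sup>2 + (nrm y)\<^sup>2 - 2 * Re (ip x y)"
  using nrm_sq_add[of x "- y"] by (simp add: minus_mem nrm_minus ip_minus_right)

lemma Re_ip_le: assumes "x \<in> W" "y \<in> W" shows "Re (ip x y) \<le> nrm x * nrm y"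
proof (cases "nrm x = 0 \<or> nrm y = 0")
  case True
  then show ?thesis using assms nrm_eq_0 ip_zero_left ip_zero_right by fastforce
next
  case False
  then have pos: "nrm x > 0" "nrm y > 0" using nrm_nonneg assms by fastforce+
  have "0 \<le> (nrm (sc (nrm y) x - sc (nrm x) y))\<^sup>2" by simp
  also have "\<dots> = 2 * (nrm x * nrm y) * (nrm x * nrm y - Re (ip x y))"
    using assms pos
    by (subst nrm_sq_diff) (auto simp: sc_mem nrm_sc ip_sc_left ip_sc_right power2_eq_square algebra_simps)
  finally show ?thesis using mult_pos_pos[OF pos] by (simp add: zero_le_mult_iff)
qed

lemma cauchy_schwarz: assumes "x \<in> W" "y \<in> W" shows "cmod (ip x y) \<le> nrm x * nrm y"
proof (cases "ip x y = 0")
  case True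
  then show ?thesis using assms nrm_nonneg by simp
next
  case False
  define u where "u = cnj (sgn (ip x y))"
  have u: "cmod u = 1" using False by (simp add: u_def norm_sgn)
  have "ip x (sc u y) = complex_of_real (cmod (ip x y))"
    using assms False complex_norm_square[of "ip x y"]
    by (simp add: ip_sc_right u_def sgn_eq power2_eq_square mult.commute nonzero_divide_eq_eq)
  then have "cmod (ip x y) \<le> nrm x * nrm (sc u y)"
    using Re_ip_le[of x "sc u y"] assms by (simp add: sc_mem)
  then show ?thesis using assms u by (simp add: nrm_sc)
qed

lemma nrm_triangle: assumes "x \<in> W" "y \<in> W" shows "nrm (x + y) \<le> nrm x + nrm y"
proof (rule power2_le_imp_le)
  show "(nrm (x + y))\<^sup>2 \<le> (nrm x + nrm y)\<^sup>2"
    using Re_ip_le[OF assms] by (simp add: nrm_sq_add assms power2_sum)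
qed (use assms nrm_nonneg in auto)

lemma ip_eqI: assumes "x \<in> W" "y \<in> W" "\<And>z. z \<in> W \<Longrightarrow> ip x z = ip y z" shows "x = y"
proof -
  have "ip (x - y) (x - y) = 0" using assms by (simp add: ip_diff_left diff_mem)
  then show ?thesis using ip_definite[of "x - y"] assms by (simp add: diff_mem)
qed

lemma ip_tendsto_left:
  assumes "\<And>n. X n \<in> W" "x \<in> W" "z \<in> W" "(\<lambda>n. nrm (X n - x)) \<longlonglongrightarrow> 0"
  shows "(\<lambda>n. ip (X n) z) \<longlonglongrightarrow> ip x z"
proof -
  have "(\<lambda>n. ip (X n) z - ip x z) \<longlonglongrightarrow> 0"
  proof (rule Lim_null_comparison)
    show "\<forall>\<^sub>F n in sequentially. norm (ip (X n) z - ip x z) \<le> nrm (X n - x) * nrm z"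
      using assms cauchy_schwarz[OF diff_mem[OF assms(1) assms(2)] assms(3)]
      by (auto simp: ip_diff_left intro!: always_eventually)
    show "(\<lambda>n. nrm (X n - x) * nrm z) \<longlonglongrightarrow> 0"
      using tendsto_mult_right[OF assms(4), of "nrm z"] by simp
  qed
  then show ?thesis by (simp add: LIM_zero_iff)
qed

text \<open>A minimizing sequence of $x \mapsto \Vert x\Vert^2 - 2\,\mathrm{Re}\,\varphi(x)$ is Cauchy by the
  parallelogram law, and its limit represents $\varphi$ by the vanishing of the first variation.\<close>

lemma riesz_representation:
  assumes add: "\<And>x y. x \<in> W \<Longrightarrow> y \<in> W \<Longrightarrow> \<phi> (x + y) = \<phi> x + \<phi> y"
    and hom: "\<And>c x. x \<in> W \<Longrightarrow> \<phi> (sc c x) = c * \<phi> x"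
    and bdd: "\<And>x. x \<in> W \<Longrightarrow> cmod (\<phi> x) \<le> M * nrm x"
  shows "\<exists>!w. w \<in> W \<and> (\<forall>z\<in>W. ip w z = \<phi> z)"
proof -
  define q where "q x = (nrm x)\<^sup>2 - 2 * Re (\<phi> x)" for x
  have lower: "q x \<ge> - (M\<^sup>2)" if x: "x \<in> W" for x
  proof -
    have "Re (\<phi> x) \<le> M * nrm x" using bdd[OF x] complex_Re_le_cmod order_trans by blast
    moreover have "0 \<le> (nrm x - M)\<^sup>2" by simp
    ultimately show ?thesis by (simp add: q_def power2_eq_square algebra_simps)
  qed
  define m where "m = Inf (q ` W)"
  have bb: "bdd_below (q ` W)" using lower by (auto simp: bdd_below_def)
  have m_le: "m \<le> q x" if "x \<in> W" for x
    unfolding m_def using bb that by (auto intro: cInf_lower)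
  have "\<exists>x\<in>W. q x < m + 1 / real (Suc n)" for n
  proof -
    have "\<exists>y\<in>q ` W. y < m + 1 / real (Suc n)"
      unfolding m_def by (rule cInf_lessD) (use zero_mem in auto)
    then show ?thesis by blast
  qed
  then obtain X where X: "\<And>n. X n \<in> W" "\<And>n. q (X n) < m + 1 / real (Suc n)" by metis
  have par: "(nrm (x - y))\<^sup>2 = 2 * q x + 2 * q y - 4 * q (sc (1/2) (x + y))" if "x \<in> W" "y \<in> W" for x y
  proof -
    have "4 * (nrm (sc (1/2) (x + y)))\<^sup>2 = (nrm (x + y))\<^sup>2"
      using that by (simp add: nrm_sc add_mem power_divide)
    moreover have "2 * Re (\<phi> (sc (1/2) (x + y))) = Re (\<phi> x) + Re (\<phi> y)"
      using that by (simp add: hom add add_mem)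
    ultimately show ?thesis using that by (simp add: q_def nrm_sq_add nrm_sq_diff)
  qed
  have close: "(nrm (X i - X j))\<^sup>2 < 2 / real (Suc i) + 2 / real (Suc j)" for i j
  proof -
    have "m \<le> q (sc (1/2) (X i + X j))" by (rule m_le) (simp add: X add_mem sc_mem)
    moreover have "a + b - c < 2 / real (Suc i) + 2 / real (Suc j)"
      if "a = 2 * q (X i)" "b = 2 * q (X j)" "4 * m \<le> c" for a b c
    proof -
      have "2 * q (X i) < 2 * m + 2 / real (Suc i)" "2 * q (X j) < 2 * m + 2 / real (Suc j)"
        using X(2)[of i] X(2)[of j] by (auto simp: field_simps)
      then show ?thesis using that by linarith
    qed
    ultimately show ?thesis using par[OF X(1) X(1), of i j] by simp
  qed
  have "\<exists>x\<in>W. (\<lambda>n. sqrt (Re (ip (X n - x) (X n - x)))) \<longlonglongrightarrow> 0"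
  proof (rule ip_complete)
    fix e :: real assume e: "e > 0"
    obtain N where N: "4 / e\<^sup>2 < real N" using reals_Archimedean2 by blast
    have "nrm (X i - X j) < e" if "i \<ge> N" "j \<ge> N" for i j
    proof -
      have Np: "real N > 0" using N e by (smt (verit) divide_nonneg_nonneg zero_le_power2)
      have "(nrm (X i - X j))\<^sup>2 < 2 / real (Suc i) + 2 / real (Suc j)" by (rule close)
      also have "\<dots> \<le> 2 / real N + 2 / real N"
        using that Np by (intro add_mono frac_le) auto
      also have "\<dots> < e\<^sup>2" using N Np e by (simp add: field_simps)
      finally show ?thesis using e by (simp add: power_less_imp_less_base)
    qed
    then show "\<exists>N. \<forall>m\<ge>N. \<forall>n\<ge>N. sqrt (Re (ip (X m - X n) (X m - X n))) < e"
      unfolding nrm_def by blast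
  qed (rule X)
  then obtain w where w: "w \<in> W" "(\<lambda>n. nrm (X n - w)) \<longlonglongrightarrow> 0" unfolding nrm_def by blast
  have Re_eq: "Re (ip w z) = Re (\<phi> z)" if z: "z \<in> W" for z
  proof -
    define b where "b = Re (ip w z) - Re (\<phi> z)"
    have var: "0 \<le> t\<^sup>2 * (nrm z)\<^sup>2 + 2 * t * b" for t :: real
    proof -
      have ge: "t\<^sup>2 * (nrm z)\<^sup>2 + 2 * t * (Re (ip (X n) z) - Re (\<phi> z)) \<ge> - (1 / real (Suc n))" for n
      proof -
        have "m \<le> q (X n + sc t z)" by (rule m_le) (simp add: X add_mem sc_mem z)
        also have "\<dots> = q (X n) + t\<^sup>2 * (nrm z)\<^sup>2 + 2 * t * (Re (ip (X n) z) - Re (\<phi> z))"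
          using X(1)[of n] z
          by (simp add: q_def nrm_sq_add sc_mem add hom nrm_sc ip_sc_right power_mult_distrib algebra_simps)
        finally show ?thesis using X(2)[of n] by simp
      qed
      have "(\<lambda>n. - (1 / real (Suc n))) \<longlonglongrightarrow> - 0"
        using LIMSEQ_inverse_real_of_nat by (intro tendsto_minus) (simp add: inverse_eq_divide)
      moreover have "(\<lambda>n. t\<^sup>2 * (nrm z)\<^sup>2 + 2 * t * (Re (ip (X n) z) - Re (\<phi> z)))
          \<longlonglongrightarrow> t\<^sup>2 * (nrm z)\<^sup>2 + 2 * t * b"
        unfolding b_def by (intro tendsto_intros ip_tendsto_left X w z)
      ultimately have "- 0 \<le> t\<^sup>2 * (nrm z)\<^sup>2 + 2 * t * b" by (rule LIMSEQ_le) (use ge in auto)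
      then show ?thesis by simp
    qed
    define a where "a = (nrm z)\<^sup>2"
    have a: "a \<ge> 0" by (simp add: a_def)
    \<comment> \<open>At \<open>t = - s * b\<close> the quadratic polynomial in \<open>t\<close> is negative unless \<open>b = 0\<close>.\<close>
    define s where "s = 1 / (a + 1)"
    have s: "s > 0" "s * a = 1 - s" using a by (auto simp: s_def field_simps)
    have "0 \<le> (- s * b)\<^sup>2 * a + 2 * (- s * b) * b" using var unfolding a_def .
    also have "\<dots> = s * b\<^sup>2 * (s * a - 2)" by (simp add: algebra_simps power2_eq_square)
    also have "s * a - 2 = - (1 + s)" by (simp add: s(2))
    also have "s * b\<^sup>2 * (- (1 + s)) = - (s * (1 + s) * b\<^sup>2)" by (simp add: algebra_simps)
    finally have "s * (1 + s) * b\<^sup>2 \<le> 0" by simp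
    moreover have "s * (1 + s) > 0" using s(1) by simp
    ultimately have "b = 0" by (metis mult_le_cancel_left_pos mult_zero_right power2_less_eq_zero_iff)
    then show ?thesis by (simp add: b_def)
  qed
  have rep: "ip w z = \<phi> z" if z: "z \<in> W" for z
  proof (rule complex_eqI)
    show "Re (ip w z) = Re (\<phi> z)" by (rule Re_eq[OF z])
    have "Re (ip w (sc \<i> z)) = Re (\<phi> (sc \<i> z))" by (rule Re_eq[OF sc_mem[OF z]])
    then show "Im (ip w z) = Im (\<phi> z)" using w z by (simp add: ip_sc_right hom)
  qed
  show ?thesis
  proof (rule ex1I)
    show "w \<in> W \<and> (\<forall>z\<in>W. ip w z = \<phi> z)" using w rep by blast
    show "w' = w" if "w' \<in> W \<and> (\<forall>z\<in>W. ip w' z = \<phi> z)" for w'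
      using that w rep by (intro ip_eqI) auto
  qed
qed

text \<open>By polarization, a norm-preserving antilinear map is antiunitary.\<close>

lemma antilinear_isometry_ip:
  assumes mem: "\<And>x. x \<in> W \<Longrightarrow> T x \<in> W"
    and add: "\<And>x y. x \<in> W \<Longrightarrow> y \<in> W \<Longrightarrow> T (x + y) = T x + T y"
    and hom: "\<And>c x. x \<in> W \<Longrightarrow> T (sc c x) = sc (cnj c) (T x)"
    and iso: "\<And>x. x \<in> W \<Longrightarrow> nrm (T x) = nrm x"
    and x: "x \<in> W" and y: "y \<in> W"
  shows "ip (T x) (T y) = cnj (ip x y)"
proof -
  have Re: "Re (ip (T x) (T y)) = Re (ip x y)" if "x \<in> W" "y \<in> W" for x y
    using nrm_sq_add[of "T x" "T y"] nrm_sq_add[of x y] that iso[of "x + y"]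
    by (simp add: mem add iso add_mem)
  have "Re (ip (T x) (T (sc \<i> y))) = Re (ip x (sc \<i> y))" using x y Re sc_mem by blast
  moreover have "ip (T x) (T (sc \<i> y)) = - \<i> * ip (T x) (T y)"
    using x y ip_sc_right[OF mem[OF x] mem[OF y], of "- \<i>"] by (simp add: hom)
  ultimately show ?thesis using Re[OF x y] x y by (simp add: complex_eq_iff ip_sc_right)
qed

end

section \<open>Operators, adjoints and orthonormal bases\<close>

lemma norm_eq_sqrt_cinner: "norm (x::'k::chilbert_space) = sqrt (Re (cinner x x))"
  by (simp add: norm_eq_sqrt_inner inner_eq_Re_cinner)

lemma hilbert_on_closed_subspace:
  fixes S :: "'k::chilbert_space set"
  assumes "closed S" "0 \<in> S" "\<And>x y. x \<in> S \<Longrightarrow> y \<in> S \<Longrightarrow> x + y \<in> S" "\<And>c x. x \<in> S \<Longrightarrow> c *\<^sub>C x \<in> S"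
  shows "hilbert_on S scaleC cinner"
proof
  fix x :: 'k
  show "0 \<le> Re (cinner x x)" by (simp flip: inner_eq_Re_cinner)
  show "x = 0" if "cinner x x = 0" using that inner_eq_Re_cinner[of x x] by simp
next
  fix X :: "nat \<Rightarrow> 'k"
  assume X: "\<And>n. X n \<in> S"
    and C: "\<And>e. e > 0 \<Longrightarrow> \<exists>N. \<forall>m\<ge>N. \<forall>n\<ge>N. sqrt (Re (cinner (X m - X n) (X m - X n))) < e"
  have "Cauchy X" using C by (auto simp: Cauchy_def dist_norm norm_eq_sqrt_cinner)
  then obtain x where x: "X \<longlonglongrightarrow> x" using Cauchy_convergent convergent_def by blast
  then have "x \<in> S" using assms(1) X closed_sequentially by blast
  then show "\<exists>x\<in>S. (\<lambda>n. sqrt (Re (cinner (X n - x) (X n - x)))) \<longlonglongrightarrow> 0"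
    unfolding norm_eq_sqrt_cinner[symmetric] using tendsto_norm_zero[OF LIM_zero[OF x]] by blast
qed (use assms in \<open>auto simp: cinner_add_right cinner_scaleC_right intro: cinner_commute cvec.vector_space_axioms
   scaleC_add_right scaleC_add_left scaleC_scaleC scaleC_one\<close>)

global_interpretation chs: hilbert_on "UNIV :: 'k::chilbert_space set" scaleC cinner
  by (rule hilbert_on_closed_subspace) auto

lemma nrm_eq_norm: "hilbert_on.nrm cinner = (norm :: 'k::chilbert_space \<Rightarrow> real)"
  by (rule ext) (simp add: chs.nrm_def norm_eq_sqrt_cinner)

lemmas cinner_add_left = chs.ip_add_left[OF UNIV_I UNIV_I UNIV_I]
lemmas cinner_scaleC_left = chs.ip_sc_left[OF UNIV_I UNIV_I]
lemmas cinner_minus_right = chs.ip_minus_right[OF UNIV_I UNIV_I]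
lemmas cinner_minus_left = chs.ip_minus_left[OF UNIV_I UNIV_I]
lemmas cinner_diff_right = chs.ip_diff_right[OF UNIV_I UNIV_I UNIV_I]
lemmas cinner_diff_left = chs.ip_diff_left[OF UNIV_I UNIV_I UNIV_I]
lemmas cinner_zero_right = chs.ip_zero_right[OF UNIV_I]
lemmas cinner_zero_left = chs.ip_zero_left[OF UNIV_I]
lemmas cinner_self = chs.ip_self[OF UNIV_I, unfolded nrm_eq_norm]
lemmas norm_scaleC_hilbert = chs.nrm_sc[OF UNIV_I, unfolded nrm_eq_norm]
lemmas cinner_cauchy_schwarz = chs.cauchy_schwarz[OF UNIV_I UNIV_I, unfolded nrm_eq_norm]
lemmas norm_sq_add = chs.nrm_sq_add[OF UNIV_I UNIV_I, unfolded nrm_eq_norm]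
lemmas cinner_eqI = chs.ip_eqI[OF UNIV_I UNIV_I]

lemmas cinner_simps = cinner_add_left cinner_add_right cinner_scaleC_left cinner_scaleC_right
  cinner_minus_left cinner_minus_right cinner_diff_left cinner_diff_right cinner_zero_left
  cinner_zero_right

lemma cinner_sum_right: "cinner (x::'k::chilbert_space) (sum f A) = (\<Sum>i\<in>A. cinner x (f i))"
  by (induction A rule: infinite_finite_induct) (auto simp: cinner_simps)

lemma cinner_sum_left: "cinner (sum f A) (x::'k::chilbert_space) = (\<Sum>i\<in>A. cinner (f i) x)"
  by (induction A rule: infinite_finite_induct) (auto simp: cinner_simps)

lemma bounded_linear_cinner_right: "bounded_linear (cinner (x::'k::chilbert_space))"
proof (rule bounded_linear_intro[of _ "norm x"])
  show "cinner x (r *\<^sub>R y) = r *\<^sub>R cinner x y" for r y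
    by (simp add: scaleR_eq_scaleC cinner_scaleC_right scaleR_conv_of_real)
  show "norm (cinner x y) \<le> norm y * norm x" for y
    using cinner_cauchy_schwarz[of x y] by (simp add: mult.commute)
qed (simp add: cinner_add_right)

lemma norm_eq_if_cinner_eq: "cinner x x = cinner y y \<Longrightarrow> norm x = norm y"
  by (simp add: norm_eq_sqrt_cinner)

lemma the_or_eqI: "Q x \<Longrightarrow> (\<And>y. Q y \<Longrightarrow> y = x) \<Longrightarrow> the_or d Q = x"
  unfolding the_or_def by (metis the_equality)

text \<open>Definite descriptions are natural under an involutive change of variable; if they fail, the
  default value is returned on both sides, and the involution fixes it.\<close>

lemma the_or_involution:
  assumes "\<And>x. k (k x) = x" "k d = d" "\<And>x. Q' x \<longleftrightarrow> Q (k x)"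
  shows "the_or d Q' = k (the_or d Q)"
proof -
  have ex: "(\<exists>!x. Q' x) \<longleftrightarrow> (\<exists>!x. Q x)" by (metis assms(1,3))
  show ?thesis
  proof (cases "\<exists>!x. Q x")
    case True
    then obtain x where x: "Q x" "\<And>y. Q y \<Longrightarrow> y = x" by blast
    have "the_or d Q = x" using x by (rule the_or_eqI)
    moreover have "the_or d Q' = k x" by (rule the_or_eqI) (use x assms in metis)+
    ultimately show ?thesis by simp
  next
    case False
    then show ?thesis using ex assms(2) by (simp add: the_or_def)
  qed
qed

subsection \<open>Bounded operators\<close>

lemma bop_add: "A \<in> bop \<Longrightarrow> A (x + y) = A x + A y"
  by (simp add: bop_def linear_add bounded_linear.linear)

lemma bop_scaleC: "A \<in> bop \<Longrightarrow> A (c *\<^sub>C x) = c *\<^sub>C A x"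
  by (simp add: bop_def Vector_Spaces.linear_iff)

lemma bop_zero: "A \<in> bop \<Longrightarrow> A 0 = 0"
  using bop_scaleC[of A 0 0] by simp

lemma bop_minus: "A \<in> bop \<Longrightarrow> A (- x) = - A x"
  using bop_scaleC[of A "-1" x] by simp

lemma bop_diff: "A \<in> bop \<Longrightarrow> A (x - y) = A x - A y"
  using bop_add[of A x "- y"] by (simp add: bop_minus)

lemma bop_bound: "A \<in> bop \<Longrightarrow> \<exists>M. M \<ge> 0 \<and> (\<forall>x. norm (A x) \<le> M * norm x)"
  unfolding bop_def using bounded_linear.nonneg_bounded[of A] by (auto simp: mult.commute)

lemma bopI:
  assumes "\<And>x y. A (x + y) = A x + A y" "\<And>c x. A (c *\<^sub>C x) = c *\<^sub>C A x" "\<And>x. norm (A x) \<le> M * norm x"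
  shows "A \<in> bop"
proof -
  have "bounded_linear A"
    by (rule bounded_linear_intro[of _ M]) (use assms in \<open>auto simp: scaleR_eq_scaleC mult.commute\<close>)
  moreover have "clinear A"
    by (simp add: Vector_Spaces.linear_iff cvec.vector_space_axioms assms)
  ultimately show ?thesis by (simp add: bop_def)
qed

lemma bop_comp: assumes "A \<in> bop" "B \<in> bop" shows "A \<circ> B \<in> bop"
proof -
  obtain M N where M: "M \<ge> 0" "\<And>x. norm (A x) \<le> M * norm x" and N: "\<And>x. norm (B x) \<le> N * norm x"
    using assms bop_bound by metis
  show ?thesis
  proof (rule bopI[of _ "M * N"])
    show "norm ((A \<circ> B) x) \<le> M * N * norm x" for x
      using M(2)[of "B x"] mult_left_mono[OF N[of x] M(1)] by simp
  qed (use assms in \<open>auto simp: bop_add bop_scaleC\<close>)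
qed

lemma bop_compl: assumes "A \<in> bop" shows "compl A \<in> bop"
proof -
  obtain M where M: "\<And>x. norm (A x) \<le> M * norm x" using assms bop_bound by metis
  show ?thesis
  proof (rule bopI[of _ "1 + M"])
    show "norm (compl A x) \<le> (1 + M) * norm x" for x
      using norm_triangle_ineq4[of x "A x"] M[of x] by (simp add: compl_def algebra_simps)
  qed (use assms in \<open>auto simp: bop_add bop_scaleC compl_def cvec.scale_right_diff_distrib\<close>)
qed

lemma adj_eqI: "(\<And>z. cinner x z = cinner y (A z)) \<Longrightarrow> adj A y = x"
  unfolding adj_def by (rule the_or_eqI) (auto intro: cinner_eqI)

lemma cinner_adj: assumes "A \<in> bop" shows "cinner (adj A y) z = cinner y (A z)"
proof -
  obtain M where M: "M \<ge> 0" "\<And>x. norm (A x) \<le> M * norm x" using assms bop_bound by metis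
  have "\<exists>!w. w \<in> UNIV \<and> (\<forall>z\<in>UNIV. cinner w z = cinner y (A z))"
  proof (rule chs.riesz_representation[of _ "norm y * M", unfolded nrm_eq_norm])
    show "cmod (cinner y (A x)) \<le> norm y * M * norm x" for x
      using cinner_cauchy_schwarz[of y "A x"] mult_left_mono[OF M(2)[of x], of "norm y"]
      by (simp add: mult.assoc)
  qed (use assms in \<open>auto simp: bop_add bop_scaleC cinner_simps\<close>)
  then show ?thesis using adj_eqI[of _ y A] by fastforce
qed

lemma cinner_adj_right: "A \<in> bop \<Longrightarrow> cinner y (adj A z) = cinner (A y) z"
  by (metis cinner_adj cinner_commute)

lemma adj_bop: assumes "A \<in> bop" shows "adj A \<in> bop"
proof -
  obtain M where M: "M \<ge> 0" "\<And>x. norm (A x) \<le> M * norm x" using assms bop_bound by metis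
  show ?thesis
  proof (rule bopI[of _ M])
    fix x y c
    show "adj A (x + y) = adj A x + adj A y"
      by (rule adj_eqI) (simp add: cinner_simps cinner_adj assms)
    show "adj A (c *\<^sub>C x) = c *\<^sub>C adj A x"
      by (rule adj_eqI) (simp add: cinner_simps cinner_adj assms)
    have "cmod (cinner (adj A x) (adj A x)) \<le> norm x * (M * norm (adj A x))"
      unfolding cinner_adj[OF assms]
      using cinner_cauchy_schwarz[of x] mult_left_mono[OF M(2)] norm_ge_zero order_trans by blast
    then have "norm (adj A x) * norm (adj A x) \<le> M * norm x * norm (adj A x)"
      by (simp add: cinner_self power2_eq_square norm_mult ac_simps)
    then show "norm (adj A x) \<le> M * norm x"
      using M(1) by (cases "norm (adj A x) = 0") auto
  qed
qed

lemma adj_comp: "A \<in> bop \<Longrightarrow> B \<in> bop \<Longrightarrow> adj (A \<circ> B) = adj B \<circ> adj A"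
  by (rule ext, rule adj_eqI) (simp add: cinner_adj)

lemma isometry_iff:
  assumes "A \<in> bop" shows "adj A \<circ> A = id \<longleftrightarrow> (\<forall>x y. cinner (A x) (A y) = cinner x y)"
proof
  show "\<forall>x y. cinner (A x) (A y) = cinner x y" if "adj A \<circ> A = id"
    using that assms by (metis cinner_adj_right comp_apply id_apply)
  show "adj A \<circ> A = id" if *: "\<forall>x y. cinner (A x) (A y) = cinner x y"
  proof (rule ext)
    fix x show "(adj A \<circ> A) x = id x"
      by (simp add: o_def) (rule adj_eqI, simp add: *)
  qed
qed

subsection \<open>Antiunitary involutions\<close>

text \<open>An antiunitary involution \<open>K\<close> acts on subsets by images and on operators by
  $A \mapsto KAK$, which is \<open>bar K A\<close>.  The operators attached to a Bogoliubov operator are definite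
  descriptions in terms of the vector space operations and the inner product; they are therefore
  equivariant under this action.\<close>

context
  fixes K :: "'k::chilbert_space \<Rightarrow> 'k"
  assumes K: "complex_conjugation K"
begin

lemma conj_add: "K (x + y) = K x + K y" using K by (simp add: complex_conjugation_def)
lemma conj_scaleC: "K (c *\<^sub>C x) = cnj c *\<^sub>C K x" using K by (simp add: complex_conjugation_def)
lemma conj_conj: "K (K x) = x" using K by (simp add: complex_conjugation_def)
lemma cinner_conj: "cinner (K x) (K y) = cinner y x" using K by (simp add: complex_conjugation_def)
lemma cinner_conj_left: "cinner (K x) y = cinner (K y) x" by (metis cinner_conj conj_conj)
lemma conj_zero: "K 0 = 0" using conj_scaleC[of 0 0] by simp
lemma conj_minus: "K (- x) = - K x" using conj_scaleC[of "-1" x] by simp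
lemma conj_diff: "K (x - y) = K x - K y" using conj_add[of x "- y"] by (simp add: conj_minus)
lemma norm_conj: "norm (K x) = norm x"
  by (rule norm_eq_if_cinner_eq) (simp add: cinner_conj)
lemma conj_eq_iff: "K x = y \<longleftrightarrow> x = K y" by (metis conj_conj)
lemma mem_conj_image: "x \<in> K ` S \<longleftrightarrow> K x \<in> S" by (metis conj_conj image_iff)
lemma conj_image_conj_image: "K ` K ` S = S" by (simp add: image_image conj_conj)

lemma bar_bar: "bar K (bar K A) = A" by (rule ext) (simp add: bar_def conj_conj)

lemma bar_comp: "bar K (A \<circ> B) = bar K A \<circ> bar K B" by (rule ext) (simp add: bar_def conj_conj)

lemma range_bar: "range (bar K A) = K ` range A"
  by (auto simp: bar_def image_iff) (metis conj_conj)

lemma compl_bar: "compl (bar K A) = bar K (compl A)"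
  by (rule ext) (simp add: compl_def bar_def conj_diff conj_conj)

lemma corner_bar: "corner (bar K P) (bar K A) (bar K Q) = bar K (corner P A Q)"
  by (simp add: corner_def bar_comp)

lemma ker_on_bar: "ker_on (K ` S) (bar K A) = K ` ker_on S A"
  unfolding ker_on_def bar_def by (auto simp: mem_conj_image conj_eq_iff[of "A _"] conj_zero conj_conj)

lemma adj_bar: "adj (bar K A) = bar K (adj A)"
proof (rule ext)
  fix y
  have "the_or 0 (\<lambda>x. \<forall>z. cinner x z = cinner y (bar K A z)) =
        K (the_or 0 (\<lambda>x. \<forall>z. cinner x z = cinner (K y) (A z)))"
  proof (rule the_or_involution)
    fix x
    have "cinner x (K z) = cinner y (bar K A (K z)) \<longleftrightarrow> cinner (K x) z = cinner (K y) (A z)" for z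
      using cinner_conj[of "K x" z] cinner_conj[of "K y" "A z"]
      by (simp add: bar_def conj_conj) (metis cinner_commute)
    then show "(\<forall>z. cinner x z = cinner y (bar K A z)) \<longleftrightarrow> (\<forall>z. cinner (K x) z = cinner (K y) (A z))"
      by (metis conj_conj)
  qed (simp_all add: conj_conj conj_zero)
  then show "adj (bar K A) y = bar K (adj A) y" by (simp add: adj_def bar_def)
qed

lemma orth_proj_bar: "orth_proj (K ` S) = bar K (orth_proj S)"
proof (rule ext)
  fix x
  have "the_or 0 (\<lambda>y. y \<in> K ` S \<and> (\<forall>s\<in>K ` S. cinner s (x - y) = 0)) =
        K (the_or 0 (\<lambda>y. y \<in> S \<and> (\<forall>s\<in>S. cinner s (K x - y) = 0)))"
  proof (rule the_or_involution)
    fix y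
    have "cinner (K s) (x - y) = 0 \<longleftrightarrow> cinner s (K x - K y) = 0" for s
      using cinner_conj[of s "K (x - y)"] cinner_commute[of s "K x - K y"]
      by (simp add: conj_conj) (metis complex_cnj_zero_iff conj_diff)
    then show "(y \<in> K ` S \<and> (\<forall>s\<in>K ` S. cinner s (x - y) = 0)) \<longleftrightarrow>
        (K y \<in> S \<and> (\<forall>s\<in>S. cinner s (K x - K y) = 0))"
      by (simp add: mem_conj_image)
  qed (simp_all add: conj_conj conj_zero)
  then show "orth_proj (K ` S) x = bar K (orth_proj S) x" by (simp add: orth_proj_def bar_def)
qed

lemma inv_on_bar: "inv_on (K ` S) (bar K A) = bar K (inv_on S A)"
proof (rule ext)
  fix y
  have "the_or 0 (\<lambda>x. x \<in> K ` S \<and> bar K A x = y) = K (the_or 0 (\<lambda>x. x \<in> S \<and> A x = K y))"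
    by (rule the_or_involution) (simp_all add: conj_conj conj_zero mem_conj_image bar_def conj_eq_iff)
  then show "inv_on (K ` S) (bar K A) y = bar K (inv_on S A) y" by (simp add: inv_on_def bar_def)
qed

lemma pseudo_inv_bar: "pseudo_inv (bar K A) = bar K (pseudo_inv A)"
proof (rule ext)
  fix y
  have "the_or 0 (\<lambda>x. x \<in> range (adj (bar K A)) \<and> (\<exists>k. adj (bar K A) k = 0 \<and> y = bar K A x + k)) =
        K (the_or 0 (\<lambda>x. x \<in> range (adj A) \<and> (\<exists>k. adj A k = 0 \<and> K y = A x + k)))"
  proof (rule the_or_involution)
    fix x
    have "(adj (bar K A) (K k) = 0 \<and> y = bar K A x + K k) \<longleftrightarrow> (adj A k = 0 \<and> K y = A (K x) + k)" for k
      by (simp add: adj_bar bar_def conj_conj conj_eq_iff conj_zero) (metis conj_add conj_conj)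
    then have "(\<exists>k. adj (bar K A) k = 0 \<and> y = bar K A x + k) \<longleftrightarrow> (\<exists>k. adj A k = 0 \<and> K y = A (K x) + k)"
      by (metis conj_conj)
    then show "(x \<in> range (adj (bar K A)) \<and> (\<exists>k. adj (bar K A) k = 0 \<and> y = bar K A x + k)) \<longleftrightarrow>
        (K x \<in> range (adj A) \<and> (\<exists>k. adj A k = 0 \<and> K y = A (K x) + k))"
      by (simp add: adj_bar range_bar mem_conj_image)
  qed (simp_all add: conj_conj conj_zero)
  then show "pseudo_inv (bar K A) y = bar K (pseudo_inv A) y" by (simp add: pseudo_inv_def bar_def)
qed

lemma bar_apply_conj: "bar K A (K x) = K (A x)"
  by (simp add: bar_def conj_conj)

lemma T_op_bar: "T_op (bar K P1) (bar K V) = bar K (T_op P1 V)"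
  unfolding T_op_def Let_def compl_bar corner_bar pseudo_inv_bar adj_bar range_bar ker_on_bar
    orth_proj_bar
  by (rule ext) (simp add: bar_def conj_conj conj_diff)

lemma frak_h_bar: "frak_h (bar K P1) (bar K V) = K ` frak_h P1 V"
  unfolding frak_h_def Let_def compl_bar corner_bar range_bar ker_on_bar
  by (simp add: image_image bar_apply_conj)

lemma P_op_bar:
  assumes JK: "\<And>x. J (K x) = K (J x)"
  shows "P_op J (bar K P1) (bar K V) = bar K (P_op J P1 V)"
proof -
  define T where "T = T_op P1 V"
  have "(\<lambda>x. bar K P1 x + bar K (adj T) (bar K T x)) = bar K (\<lambda>x. P1 x + adj T (T x))"
    by (rule ext) (simp add: bar_def conj_add conj_conj)
  then have R: "inv_on (range (bar K P1)) (\<lambda>x. bar K P1 x + bar K (adj T) (bar K T x)) =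
      bar K (inv_on (range P1) (\<lambda>x. P1 x + adj T (T x)))"
    by (simp only: range_bar inv_on_bar)
  show ?thesis
    unfolding P_op_def Let_def T_op_bar frak_h_bar orth_proj_bar adj_bar R[unfolded T_def]
    by (rule ext) (simp add: bar_def JK conj_add conj_diff conj_conj)
qed

lemma frak_k_bar:
  assumes JK: "\<And>x. J (K x) = K (J x)"
  shows "frak_k J (bar K P1) (bar K V) = K ` frak_k J P1 V"
proof -
  have "ker_on UNIV (adj (bar K V)) = K ` ker_on UNIV (adj V)"
    using ker_on_bar[of UNIV "adj V"] by (metis adj_bar conj_conj surjI)
  then show ?thesis
    unfolding frak_k_def P_op_bar[where J = J, OF JK] by (simp add: image_image bar_apply_conj)
qed

lemma conj_image_cspan: "K ` cspan E = cspan (K ` E)"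
proof -
  have sub: "K x \<in> cspan (K ` E)" if "x \<in> cspan E" for x E
    using that
  proof (induction rule: cvec.span_induct_alt)
    case base
    then show ?case by (simp add: conj_zero cvec.span_zero)
  next
    case (step c x y)
    then show ?case by (simp add: conj_add conj_scaleC cvec.span_add cvec.span_scale cvec.span_base)
  qed
  show ?thesis
  proof
    show "K ` cspan E \<subseteq> cspan (K ` E)" using sub by blast
    show "cspan (K ` E) \<subseteq> K ` cspan E"
      using sub[of _ "K ` E"] by (auto simp: mem_conj_image conj_image_conj_image)
  qed
qed

lemma continuous_on_conj: "continuous_on X K"
proof (rule continuous_on_subset)
  show "continuous_on UNIV K"
    unfolding continuous_on_iff dist_norm by (metis conj_diff norm_conj)
qed simp

lemma conj_image_closure: "K ` closure X = closure (K ` X)"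
proof
  have sub: "K ` closure X \<subseteq> closure (K ` X)" for X
    by (rule image_closure_subset[OF continuous_on_conj closed_closure closure_subset])
  show "K ` closure X \<subseteq> closure (K ` X)" by (rule sub)
  have "K ` closure (K ` X) \<subseteq> closure X" using sub[of "K ` X"] by (simp add: conj_image_conj_image)
  then show "closure (K ` X) \<subseteq> K ` closure X" by (metis conj_image_conj_image image_mono)
qed

lemma is_onb_conj: "is_onb S E \<Longrightarrow> is_onb (K ` S) (K ` E)"
  unfolding is_onb_def conj_image_closure[symmetric] conj_image_cspan[symmetric]
  by (auto simp: cinner_conj conj_eq_iff conj_conj)

lemma bar_bop: assumes "A \<in> bop" shows "bar K A \<in> bop"
proof -
  obtain M where M: "\<And>x. norm (A x) \<le> M * norm x" using assms bop_bound by metis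
  show ?thesis
  proof (rule bopI[of _ M])
    show "norm (bar K A x) \<le> M * norm x" for x
      using M[of "K x"] by (simp add: bar_def norm_conj)
  qed (use assms in \<open>auto simp: bar_def conj_add conj_scaleC bop_add bop_scaleC\<close>)
qed

end

subsection \<open>Parseval's identity\<close>

text \<open>The partial sum over a finite \<open>F\<close> is the best approximation by vectors in the span of \<open>F\<close>, so
  the density of the span of the basis suffices.\<close>

lemma onb_expansion:
  fixes S :: "'k::chilbert_space set"
  assumes onb: "is_onb S E" and v: "v \<in> S"
  shows "((\<lambda>e. cinner e v *\<^sub>C e) has_sum v) E"
proof -
  have orth: "cinner e f = (if e = f then 1 else 0)" if "e \<in> E" "f \<in> E" for e f
    using onb that by (simp add: is_onb_def)
  have vc: "v \<in> closure (cspan E)" using onb v by (simp add: is_onb_def)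
  show ?thesis
    unfolding has_sum_def
  proof (rule tendstoI)
    fix \<epsilon> :: real assume "\<epsilon> > 0"
    then obtain u where u: "u \<in> cspan E" "dist u v < \<epsilon>" using vc closure_approachable by blast
    obtain t r where t: "finite t" "t \<subseteq> E" "u = (\<Sum>a\<in>t. r a *\<^sub>C a)"
      using u(1) unfolding cvec.span_explicit by blast
    have "dist (\<Sum>e\<in>F. cinner e v *\<^sub>C e) v < \<epsilon>" if F: "finite F" "F \<subseteq> E" "t \<subseteq> F" for F
    proof -
      define w where "w = v - (\<Sum>e\<in>F. cinner e v *\<^sub>C e)"
      define d where "d = (\<Sum>e\<in>F. (cinner e v - (if e \<in> t then r e else 0)) *\<^sub>C e)"
      have wF: "cinner e w = 0" if "e \<in> F" for e
      proof -
        have "(\<Sum>f\<in>F. cinner f v * cinner e f) = (\<Sum>f\<in>F. if f = e then cinner e v else 0)"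
          by (rule sum.cong[OF refl]) (use F that orth[of e] in \<open>auto simp: subset_iff\<close>)
        then show ?thesis using F that by (simp add: w_def cinner_simps cinner_sum_right)
      qed
      have "cinner d w = 0" by (simp add: d_def cinner_sum_left cinner_simps wF)
      have "(\<Sum>e\<in>F. (if e \<in> t then r e else 0) *\<^sub>C e) = u"
        unfolding t(3) by (rule sum.mono_neutral_cong_right) (use F t in auto)
      then have vu: "v - u = w + d"
        by (simp add: w_def d_def cvec.scale_left_diff_distrib sum_subtractf)
      have "cinner w d = 0" using \<open>cinner d w = 0\<close> by (metis cinner_commute complex_cnj_zero)
      then have "(norm w)\<^sup>2 \<le> (norm (v - u))\<^sup>2" by (simp add: vu norm_sq_add)
      then have "norm w \<le> norm (v - u)" by (rule power2_le_imp_le) simp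
      then show ?thesis using u(2) by (simp add: w_def dist_norm norm_minus_commute)
    qed
    then show "\<forall>\<^sub>F F in finite_subsets_at_top E. dist (\<Sum>e\<in>F. cinner e v *\<^sub>C e) v < \<epsilon>"
      unfolding eventually_finite_subsets_at_top using t by blast
  qed
qed

lemma parseval:
  assumes "is_onb S E" "v \<in> S"
  shows "((\<lambda>e. cinner x e * cinner e v) has_sum cinner x v) E"
  using has_sum_bounded_linear[OF bounded_linear_cinner_right[of x] onb_expansion[OF assms]]
  by (simp add: o_def cinner_scaleC_right mult.commute)

lemma parseval_norm:
  assumes "is_onb S E" "v \<in> S"
  shows "((\<lambda>e. (cmod (cinner e v))\<^sup>2) has_sum (norm v)\<^sup>2) E"
proof -
  have "cinner v e * cinner e v = complex_of_real ((cmod (cinner e v))\<^sup>2)" for e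
    by (metis cinner_commute complex_norm_square mult.commute)
  then have "((\<lambda>e. complex_of_real ((cmod (cinner e v))\<^sup>2)) has_sum complex_of_real ((norm v)\<^sup>2)) E"
    using parseval[OF assms, of v] by (simp add: cinner_self)
  then show ?thesis by (simp only: has_sum_of_real_iff)
qed

lemma onb_subspace:
  assumes "is_onb S E"
  shows "hilbert_on S scaleC cinner"
proof -
  have S: "S = closure (cspan E)" using assms by (simp add: is_onb_def)
  show ?thesis
  proof (rule hilbert_on_closed_subspace)
    show "closed S" by (simp add: S)
    show "0 \<in> S" using closure_subset cvec.span_zero S by blast
  next
    fix x y assume "x \<in> S" "y \<in> S"
    then obtain X Y where XY: "\<forall>n. X n \<in> cspan E" "X \<longlonglongrightarrow> x" "\<forall>n. Y n \<in> cspan E" "Y \<longlonglongrightarrow> y"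
      unfolding S closure_sequential by blast
    then show "x + y \<in> S"
      unfolding S closure_sequential by (intro exI[of _ "\<lambda>n. X n + Y n"]) (auto intro: tendsto_intros cvec.span_add)
  next
    fix c x assume "x \<in> S"
    then obtain X where X: "\<forall>n. X n \<in> cspan E" "X \<longlonglongrightarrow> x"
      unfolding S closure_sequential by blast
    have "(\<lambda>n. norm (c *\<^sub>C X n - c *\<^sub>C x)) \<longlonglongrightarrow> 0"
      using tendsto_mult_right_zero[OF tendsto_norm_zero[OF LIM_zero[OF X(2)]], of "cmod c"]
      by (simp add: cvec.scale_right_diff_distrib[symmetric] norm_scaleC_hilbert)
    then have "(\<lambda>n. c *\<^sub>C X n) \<longlonglongrightarrow> c *\<^sub>C x"
      by (rule LIM_zero_cancel[OF tendsto_norm_zero_cancel])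
    then show "c *\<^sub>C x \<in> S"
      unfolding S closure_sequential using X by (intro exI[of _ "\<lambda>n. c *\<^sub>C X n"]) (auto intro: cvec.span_scale)
  qed
qed

subsection \<open>Hilbert--Schmidt operators\<close>

text \<open>The sum over matrix elements is symmetric in the two bases, so it may be evaluated along
  rows or along columns.\<close>

lemma hilbert_schmidt_adjoint:
  assumes E: "is_onb S E" and F: "is_onb T F"
    and A: "\<And>x. x \<in> S \<Longrightarrow> A x \<in> T" and A': "\<And>y. y \<in> T \<Longrightarrow> A' y \<in> S"
    and adj: "\<And>x y. x \<in> S \<Longrightarrow> y \<in> T \<Longrightarrow> cinner y (A x) = cinner (A' y) x"
    and sum: "(\<lambda>e. (norm (A e))\<^sup>2) summable_on E"
  shows "(\<lambda>f. (norm (A' f))\<^sup>2) summable_on F"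
proof -
  have ES: "e \<in> S" if "e \<in> E" for e using E that by (auto simp: is_onb_def)
  have FT: "f \<in> T" if "f \<in> F" for f using F that by (auto simp: is_onb_def)
  have "(\<lambda>(e, f). (cmod (cinner f (A e)))\<^sup>2) summable_on (E \<times> F)"
  proof (rule summable_on_SigmaI)
    show "((\<lambda>f. case (e, f) of (e, f) \<Rightarrow> (cmod (cinner f (A e)))\<^sup>2) has_sum (norm (A e))\<^sup>2) F" if "e \<in> E" for e
      using parseval_norm[OF F A] ES that by simp
  qed (use sum in auto)
  then have "(\<lambda>(f, e). (cmod (cinner f (A e)))\<^sup>2) summable_on (F \<times> E)"
    by (subst (asm) summable_on_swap) simp
  then have "(\<lambda>f. infsum (\<lambda>e. (cmod (cinner f (A e)))\<^sup>2) E) summable_on F"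
    using summable_on_Sigma_banach[of "\<lambda>f e. (cmod (cinner f (A e)))\<^sup>2" F "\<lambda>_. E"] by simp
  moreover have "infsum (\<lambda>e. (cmod (cinner f (A e)))\<^sup>2) E = (norm (A' f))\<^sup>2" if "f \<in> F" for f
  proof (rule infsumI)
    have "((\<lambda>e. (cmod (cinner e (A' f)))\<^sup>2) has_sum (norm (A' f))\<^sup>2) E"
      using parseval_norm[OF E A'] FT that by simp
    moreover have "cmod (cinner e (A' f)) = cmod (cinner f (A e))" if "e \<in> E" for e
      by (metis FT ES adj \<open>f \<in> F\<close> that cinner_commute complex_mod_cnj)
    ultimately show "((\<lambda>e. (cmod (cinner f (A e)))\<^sup>2) has_sum (norm (A' f))\<^sup>2) E"
      by (simp cong: has_sum_cong)
  qed
  ultimately show ?thesis by (simp cong: summable_on_cong)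
qed

section \<open>Multi-antilinear forms and the Fock space\<close>

lemma has_sum_Sigma_nonneg:
  fixes f :: "'b \<times> 'c \<Rightarrow> real"
  assumes "\<And>x. x \<in> A \<Longrightarrow> ((\<lambda>y. f (x, y)) has_sum g x) (B x)" "(g has_sum s) A"
    "\<And>x y. x \<in> A \<Longrightarrow> y \<in> B x \<Longrightarrow> f (x, y) \<ge> 0"
  shows "(f has_sum s) (Sigma A B)"
proof (rule has_sum_SigmaI[OF assms(1,2)])
  show "f summable_on Sigma A B"
    by (rule summable_on_SigmaI[OF assms(1)]) (use assms in \<open>auto dest: has_sum_imp_summable\<close>)
qed auto

definition tuples :: "'b set \<Rightarrow> nat \<Rightarrow> 'b list set"
  where "tuples E n = {es \<in> lists E. length es = n}"

lemma tuples_0 [simp]: "tuples E 0 = {[]}"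
  by (auto simp: tuples_def)

lemma Nil_mem_tuples [simp]: "[] \<in> tuples E n \<longleftrightarrow> n = 0"
  by (auto simp: tuples_def)

lemma Cons_mem_tuples [simp]: "e # es \<in> tuples E (Suc n) \<longleftrightarrow> e \<in> E \<and> es \<in> tuples E n"
  by (auto simp: tuples_def)

lemma tuples_SucE: "xs \<in> tuples E (Suc n) \<Longrightarrow> (\<And>e es. xs = e # es \<Longrightarrow> e \<in> E \<Longrightarrow> es \<in> tuples E n \<Longrightarrow> P) \<Longrightarrow> P"
  by (cases xs) (auto simp: tuples_def)

lemma tuples_mono: "E \<subseteq> S \<Longrightarrow> tuples E n \<subseteq> tuples S n"
  by (auto simp: tuples_def)

lemma bij_betw_tuples_Suc: "bij_betw (\<lambda>(e, es). e # es) (E \<times> tuples E n) (tuples E (Suc n))"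
  by (auto simp: bij_betw_def inj_on_def image_iff elim!: tuples_SucE)

lemma bij_betw_tuples_lists: "bij_betw snd (Sigma UNIV (tuples E)) (lists E)"
  by (force simp: bij_betw_def inj_on_def tuples_def)

lemma has_sum_tuples_Suc:
  "(f has_sum s) (tuples E (Suc n)) \<longleftrightarrow> ((\<lambda>(e, es). f (e # es)) has_sum s) (E \<times> tuples E n)"
  using has_sum_reindex_bij_betw[OF bij_betw_tuples_Suc, of f] by (simp add: case_prod_unfold)

lemma has_sum_lists:
  "(f has_sum s) (lists E) \<longleftrightarrow> ((\<lambda>(n, es). f es) has_sum s) (Sigma UNIV (tuples E))"
  using has_sum_reindex_bij_betw[OF bij_betw_tuples_lists, of f] by (simp add: case_prod_unfold)

lemma summable_on_tuples: "(f :: _ \<Rightarrow> 'c::banach) summable_on lists E \<Longrightarrow> f summable_on tuples E n"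
  by (rule summable_on_subset_banach) (auto simp: tuples_def)

subsection \<open>Multi-antilinear forms\<close>

text \<open>Bounded multi-antilinear forms in \<open>n\<close> variables from \<open>S\<close>: the components of Fock vectors
  before antisymmetry and the Hilbert--Schmidt condition are imposed.  Values on other lists are
  unconstrained, so a single function can be a form for every \<open>n\<close>.\<close>

definition mform :: "'k::chilbert_space set \<Rightarrow> nat \<Rightarrow> ('k list \<Rightarrow> complex) \<Rightarrow> bool"
  where "mform S n \<Phi> \<longleftrightarrow>
    (\<forall>xs\<in>lists S. \<forall>ys\<in>lists S. length xs + length ys + 1 = n \<longrightarrow>
      (\<forall>x\<in>S. \<forall>y\<in>S. \<Phi> (xs @ (x + y) # ys) = \<Phi> (xs @ x # ys) + \<Phi> (xs @ y # ys)) \<and>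
      (\<forall>x\<in>S. \<forall>c. \<Phi> (xs @ (c *\<^sub>C x) # ys) = cnj c * \<Phi> (xs @ x # ys))) \<and>
    (\<exists>M. \<forall>xs\<in>tuples S n. cmod (\<Phi> xs) \<le> M * prod_list (map norm xs))"

lemma mform_add_arg:
  "mform S n \<Phi> \<Longrightarrow> xs \<in> lists S \<Longrightarrow> ys \<in> lists S \<Longrightarrow> length xs + length ys + 1 = n \<Longrightarrow> x \<in> S \<Longrightarrow> y \<in> S
   \<Longrightarrow> \<Phi> (xs @ (x + y) # ys) = \<Phi> (xs @ x # ys) + \<Phi> (xs @ y # ys)"
  by (simp add: mform_def)

lemma mform_scale_arg:
  "mform S n \<Phi> \<Longrightarrow> xs \<in> lists S \<Longrightarrow> ys \<in> lists S \<Longrightarrow> length xs + length ys + 1 = n \<Longrightarrow> x \<in> S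
   \<Longrightarrow> \<Phi> (xs @ (c *\<^sub>C x) # ys) = cnj c * \<Phi> (xs @ x # ys)"
  by (simp add: mform_def)

lemma mform_bound: "mform S n \<Phi> \<Longrightarrow> \<exists>M. \<forall>xs\<in>tuples S n. cmod (\<Phi> xs) \<le> M * prod_list (map norm xs)"
  by (simp add: mform_def)

lemma mformI:
  assumes "\<And>xs ys x y. xs \<in> lists S \<Longrightarrow> ys \<in> lists S \<Longrightarrow> length xs + length ys + 1 = n \<Longrightarrow> x \<in> S \<Longrightarrow> y \<in> S
      \<Longrightarrow> \<Phi> (xs @ (x + y) # ys) = \<Phi> (xs @ x # ys) + \<Phi> (xs @ y # ys)"
    and "\<And>xs ys x c. xs \<in> lists S \<Longrightarrow> ys \<in> lists S \<Longrightarrow> length xs + length ys + 1 = n \<Longrightarrow> x \<in> S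
      \<Longrightarrow> \<Phi> (xs @ (c *\<^sub>C x) # ys) = cnj c * \<Phi> (xs @ x # ys)"
    and "\<And>xs. xs \<in> tuples S n \<Longrightarrow> cmod (\<Phi> xs) \<le> M * prod_list (map norm xs)"
  shows "mform S n \<Phi>"
  using assms unfolding mform_def by blast

lemma mform_Cons:
  assumes "mform S (Suc n) \<Phi>" "x \<in> S"
  shows "mform S n (\<lambda>xs. \<Phi> (x # xs))"
  unfolding mform_def
proof (intro conjI ballI impI allI)
  fix xs ys y z c assume *: "xs \<in> lists S" "ys \<in> lists S" "length xs + length ys + 1 = n" "y \<in> S"
  show "\<Phi> (x # xs @ (y + z) # ys) = \<Phi> (x # xs @ y # ys) + \<Phi> (x # xs @ z # ys)" if "z \<in> S"
    using mform_add_arg[OF assms(1), of "x # xs" ys y z] * assms(2) that by simp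
  show "\<Phi> (x # xs @ (c *\<^sub>C y) # ys) = cnj c * \<Phi> (x # xs @ y # ys)"
    using mform_scale_arg[OF assms(1), of "x # xs" ys y c] * assms(2) by simp
next
  obtain M where "\<forall>xs\<in>tuples S (Suc n). cmod (\<Phi> xs) \<le> M * prod_list (map norm xs)"
    using mform_bound[OF assms(1)] by blast
  then show "\<exists>M. \<forall>xs\<in>tuples S n. cmod (\<Phi> (x # xs)) \<le> M * prod_list (map norm xs)"
    using assms(2) by (intro exI[of _ "M * norm x"] ballI) (metis Cons_mem_tuples list.simps(9) mult.assoc prod_list.Cons)
qed

text \<open>By Riesz, a form is an inner product in its first slot; hence the square sum over that slot
  does not depend on the orthonormal basis and dominates every value.\<close>

lemma mform_head_norm:
  assumes form: "mform S (Suc n) \<Phi>" and onb: "is_onb S E" and xs: "xs \<in> tuples S n"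
  shows "\<exists>N. (\<forall>E. is_onb S E \<longrightarrow> ((\<lambda>e. (cmod (\<Phi> (e # xs)))\<^sup>2) has_sum N) E) \<and>
    (\<forall>x\<in>S. (cmod (\<Phi> (x # xs)))\<^sup>2 \<le> (norm x)\<^sup>2 * N) \<and>
    (\<forall>x\<in>S. \<forall>E. is_onb S E \<longrightarrow> ((\<lambda>e. cinner x e * \<Phi> (e # xs)) has_sum \<Phi> (x # xs)) E)"
proof -
  interpret S: hilbert_on S scaleC cinner by (rule onb_subspace[OF onb])
  have xs': "xs \<in> lists S" "length xs = n" using xs by (auto simp: tuples_def)
  obtain M where M: "\<forall>ys\<in>tuples S (Suc n). cmod (\<Phi> ys) \<le> M * prod_list (map norm ys)"
    using mform_bound[OF form] by blast
  have "\<exists>!w. w \<in> S \<and> (\<forall>z\<in>S. cinner w z = cnj (\<Phi> (z # xs)))"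
  proof (rule S.riesz_representation[of _ "M * prod_list (map norm xs)", unfolded nrm_eq_norm])
    fix x y c assume "x \<in> S"
    show "cnj (\<Phi> ((x + y) # xs)) = cnj (\<Phi> (x # xs)) + cnj (\<Phi> (y # xs))" if "y \<in> S"
      using mform_add_arg[OF form, of "[]" xs x y] xs' \<open>x \<in> S\<close> that by simp
    show "cnj (\<Phi> ((c *\<^sub>C x) # xs)) = c * cnj (\<Phi> (x # xs))"
      using mform_scale_arg[OF form, of "[]" xs x c] xs' \<open>x \<in> S\<close> by simp
    show "cmod (cnj (\<Phi> (x # xs))) \<le> M * prod_list (map norm xs) * norm x"
      using bspec[OF M, of "x # xs"] \<open>x \<in> S\<close> xs by (simp add: ac_simps)
  qed
  then obtain w where w: "w \<in> S" "\<And>z. z \<in> S \<Longrightarrow> cinner w z = cnj (\<Phi> (z # xs))" by blast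
  have \<Phi>: "\<Phi> (z # xs) = cinner z w" if "z \<in> S" for z
    using w(2)[OF that] by (metis cinner_commute complex_cnj_cnj)
  have ES: "e \<in> S" if "is_onb S E" "e \<in> E" for E e using that by (auto simp: is_onb_def)
  show ?thesis
  proof (intro exI[of _ "(norm w)\<^sup>2"] conjI ballI allI impI)
    show "((\<lambda>e. (cmod (\<Phi> (e # xs)))\<^sup>2) has_sum (norm w)\<^sup>2) E" if "is_onb S E" for E
      using parseval_norm[OF that w(1)] ES[OF that] by (simp add: \<Phi> cong: has_sum_cong)
    show "(cmod (\<Phi> (x # xs)))\<^sup>2 \<le> (norm x)\<^sup>2 * (norm w)\<^sup>2" if "x \<in> S" for x
      unfolding \<Phi>[OF that] power_mult_distrib[symmetric]
      by (rule power_mono[OF cinner_cauchy_schwarz]) simp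
    show "((\<lambda>e. cinner x e * \<Phi> (e # xs)) has_sum \<Phi> (x # xs)) E" if "x \<in> S" "is_onb S E" for x E
    proof -
      have "((\<lambda>e. cinner x e * \<Phi> (e # xs)) has_sum cinner x w) E \<longleftrightarrow>
          ((\<lambda>e. cinner x e * cinner e w) has_sum cinner x w) E"
        by (rule has_sum_cong) (simp add: \<Phi> ES[OF that(2)])
      then show ?thesis using parseval[OF that(2) w(1), of x] \<Phi>[OF that(1)] by simp
    qed
  qed
qed

text \<open>The basis is exchanged one slot at a time.  Since all summands are nonnegative, the sums over the
  slots may be interchanged freely.\<close>

lemma mform_basis_change:
  assumes "mform S n \<Phi>" and E: "is_onb S E" and E': "is_onb S E'"
    and "((\<lambda>es. (cmod (\<Phi> es))\<^sup>2) has_sum s) (tuples E n)"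
  shows "((\<lambda>es. (cmod (\<Phi> es))\<^sup>2) has_sum s) (tuples E' n)"
  using assms(1,4)
proof (induction n arbitrary: \<Phi> s)
  case 0
  then show ?case by simp
next
  case (Suc n)
  have ES: "E \<subseteq> S" "E' \<subseteq> S" using E E' by (auto simp: is_onb_def)
  let ?q = "\<lambda>e es. (cmod (\<Phi> (e # es)))\<^sup>2"
  have sum: "((\<lambda>(e, es). ?q e es) has_sum s) (E \<times> tuples E n)"
    using Suc.prems(2) by (simp add: has_sum_tuples_Suc)
  define g where "g e = infsum (?q e) (tuples E n)" for e
  have g: "(?q e has_sum g e) (tuples E n)" if "e \<in> E" for e
    unfolding g_def by (rule has_sum_infsum, rule summable_on_SigmaD1[OF has_sum_imp_summable[OF sum] that])
  have gs: "(g has_sum s) E"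
    by (rule has_sum_SigmaD[OF sum]) (simp add: g)
  have g': "(?q e has_sum g e) (tuples E' n)" if "e \<in> E" for e
    using Suc.IH[OF mform_Cons[OF Suc.prems(1)] g] that ES by blast
  have "((\<lambda>(e, es). ?q e es) has_sum s) (E \<times> tuples E' n)"
    by (rule has_sum_Sigma_nonneg[OF _ gs]) (simp_all add: g')
  then have swapped: "((\<lambda>(es, e). ?q e es) has_sum s) (tuples E' n \<times> E)"
    by (subst (asm) has_sum_swap) simp
  have "\<exists>N. \<forall>E. is_onb S E \<longrightarrow> ((\<lambda>e. ?q e es) has_sum N) E" if "es \<in> tuples E' n" for es
    using mform_head_norm[OF Suc.prems(1) E, of es] that tuples_mono[OF ES(2)] by blast
  then obtain N where N: "\<And>es E. es \<in> tuples E' n \<Longrightarrow> is_onb S E \<Longrightarrow> ((\<lambda>e. ?q e es) has_sum N es) E"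
    by metis
  have Ns: "(N has_sum s) (tuples E' n)"
    by (rule has_sum_SigmaD[OF swapped]) (simp add: N[OF _ E])
  have "((\<lambda>(es, e). ?q e es) has_sum s) (tuples E' n \<times> E')"
    by (rule has_sum_Sigma_nonneg[OF _ Ns]) (simp_all add: N[OF _ E'])
  then have "((\<lambda>(e, es). ?q e es) has_sum s) (E' \<times> tuples E' n)"
    by (subst (asm) has_sum_swap) simp
  then show ?case by (simp add: has_sum_tuples_Suc)
qed

text \<open>This makes point evaluations continuous for the Hilbert--Schmidt norm, which yields
  definiteness and completeness of the Fock space.\<close>

lemma mform_le_hilbert_schmidt:
  assumes "mform S n \<Phi>" and E: "is_onb S E"
    and "((\<lambda>es. (cmod (\<Phi> es))\<^sup>2) has_sum s) (tuples E n)" and "xs \<in> tuples S n"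
  shows "(cmod (\<Phi> xs))\<^sup>2 \<le> s * (prod_list (map norm xs))\<^sup>2"
  using assms(1,3,4)
proof (induction n arbitrary: \<Phi> s xs)
  case 0
  then have "s = (cmod (\<Phi> []))\<^sup>2" by (simp add: has_sum_finite_iff)
  then show ?case using 0 by simp
next
  case (Suc n)
  have ES: "E \<subseteq> S" using E by (auto simp: is_onb_def)
  obtain x ys where xs: "xs = x # ys" "x \<in> S" "ys \<in> tuples S n" using Suc.prems(3) by (rule tuples_SucE)
  let ?q = "\<lambda>e es. (cmod (\<Phi> (e # es)))\<^sup>2"
  have sum: "((\<lambda>(e, es). ?q e es) has_sum s) (E \<times> tuples E n)"
    using Suc.prems(2) by (simp add: has_sum_tuples_Suc)
  define g where "g e = infsum (?q e) (tuples E n)" for e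
  have g: "(?q e has_sum g e) (tuples E n)" if "e \<in> E" for e
    unfolding g_def by (rule has_sum_infsum, rule summable_on_SigmaD1[OF has_sum_imp_summable[OF sum] that])
  have gs: "(g has_sum s) E"
    by (rule has_sum_SigmaD[OF sum]) (simp add: g)
  obtain N where N: "((\<lambda>e. ?q e ys) has_sum N) E" "\<forall>x\<in>S. ?q x ys \<le> (norm x)\<^sup>2 * N"
    using mform_head_norm[OF Suc.prems(1) E xs(3)] E by blast
  have "N \<le> s * (prod_list (map norm ys))\<^sup>2"
  proof (rule has_sum_mono[OF N(1) has_sum_cmult_left[OF gs]])
    show "?q e ys \<le> g e * (prod_list (map norm ys))\<^sup>2" if "e \<in> E" for e
      by (rule Suc.IH[OF mform_Cons[OF Suc.prems(1)] g xs(3)]) (use that ES in auto)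
  qed
  then have "(norm x)\<^sup>2 * N \<le> (norm x)\<^sup>2 * (s * (prod_list (map norm ys))\<^sup>2)"
    by (rule mult_left_mono) simp
  then show ?case using N(2) xs by (fastforce simp: power_mult_distrib ac_simps intro: order_trans)
qed

subsection \<open>The antisymmetric Fock space as a Hilbert space\<close>

definition alternating :: "'k set \<Rightarrow> ('k list \<Rightarrow> complex) \<Rightarrow> bool"
  where "alternating S \<Phi> \<longleftrightarrow>
    (\<forall>xs\<in>lists S. \<forall>ys\<in>lists S. \<forall>x\<in>S. \<forall>y\<in>S. \<Phi> (xs @ x # y # ys) = - \<Phi> (xs @ y # x # ys))"

lemma alternatingD:
  "alternating S \<Phi> \<Longrightarrow> xs \<in> lists S \<Longrightarrow> ys \<in> lists S \<Longrightarrow> x \<in> S \<Longrightarrow> y \<in> S \<Longrightarrow>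
   \<Phi> (xs @ x # y # ys) = - \<Phi> (xs @ y # x # ys)"
  unfolding alternating_def by blast

lemma alternatingI:
  "(\<And>xs ys x y. xs \<in> lists S \<Longrightarrow> ys \<in> lists S \<Longrightarrow> x \<in> S \<Longrightarrow> y \<in> S \<Longrightarrow>
   \<Phi> (xs @ x # y # ys) = - \<Phi> (xs @ y # x # ys)) \<Longrightarrow> alternating S \<Phi>"
  unfolding alternating_def by blast

lemma fock_vectors_iff:
  "\<Phi> \<in> fock_vectors S \<longleftrightarrow> (\<forall>xs. \<not> set xs \<subseteq> S \<longrightarrow> \<Phi> xs = 0) \<and> (\<forall>n. mform S n \<Phi>) \<and> alternating S \<Phi> \<and>
    (\<lambda>xs. (cmod (\<Phi> xs))\<^sup>2) summable_on lists (some_onb S)"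
proof -
  have mform_all: "(\<forall>n. mform S n \<Phi>) \<longleftrightarrow>
    (\<forall>xs\<in>lists S. \<forall>ys\<in>lists S. \<forall>x\<in>S. \<forall>y\<in>S. \<Phi> (xs @ (x + y) # ys) = \<Phi> (xs @ x # ys) + \<Phi> (xs @ y # ys)) \<and>
    (\<forall>xs\<in>lists S. \<forall>ys\<in>lists S. \<forall>x\<in>S. \<forall>c. \<Phi> (xs @ (c *\<^sub>C x) # ys) = cnj c * \<Phi> (xs @ x # ys)) \<and>
    (\<forall>n. \<exists>M. \<forall>xs\<in>lists S. length xs = n \<longrightarrow> cmod (\<Phi> xs) \<le> M * prod_list (map norm xs))"
    (is "_ \<longleftrightarrow> ?add \<and> ?scale \<and> ?bound")
  proof (intro iffI conjI ballI allI)
    fix xs ys x y c n assume form: "\<forall>n. mform S n \<Phi>"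
    show "\<exists>M. \<forall>xs\<in>lists S. length xs = n \<longrightarrow> cmod (\<Phi> xs) \<le> M * prod_list (map norm xs)"
      using mform_bound[OF spec[OF form, of n]] by (auto simp: tuples_def)
    assume *: "xs \<in> lists S" "ys \<in> lists S" "x \<in> S"
    show "\<Phi> (xs @ (c *\<^sub>C x) # ys) = cnj c * \<Phi> (xs @ x # ys)"
      by (rule mform_scale_arg[OF spec[OF form] *(1,2) refl *(3)])
    show "\<Phi> (xs @ (x + y) # ys) = \<Phi> (xs @ x # ys) + \<Phi> (xs @ y # ys)" if "y \<in> S"
      by (rule mform_add_arg[OF spec[OF form] *(1,2) refl *(3) that])
  next
    fix n assume *: "?add \<and> ?scale \<and> ?bound"
    then obtain M where "\<forall>xs\<in>lists S. length xs = n \<longrightarrow> cmod (\<Phi> xs) \<le> M * prod_list (map norm xs)"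
      by blast
    then show "mform S n \<Phi>"
      by (intro mformI[where M = M]) (use * in \<open>simp_all add: tuples_def\<close>)
  qed
  show ?thesis
    unfolding fock_vectors_def alternating_def mem_Collect_eq mform_all by (simp only: conj_ac)
qed

definition fsc :: "complex \<Rightarrow> 'k fock \<Rightarrow> 'k fock"
  where "fsc c \<Phi> = (\<lambda>xs. c * \<Phi> xs)"

lemma fsc_apply [simp]: "fsc c \<Phi> xs = c * \<Phi> xs"
  by (simp add: fsc_def)

definition fip :: "'k::chilbert_space set \<Rightarrow> 'k fock \<Rightarrow> 'k fock \<Rightarrow> complex"
  where "fip S \<Phi> \<Psi> = (\<Sum>\<^sub>\<infinity>xs\<in>lists (some_onb S). cnj (\<Phi> xs) * \<Psi> xs)"

lemma fock_space_simps [simp]: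
  "hcarrier (fock_space S) = fock_vectors S" "hadd (fock_space S) = (+)"
  "hscale (fock_space S) = fsc" "hip (fock_space S) = fip S"
  by (simp_all add: fock_space_def fun_eq_iff fip_def)

lemma vector_space_fsc: "vector_space fsc"
  by unfold_locales (simp_all add: fsc_def plus_fun_def distrib_left distrib_right mult.assoc)

lemma mform_add: assumes \<Phi>: "mform S n \<Phi>" and \<Psi>: "mform S n \<Psi>" shows "mform S n (\<Phi> + \<Psi>)"
proof -
  obtain M N where M: "\<And>xs. xs\<in>tuples S n \<Longrightarrow> cmod (\<Phi> xs) \<le> M * prod_list (map norm xs)"
    and N: "\<And>xs. xs\<in>tuples S n \<Longrightarrow> cmod (\<Psi> xs) \<le> N * prod_list (map norm xs)"
    using mform_bound[OF \<Phi>] mform_bound[OF \<Psi>] by blast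
  show ?thesis
  proof (rule mformI[where M = "M + N"])
    show "cmod ((\<Phi> + \<Psi>) xs) \<le> (M + N) * prod_list (map norm xs)" if "xs \<in> tuples S n" for xs
      using add_mono[OF M[OF that] N[OF that]] norm_triangle_ineq[of "\<Phi> xs" "\<Psi> xs"]
      by (simp add: distrib_right)
  qed (simp_all add: mform_add_arg[OF \<Phi>] mform_scale_arg[OF \<Phi>] mform_add_arg[OF \<Psi>]
      mform_scale_arg[OF \<Psi>] distrib_left)
qed

lemma mform_fsc: assumes \<Phi>: "mform S n \<Phi>" shows "mform S n (fsc c \<Phi>)"
proof -
  obtain M where M: "\<And>xs. xs\<in>tuples S n \<Longrightarrow> cmod (\<Phi> xs) \<le> M * prod_list (map norm xs)"
    using mform_bound[OF \<Phi>] by blast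
  show ?thesis
  proof (rule mformI[where M = "cmod c * M"])
    show "cmod (fsc c \<Phi> xs) \<le> (cmod c * M) * prod_list (map norm xs)" if "xs \<in> tuples S n" for xs
      using mult_left_mono[OF M[OF that], of "cmod c"] by (simp add: norm_mult mult.assoc)
  qed (simp_all add: mform_add_arg[OF \<Phi>] mform_scale_arg[OF \<Phi>] distrib_left mult.left_commute)
qed

lemma norm_add_sq_le: "(norm (a + b))\<^sup>2 \<le> 2 * (norm a)\<^sup>2 + 2 * (norm (b::'b::real_normed_vector))\<^sup>2"
proof -
  have "(norm (a + b))\<^sup>2 \<le> (norm a + norm b)\<^sup>2" by (simp add: norm_triangle_ineq power_mono)
  also have "\<dots> \<le> 2 * (norm a)\<^sup>2 + 2 * (norm b)\<^sup>2"
    using zero_le_power2[of "norm a - norm b"] by (simp add: power2_sum power2_diff)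
  finally show ?thesis .
qed

lemma summable_sq_add:
  assumes "(\<lambda>x. (cmod (f x))\<^sup>2) summable_on A" "(\<lambda>x. (cmod (g x))\<^sup>2) summable_on A"
  shows "(\<lambda>x. (cmod (f x + g x))\<^sup>2) summable_on A"
proof (rule summable_on_comparison_test)
  show "(\<lambda>x. 2 * (cmod (f x))\<^sup>2 + 2 * (cmod (g x))\<^sup>2) summable_on A"
    using assms by (intro summable_on_add summable_on_cmult_right)
qed (auto intro: norm_add_sq_le)

lemma summable_sq_mult:
  assumes "(\<lambda>x. (cmod (f x))\<^sup>2) summable_on A" "(\<lambda>x. (cmod (g x))\<^sup>2) summable_on A"
  shows "(\<lambda>x. cnj (f x) * g x) summable_on A"
proof (rule abs_summable_summable, rule Infinite_Sum.abs_summable_on_comparison_test')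
  show "(\<lambda>x. (cmod (f x))\<^sup>2 + (cmod (g x))\<^sup>2) summable_on A"
    using assms by (intro summable_on_add)
  show "norm (cnj (f x) * g x) \<le> (cmod (f x))\<^sup>2 + (cmod (g x))\<^sup>2" for x
  proof -
    have "0 \<le> (cmod (f x) - cmod (g x))\<^sup>2" "0 \<le> cmod (f x) * cmod (g x)" by simp_all
    then show ?thesis unfolding power2_diff norm_mult complex_mod_cnj by linarith
  qed
qed

locale fock_onb =
  fixes S :: "'k::chilbert_space set"
  assumes ex_onb: "\<exists>E. is_onb S E"
begin

abbreviation "E \<equiv> some_onb S"
abbreviation "F \<equiv> fock_vectors S"

lemma onb: "is_onb S E"
  unfolding some_onb_def by (rule someI_ex[OF ex_onb])

lemma E_sub: "E \<subseteq> S"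
  using onb by (simp add: is_onb_def)

sublocale S: hilbert_on S scaleC cinner
  by (rule onb_subspace[OF onb])

lemma fock_summable: "\<Phi> \<in> F \<Longrightarrow> (\<lambda>xs. (cmod (\<Phi> xs))\<^sup>2) summable_on lists E"
  by (simp add: fock_vectors_iff)

lemma fock_ip_summable: "\<Phi> \<in> F \<Longrightarrow> \<Psi> \<in> F \<Longrightarrow> (\<lambda>xs. cnj (\<Phi> xs) * \<Psi> xs) summable_on lists E"
  by (intro summable_sq_mult fock_summable)

lemma fock_outside: "\<Phi> \<in> F \<Longrightarrow> \<not> set xs \<subseteq> S \<Longrightarrow> \<Phi> xs = 0"
  by (simp add: fock_vectors_iff)

lemma fock_mform: "\<Phi> \<in> F \<Longrightarrow> mform S n \<Phi>"
  by (simp add: fock_vectors_iff)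

lemma fock_alternating: "\<Phi> \<in> F \<Longrightarrow> alternating S \<Phi>"
  by (simp add: fock_vectors_iff)

lemma fock_zero: "0 \<in> F"
proof -
  have "mform S n 0" for n :: nat
    by (rule mformI[where M = 0]) simp_all
  then show ?thesis by (simp add: fock_vectors_iff alternating_def)
qed

lemma fock_add:
  assumes "\<Phi> \<in> F" "\<Psi> \<in> F" shows "\<Phi> + \<Psi> \<in> F"
proof -
  have "alternating S (\<Phi> + \<Psi>)"
  proof (rule alternatingI)
    fix xs ys x y assume *: "xs \<in> lists S" "ys \<in> lists S" "x \<in> S" "y \<in> S"
    show "(\<Phi> + \<Psi>) (xs @ x # y # ys) = - (\<Phi> + \<Psi>) (xs @ y # x # ys)"
      using alternatingD[OF fock_alternating[OF assms(1)] *] alternatingD[OF fock_alternating[OF assms(2)] *]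
      by (simp only: plus_fun_apply minus_add_distrib)
  qed
  moreover have "(\<lambda>xs. (cmod ((\<Phi> + \<Psi>) xs))\<^sup>2) summable_on lists E"
    unfolding plus_fun_apply by (rule summable_sq_add[OF assms[THEN fock_summable]])
  ultimately show ?thesis
    unfolding fock_vectors_iff using assms by (simp add: fock_outside mform_add fock_mform)
qed

lemma fock_fsc:
  assumes "\<Phi> \<in> F" shows "fsc c \<Phi> \<in> F"
proof -
  have "alternating S (fsc c \<Phi>)"
  proof (rule alternatingI)
    fix xs ys x y assume *: "xs \<in> lists S" "ys \<in> lists S" "x \<in> S" "y \<in> S"
    show "fsc c \<Phi> (xs @ x # y # ys) = - fsc c \<Phi> (xs @ y # x # ys)"
      using alternatingD[OF fock_alternating[OF assms(1)] *] by (simp only: fsc_apply mult_minus_right)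
  qed
  moreover have "(\<lambda>xs. (cmod (fsc c \<Phi> xs))\<^sup>2) summable_on lists E"
    unfolding fsc_apply norm_mult power_mult_distrib
    by (rule summable_on_cmult_right[OF fock_summable[OF assms]])
  ultimately show ?thesis
    unfolding fock_vectors_iff using assms by (simp add: fock_outside mform_fsc fock_mform)
qed

lemma fock_diff: "\<Phi> \<in> F \<Longrightarrow> \<Psi> \<in> F \<Longrightarrow> \<Phi> - \<Psi> \<in> F"
proof -
  assume "\<Phi> \<in> F" "\<Psi> \<in> F"
  then have "\<Phi> + fsc (-1) \<Psi> \<in> F" by (intro fock_add fock_fsc)
  moreover have "\<Phi> + fsc (-1) \<Psi> = \<Phi> - \<Psi>" by (simp add: fun_eq_iff)
  ultimately show ?thesis by simp
qed

definition fnsq :: "'k fock \<Rightarrow> real"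
  where "fnsq \<Phi> = (\<Sum>\<^sub>\<infinity>xs\<in>lists E. (cmod (\<Phi> xs))\<^sup>2)"

lemma fnsq_has_sum: "\<Phi> \<in> F \<Longrightarrow> ((\<lambda>xs. (cmod (\<Phi> xs))\<^sup>2) has_sum fnsq \<Phi>) (lists E)"
  unfolding fnsq_def by (rule has_sum_infsum[OF fock_summable])

lemma fnsq_nonneg: "0 \<le> fnsq \<Phi>"
  unfolding fnsq_def by (rule infsum_nonneg) simp

lemma fip_self: "\<Phi> \<in> F \<Longrightarrow> fip S \<Phi> \<Phi> = complex_of_real (fnsq \<Phi>)"
proof -
  assume "\<Phi> \<in> F"
  then have "((\<lambda>xs. complex_of_real ((cmod (\<Phi> xs))\<^sup>2)) has_sum complex_of_real (fnsq \<Phi>)) (lists E)"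
    unfolding has_sum_of_real_iff by (rule fnsq_has_sum)
  then show ?thesis
    unfolding fip_def by (simp add: infsumI complex_norm_square mult.commute del: of_real_power)
qed

lemma fock_value_bound:
  assumes "\<Phi> \<in> F" "xs \<in> lists S"
  shows "cmod (\<Phi> xs) \<le> sqrt (fnsq \<Phi>) * prod_list (map norm xs)"
proof -
  let ?n = "length xs"
  let ?s = "infsum (\<lambda>xs. (cmod (\<Phi> xs))\<^sup>2) (tuples E ?n)"
  have s: "((\<lambda>es. (cmod (\<Phi> es))\<^sup>2) has_sum ?s) (tuples E ?n)"
    by (rule has_sum_infsum[OF summable_on_tuples[OF fock_summable[OF assms(1)]]])
  have "(cmod (\<Phi> xs))\<^sup>2 \<le> ?s * (prod_list (map norm xs))\<^sup>2"
    by (rule mform_le_hilbert_schmidt[OF fock_mform[OF assms(1)] onb s]) (use assms in \<open>auto simp: tuples_def\<close>)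
  also have "?s \<le> fnsq \<Phi>"
    by (rule has_sum_mono2[OF s fnsq_has_sum[OF assms(1)]]) (auto simp: tuples_def)
  finally have "(cmod (\<Phi> xs))\<^sup>2 \<le> fnsq \<Phi> * (prod_list (map norm xs))\<^sup>2"
    by (simp add: mult_right_mono)
  then have "sqrt ((cmod (\<Phi> xs))\<^sup>2) \<le> sqrt (fnsq \<Phi> * (prod_list (map norm xs))\<^sup>2)"
    by (simp only: real_sqrt_le_iff)
  moreover have "prod_list (map norm xs) \<ge> 0" by (induction xs) auto
  ultimately show ?thesis by (simp add: real_sqrt_mult)
qed

text \<open>By Fatou's lemma, balls of the Fock space are closed under pointwise limits.\<close>

lemma fock_pointwise_limit:
  assumes D: "\<And>m. D m \<in> F" and bdd: "\<And>m. fnsq (D m) \<le> e" and lim: "\<And>xs. (\<lambda>m. D m xs) \<longlonglongrightarrow> L xs"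
  shows "L \<in> F" "fnsq L \<le> e"
proof -
  have fin: "(\<Sum>xs\<in>A. (cmod (L xs))\<^sup>2) \<le> e" if "finite A" "A \<subseteq> lists E" for A
  proof (rule LIMSEQ_le_const2)
    show "(\<lambda>m. \<Sum>xs\<in>A. (cmod (D m xs))\<^sup>2) \<longlonglongrightarrow> (\<Sum>xs\<in>A. (cmod (L xs))\<^sup>2)"
      by (intro tendsto_intros lim)
    have "(\<Sum>xs\<in>A. (cmod (D m xs))\<^sup>2) \<le> e" for m
      by (rule order_trans[OF finite_sum_le_has_sum[OF fnsq_has_sum[OF D] that] bdd]) simp
    then show "\<exists>N. \<forall>n\<ge>N. (\<Sum>xs\<in>A. (cmod (D n xs))\<^sup>2) \<le> e" by blast
  qed
  have summ: "(\<lambda>xs. (cmod (L xs))\<^sup>2) summable_on lists E"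
    by (rule nonneg_bdd_above_summable_on) (use fin in \<open>auto simp: bdd_above_def\<close>)
  show "fnsq L \<le> e"
    unfolding fnsq_def by (rule infsum_le_finite_sums[OF summ]) (use fin in auto)
  have uniq: "L xs = z" if "(\<lambda>m. D m xs) \<longlonglongrightarrow> z" for xs z
    using LIMSEQ_unique lim that by blast
  have e: "0 \<le> e" using fnsq_nonneg bdd order_trans by blast
  show "L \<in> F"
    unfolding fock_vectors_iff
  proof (intro conjI allI impI summ)
    show "L xs = 0" if "\<not> set xs \<subseteq> S" for xs
      by (rule uniq) (simp add: fock_outside[OF D that])
    show "alternating S L"
    proof (rule alternatingI, rule uniq)
      fix xs ys x y assume *: "xs \<in> lists S" "ys \<in> lists S" "x \<in> S" "y \<in> S"
      have "(\<lambda>m. D m (xs @ x # y # ys)) = (\<lambda>m. - D m (xs @ y # x # ys))"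
        by (rule ext) (rule alternatingD[OF fock_alternating[OF D] *])
      then show "(\<lambda>m. D m (xs @ x # y # ys)) \<longlonglongrightarrow> - L (xs @ y # x # ys)"
        by (simp only:) (intro tendsto_intros lim)
    qed
    show "mform S n L" for n
      unfolding mform_def
    proof (intro conjI ballI impI allI)
      fix xs ys x y c assume *: "xs \<in> lists S" "ys \<in> lists S" "length xs + length ys + 1 = n" "x \<in> S"
      show "L (xs @ (x + y) # ys) = L (xs @ x # ys) + L (xs @ y # ys)" if "y \<in> S"
        by (rule uniq, simp only: mform_add_arg[OF fock_mform[OF D] *(1-4) that])
           (intro tendsto_intros lim)
      show "L (xs @ (c *\<^sub>C x) # ys) = cnj c * L (xs @ x # ys)"
        by (rule uniq, simp only: mform_scale_arg[OF fock_mform[OF D] *(1-4)])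
           (intro tendsto_intros lim)
    next
      have "cmod (L xs) \<le> sqrt e * prod_list (map norm xs)" if "xs \<in> tuples S n" for xs
      proof (rule LIMSEQ_le_const2)
        show "(\<lambda>m. cmod (D m xs)) \<longlonglongrightarrow> cmod (L xs)" by (intro tendsto_intros lim)
        have "cmod (D m xs) \<le> sqrt e * prod_list (map norm xs)" for m
        proof -
          have "prod_list (map norm xs) \<ge> 0" by (induction xs) auto
          moreover have "xs \<in> lists S" using that by (simp add: tuples_def)
          ultimately show ?thesis
            using fock_value_bound[OF D, of xs m] bdd[of m]
            by (meson mult_right_mono order_trans real_sqrt_le_mono)
        qed
        then show "\<exists>N. \<forall>n\<ge>N. cmod (D n xs) \<le> sqrt e * prod_list (map norm xs)" by blast
      qed
      then show "\<exists>M. \<forall>xs\<in>tuples S n. cmod (L xs) \<le> M * prod_list (map norm xs)" by blast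
    qed
  qed
qed

text \<open>A Cauchy sequence converges at every list, by the bound on point evaluations.  Membership and
  norm convergence of the limit come from applying the closedness of balls to differences of its
  terms.\<close>

sublocale fock: hilbert_on F fsc "fip S"
proof (rule hilbert_on.intro[OF vector_space_fsc fock_zero fock_add fock_fsc], assumption+)
  fix \<Phi> \<Psi> X c assume \<Phi>: "\<Phi> \<in> F" and \<Psi>: "\<Psi> \<in> F"
  show "fip S \<Phi> (\<Psi> + X) = fip S \<Phi> \<Psi> + fip S \<Phi> X" if "X \<in> F"
    unfolding fip_def using \<Phi> \<Psi> that
    by (simp add: distrib_left infsum_add fock_ip_summable)
  show "fip S \<Phi> (fsc c \<Psi>) = c * fip S \<Phi> \<Psi>"
    unfolding fip_def using fock_ip_summable[OF \<Phi> \<Psi>]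
    by (simp add: mult.left_commute[of _ c] infsum_cmult_right)
  show "fip S \<Psi> \<Phi> = cnj (fip S \<Phi> \<Psi>)"
    unfolding fip_def by (simp flip: infsum_cnj add: mult.commute)
next
  fix \<Phi> assume \<Phi>: "\<Phi> \<in> F"
  show "0 \<le> Re (fip S \<Phi> \<Phi>)" using \<Phi> by (simp add: fip_self fnsq_nonneg)
  show "\<Phi> = 0" if "fip S \<Phi> \<Phi> = 0"
  proof (rule ext)
    have "fnsq \<Phi> = 0" using that \<Phi> by (simp add: fip_self)
    then show "\<Phi> xs = 0 xs" for xs
      using fock_value_bound[OF \<Phi>, of xs] fock_outside[OF \<Phi>, of xs] by (cases "set xs \<subseteq> S") auto
  qed
next
  fix X :: "nat \<Rightarrow> 'k fock"
  assume X: "\<And>n. X n \<in> F"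
    and "\<And>e. e > 0 \<Longrightarrow> \<exists>N. \<forall>m\<ge>N. \<forall>n\<ge>N. sqrt (Re (fip S (X m - X n) (X m - X n))) < e"
  then have C: "\<exists>N. \<forall>m\<ge>N. \<forall>n\<ge>N. sqrt (fnsq (X m - X n)) < e" if "e > 0" for e
    using that by (simp add: fip_self fock_diff)
  have "\<exists>l. (\<lambda>n. X n xs) \<longlonglongrightarrow> l" for xs
  proof (cases "set xs \<subseteq> S")
    case False
    then show ?thesis using X by (auto simp: fock_outside)
  next
    case True
    let ?p = "prod_list (map norm xs)"
    have p: "?p \<ge> 0" by (induction xs) auto
    have "Cauchy (\<lambda>n. X n xs)"
    proof (rule metric_CauchyI)
      fix e :: real assume e: "e > 0"
      obtain N where N: "\<forall>m\<ge>N. \<forall>n\<ge>N. sqrt (fnsq (X m - X n)) < e / (?p + 1)"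
        using C[of "e / (?p + 1)"] e p by auto
      have "dist (X m xs) (X n xs) < e" if "m \<ge> N" "n \<ge> N" for m n
      proof -
        have "cmod ((X m - X n) xs) \<le> sqrt (fnsq (X m - X n)) * ?p"
          by (rule fock_value_bound[OF fock_diff[OF X X]]) (use True in auto)
        also have "\<dots> \<le> e / (?p + 1) * ?p"
          using N that p by (intro mult_right_mono) (auto intro: less_imp_le)
        also have "\<dots> < e" using e p by (simp add: field_simps)
        finally show ?thesis by (simp add: dist_norm)
      qed
      then show "\<exists>M. \<forall>m\<ge>M. \<forall>n\<ge>M. dist (X m xs) (X n xs) < e" by blast
    qed
    then show ?thesis using Cauchy_convergent convergent_def by blast
  qed
  then obtain L where L: "\<And>xs. (\<lambda>n. X n xs) \<longlonglongrightarrow> L xs" by metis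
  have tail: "L - X n \<in> F \<and> fnsq (L - X n) \<le> e\<^sup>2"
    if N: "\<forall>m\<ge>N. \<forall>n\<ge>N. sqrt (fnsq (X m - X n)) < e" and n: "n \<ge> N" and e: "e > 0" for N e n
  proof -
    have "fnsq (X (m + N) - X n) \<le> e\<^sup>2" for m
      using N n e real_sqrt_less_iff[of "fnsq (X (m + N) - X n)" "e\<^sup>2"] by (simp add: less_imp_le)
    moreover have "(\<lambda>m. (X (m + N) - X n) xs) \<longlonglongrightarrow> (L - X n) xs" for xs
      using L[of xs, THEN LIMSEQ_ignore_initial_segment, of N] by (auto intro: tendsto_intros)
    ultimately show ?thesis
      using fock_pointwise_limit[of "\<lambda>m. X (m + N) - X n" "e\<^sup>2" "L - X n"] X by (simp add: fock_diff)
  qed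
  obtain N where N: "\<forall>m\<ge>N. \<forall>n\<ge>N. sqrt (fnsq (X m - X n)) < 1" using C[of 1] by auto
  have "L - X N \<in> F" using tail[OF N order_refl] by simp
  then have "(L - X N) + X N \<in> F" using X by (rule fock_add)
  then have LF: "L \<in> F" by simp
  have "(\<lambda>n. sqrt (Re (fip S (X n - L) (X n - L)))) \<longlonglongrightarrow> 0"
  proof (rule LIMSEQ_I)
    fix r :: real assume r: "r > 0"
    obtain N where N: "\<forall>m\<ge>N. \<forall>n\<ge>N. sqrt (fnsq (X m - X n)) < r / 2" using C[of "r / 2"] r by auto
    have "norm (sqrt (Re (fip S (X n - L) (X n - L))) - 0) < r" if n: "n \<ge> N" for n
    proof -
      have "fnsq (X n - L) = fnsq (L - X n)" by (simp add: fnsq_def norm_minus_commute)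
      then have "fnsq (X n - L) \<le> (r / 2)\<^sup>2" using tail[OF N n] r by simp
      then have "sqrt (fnsq (X n - L)) \<le> r / 2" by (rule real_le_lsqrt[rotated]) (use r in simp)
      then show ?thesis using r X LF by (simp add: fip_self fock_diff fnsq_nonneg)
    qed
    then show "\<exists>no. \<forall>n\<ge>no. norm (sqrt (Re (fip S (X n - L) (X n - L))) - 0) < r" by blast
  qed
  then show "\<exists>L\<in>F. (\<lambda>n. sqrt (Re (fip S (X n - L) (X n - L)))) \<longlonglongrightarrow> 0" using LF by blast
qed

end

section \<open>Creation and annihilation operators\<close>

text \<open>On $(x_1,\dots,x_n)$ this is
  $\sum_i (-1)^{i-1}\langle x_i, f\rangle\,\Phi(x_1,\dots,\widehat{x_i},\dots,x_n)$, the creation operator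
  up to the factor $1/\sqrt n$.  The recursion is the expansion along the first entry, on which the
  anticommutation relation rests.\<close>

primrec cr :: "'k::chilbert_space \<Rightarrow> 'k list \<Rightarrow> ('k list \<Rightarrow> complex) \<Rightarrow> complex" where
  "cr f [] \<Phi> = 0"
| "cr f (x # xs) \<Phi> = cinner x f * \<Phi> xs - cr f xs (\<lambda>ys. \<Phi> (x # ys))"

lemma cr_cong:
  assumes "\<And>ys. ys \<in> lists S \<Longrightarrow> Suc (length ys) = length xs \<Longrightarrow> \<Phi> ys = \<Psi> ys" "xs \<in> lists S"
  shows "cr f xs \<Phi> = cr f xs \<Psi>"
  using assms
proof (induction xs arbitrary: \<Phi> \<Psi>)
  case (Cons x xs)
  have "cr f xs (\<lambda>ys. \<Phi> (x # ys)) = cr f xs (\<lambda>ys. \<Psi> (x # ys))"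
    by (rule Cons.IH) (use Cons.prems in auto)
  then show ?case using Cons.prems by simp
qed simp

lemma cr_add: "cr f xs (\<lambda>ys. \<Phi> ys + \<Psi> ys) = cr f xs \<Phi> + cr f xs \<Psi>"
  by (induction xs arbitrary: \<Phi> \<Psi>) (simp_all add: distrib_left)

lemma cr_scale: "cr f xs (\<lambda>ys. c * \<Phi> ys) = c * cr f xs \<Phi>"
  by (induction xs arbitrary: \<Phi>) (simp_all add: right_diff_distrib mult.left_commute)

lemma cr_minus: "cr f xs (\<lambda>ys. - \<Phi> ys) = - cr f xs \<Phi>"
  using cr_scale[of f xs "-1" \<Phi>] by simp

lemma cr_add_vector: "cr (f + g) xs \<Phi> = cr f xs \<Phi> + cr g xs \<Phi>"
  by (induction xs arbitrary: \<Phi>) (simp_all add: cinner_simps algebra_simps)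

lemma cr_scale_vector: "cr (c *\<^sub>C f) xs \<Phi> = c * cr f xs \<Phi>"
  by (induction xs arbitrary: \<Phi>) (simp_all add: cinner_simps right_diff_distrib)

lemma cr_bound:
  assumes "\<And>ys. ys \<in> tuples S n \<Longrightarrow> cmod (\<Phi> ys) \<le> M * prod_list (map norm ys)" "xs \<in> tuples S (Suc n)"
  shows "cmod (cr f xs \<Phi>) \<le> (real (Suc n) * norm f * M) * prod_list (map norm xs)"
  using assms
proof (induction n arbitrary: \<Phi> M xs)
  case 0
  obtain x where xs: "xs = [x]" "x \<in> S" using 0(2) by (auto elim!: tuples_SucE)
  have "cmod (cinner x f) * cmod (\<Phi> []) \<le> (norm x * norm f) * M"
    using cinner_cauchy_schwarz[of x f] 0(1)[of "[]"] by (intro mult_mono) auto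
  then show ?case by (simp add: xs norm_mult ac_simps)
next
  case (Suc n)
  obtain x ys where xs: "xs = x # ys" "x \<in> S" "ys \<in> tuples S (Suc n)" using Suc.prems(2) by (rule tuples_SucE)
  have 1: "cmod (cinner x f * \<Phi> ys) \<le> (norm x * norm f) * (M * prod_list (map norm ys))"
    unfolding norm_mult using cinner_cauchy_schwarz[of x f] Suc.prems(1)[OF xs(3)] by (intro mult_mono) auto
  have 2: "cmod (cr f ys (\<lambda>ys. \<Phi> (x # ys))) \<le> (real (Suc n) * norm f * (M * norm x)) * prod_list (map norm ys)"
  proof (rule Suc.IH[OF _ xs(3)])
    show "cmod (\<Phi> (x # zs)) \<le> M * norm x * prod_list (map norm zs)" if "zs \<in> tuples S n" for zs
      using Suc.prems(1)[of "x # zs"] that xs(2) by (simp add: mult.assoc)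
  qed
  have "cmod (cr f xs \<Phi>) \<le> cmod (cinner x f * \<Phi> ys) + cmod (cr f ys (\<lambda>ys. \<Phi> (x # ys)))"
    by (simp add: xs norm_triangle_ineq4)
  also have "\<dots> \<le> (real (Suc (Suc n)) * norm f * M) * prod_list (map norm xs)"
    using add_mono[OF 1 2] by (simp add: xs algebra_simps)
  finally show ?case .
qed

lemma mform_cr:
  assumes \<Phi>: "mform S n \<Phi>"
  shows "mform S (Suc n) (\<lambda>xs. cr f xs \<Phi>)"
proof -
  have add: "cr f (xs @ (x + y) # ys) \<Phi> = cr f (xs @ x # ys) \<Phi> + cr f (xs @ y # ys) \<Phi>"
    if "mform S (length xs + length ys) \<Phi>" "xs \<in> lists S" "ys \<in> lists S" "x \<in> S" "y \<in> S" for xs ys x y \<Phi>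
    using that
  proof (induction xs arbitrary: \<Phi>)
    case Nil
    have "cr f ys (\<lambda>zs. \<Phi> ((x + y) # zs)) = cr f ys (\<lambda>zs. \<Phi> (x # zs) + \<Phi> (y # zs))"
    proof (rule cr_cong)
      show "\<Phi> ((x + y) # zs) = \<Phi> (x # zs) + \<Phi> (y # zs)" if "zs \<in> lists S" "Suc (length zs) = length ys" for zs
        using mform_add_arg[OF Nil(1), of "[]" zs x y] that Nil by simp
    qed (rule Nil)
    then show ?case by (simp add: cr_add cinner_simps algebra_simps)
  next
    case (Cons a xs)
    have "cr f (xs @ (x + y) # ys) (\<lambda>zs. \<Phi> (a # zs)) =
        cr f (xs @ x # ys) (\<lambda>zs. \<Phi> (a # zs)) + cr f (xs @ y # ys) (\<lambda>zs. \<Phi> (a # zs))"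
      by (rule Cons.IH) (use Cons.prems in \<open>auto intro: mform_Cons\<close>)
    moreover have "\<Phi> (xs @ (x + y) # ys) = \<Phi> (xs @ x # ys) + \<Phi> (xs @ y # ys)"
      by (rule mform_add_arg[OF Cons.prems(1)]) (use Cons.prems in auto)
    ultimately show ?case by (simp add: algebra_simps)
  qed
  have scale: "cr f (xs @ (c *\<^sub>C x) # ys) \<Phi> = cnj c * cr f (xs @ x # ys) \<Phi>"
    if "mform S (length xs + length ys) \<Phi>" "xs \<in> lists S" "ys \<in> lists S" "x \<in> S" for xs ys x c \<Phi>
    using that
  proof (induction xs arbitrary: \<Phi>)
    case Nil
    have "cr f ys (\<lambda>zs. \<Phi> ((c *\<^sub>C x) # zs)) = cr f ys (\<lambda>zs. cnj c * \<Phi> (x # zs))"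
    proof (rule cr_cong)
      show "\<Phi> ((c *\<^sub>C x) # zs) = cnj c * \<Phi> (x # zs)" if "zs \<in> lists S" "Suc (length zs) = length ys" for zs
        using mform_scale_arg[OF Nil(1), of "[]" zs x c] that Nil by simp
    qed (rule Nil)
    then show ?case by (simp add: cr_scale cinner_simps algebra_simps)
  next
    case (Cons a xs)
    have "cr f (xs @ (c *\<^sub>C x) # ys) (\<lambda>zs. \<Phi> (a # zs)) = cnj c * cr f (xs @ x # ys) (\<lambda>zs. \<Phi> (a # zs))"
      by (rule Cons.IH) (use Cons.prems in \<open>auto intro: mform_Cons\<close>)
    moreover have "\<Phi> (xs @ (c *\<^sub>C x) # ys) = cnj c * \<Phi> (xs @ x # ys)"
      by (rule mform_scale_arg[OF Cons.prems(1)]) (use Cons.prems in auto)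
    ultimately show ?case by (simp add: algebra_simps)
  qed
  obtain M where M: "\<And>xs. xs\<in>tuples S n \<Longrightarrow> cmod (\<Phi> xs) \<le> M * prod_list (map norm xs)"
    using mform_bound[OF \<Phi>] by blast
  show ?thesis
  proof (rule mformI)
    fix xs ys :: "'a list" and x y c
    assume *: "xs \<in> lists S" "ys \<in> lists S" "length xs + length ys + 1 = Suc n" "x \<in> S"
    then have \<Phi>': "mform S (length xs + length ys) \<Phi>" using \<Phi> by simp
    show "cr f (xs @ (x + y) # ys) \<Phi> = cr f (xs @ x # ys) \<Phi> + cr f (xs @ y # ys) \<Phi>" if "y \<in> S"
      by (rule add[OF \<Phi>' *(1,2,4) that])
    show "cr f (xs @ (c *\<^sub>C x) # ys) \<Phi> = cnj c * cr f (xs @ x # ys) \<Phi>"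
      by (rule scale[OF \<Phi>' *(1,2,4)])
  next
    show "cmod (cr f xs \<Phi>) \<le> (real (Suc n) * norm f * M) * prod_list (map norm xs)"
      if "xs \<in> tuples S (Suc n)" for xs
      by (rule cr_bound[OF M that])
  qed
qed

lemma alternating_Cons: "alternating S \<Phi> \<Longrightarrow> a \<in> S \<Longrightarrow> alternating S (\<lambda>xs. \<Phi> (a # xs))"
proof (rule alternatingI)
  fix xs ys x y assume *: "alternating S \<Phi>" "a \<in> S" "xs \<in> lists S" "ys \<in> lists S" "x \<in> S" "y \<in> S"
  show "\<Phi> (a # xs @ x # y # ys) = - \<Phi> (a # xs @ y # x # ys)"
    using alternatingD[OF *(1) _ *(4-6), of "a # xs"] *(2,3) by simp
qed

lemma alternating_cr:
  assumes "alternating S \<Phi>" shows "alternating S (\<lambda>xs. cr f xs \<Phi>)"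
proof (rule alternatingI)
  fix xs ys x y assume "xs \<in> lists S" and *: "ys \<in> lists S" "x \<in> S" "y \<in> S"
  then show "cr f (xs @ x # y # ys) \<Phi> = - cr f (xs @ y # x # ys) \<Phi>"
    using assms
  proof (induction xs arbitrary: \<Phi>)
    case Nil
    have "cr f ys (\<lambda>zs. \<Phi> (x # y # zs)) = cr f ys (\<lambda>zs. - \<Phi> (y # x # zs))"
    proof (rule cr_cong[OF _ *(1)])
      show "\<Phi> (x # y # zs) = - \<Phi> (y # x # zs)" if "zs \<in> lists S" for zs
        using alternatingD[OF Nil.prems(4), of "[]" zs x y] that * by simp
    qed
    then show ?case by (simp add: cr_minus)
  next
    case (Cons a xs)
    have a: "a \<in> S" using Cons.hyps by simp
    have "cr f (xs @ x # y # ys) (\<lambda>zs. \<Phi> (a # zs)) = - cr f (xs @ y # x # ys) (\<lambda>zs. \<Phi> (a # zs))"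
      by (rule Cons.IH) (use Cons.prems a alternating_Cons[OF Cons.prems(4) a] in simp_all)
    moreover have "\<Phi> (xs @ x # y # ys) = - \<Phi> (xs @ y # x # ys)"
      by (rule alternatingD[OF Cons.prems(4)]) (use Cons in auto)
    ultimately show ?case by simp
  qed
qed

lemma mform_cong:
  assumes eq: "\<And>xs. xs \<in> tuples S n \<Longrightarrow> \<Phi> xs = \<Psi> xs" and \<Phi>: "mform S n \<Phi>" and S: "\<And>x y. x \<in> S \<Longrightarrow> y \<in> S \<Longrightarrow> x + y \<in> S"
    "\<And>c x. x \<in> S \<Longrightarrow> c *\<^sub>C x \<in> S"
  shows "mform S n \<Psi>"
proof -
  obtain M where M: "\<And>xs. xs\<in>tuples S n \<Longrightarrow> cmod (\<Phi> xs) \<le> M * prod_list (map norm xs)"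
    using mform_bound[OF \<Phi>] by blast
  show ?thesis
  proof (rule mformI[where M = M])
    fix xs ys :: "'a list" and x y c
    assume *: "xs \<in> lists S" "ys \<in> lists S" "length xs + length ys + 1 = n" "x \<in> S"
    show "\<Psi> (xs @ (x + y) # ys) = \<Psi> (xs @ x # ys) + \<Psi> (xs @ y # ys)" if "y \<in> S"
      using mform_add_arg[OF \<Phi> * that] * that S(1)[of x y] by (simp add: eq[symmetric] tuples_def)
    show "\<Psi> (xs @ (c *\<^sub>C x) # ys) = cnj c * \<Psi> (xs @ x # ys)"
      using mform_scale_arg[OF \<Phi> *, of c] * S(2)[of x c] by (simp add: eq[symmetric] tuples_def)
  qed (simp add: M eq[symmetric])
qed

context fock_onb
begin

definition sqsum :: "nat \<Rightarrow> ('k list \<Rightarrow> complex) \<Rightarrow> bool"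
  where "sqsum n \<Phi> \<longleftrightarrow> (\<lambda>es. (cmod (\<Phi> es))\<^sup>2) summable_on tuples E n"

lemma sqsum_Suc: "sqsum (Suc n) \<Phi> \<longleftrightarrow> (\<lambda>(e, es). (cmod (\<Phi> (e # es)))\<^sup>2) summable_on E \<times> tuples E n"
  by (simp add: sqsum_def summable_on_def has_sum_tuples_Suc)

lemma sqsum_Cons: "sqsum (Suc n) \<Phi> \<Longrightarrow> e \<in> E \<Longrightarrow> sqsum n (\<lambda>es. \<Phi> (e # es))"
  unfolding sqsum_Suc unfolding sqsum_def by (rule summable_on_SigmaD1)

lemma has_sum_cinner_sq: "f \<in> S \<Longrightarrow> ((\<lambda>e. (cmod (cinner e f))\<^sup>2) has_sum (norm f)\<^sup>2) E"
  by (rule parseval_norm[OF onb])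

lemma has_sum_tensor_sq:
  assumes f: "f \<in> S" and s: "((\<lambda>es. (cmod (\<Phi> es))\<^sup>2) has_sum s) (tuples E n)"
  shows "((\<lambda>(e, es). (cmod (cinner e f * \<Phi> es))\<^sup>2) has_sum ((norm f)\<^sup>2 * s)) (E \<times> tuples E n)"
proof (rule has_sum_Sigma_nonneg)
  show "((\<lambda>e. (cmod (cinner e f))\<^sup>2 * s) has_sum ((norm f)\<^sup>2 * s)) E"
    by (rule has_sum_cmult_left[OF has_sum_cinner_sq[OF f]])
  show "((\<lambda>es. case (e, es) of (e, es) \<Rightarrow> (cmod (cinner e f * \<Phi> es))\<^sup>2) has_sum ((cmod (cinner e f))\<^sup>2 * s)) (tuples E n)" for e
    using has_sum_cmult_right[OF s] by (simp add: norm_mult power_mult_distrib)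
qed auto

text \<open>The constant obtained here grows with \<open>n\<close>; this is enough to justify the manipulation of sums at
  a fixed particle number, from which the sharp bound then follows.\<close>

lemma cr_square_sum:
  assumes f: "f \<in> S"
  shows "\<exists>C. \<forall>\<Phi> s. ((\<lambda>es. (cmod (\<Phi> es))\<^sup>2) has_sum s) (tuples E n) \<longrightarrow>
    (\<exists>t. ((\<lambda>es. (cmod (cr f es \<Phi>))\<^sup>2) has_sum t) (tuples E (Suc n)) \<and> t \<le> C * s)"
proof (induction n)
  case 0
  show ?case
  proof (rule exI[of _ "(norm f)\<^sup>2"], intro allI impI)
    fix \<Phi> :: "'k list \<Rightarrow> complex" and s
    assume "((\<lambda>es. (cmod (\<Phi> es))\<^sup>2) has_sum s) (tuples E 0)"
    note tensor = has_sum_tensor_sq[OF f this]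
    have "((\<lambda>(e, es). (cmod (cr f (e # es) \<Phi>))\<^sup>2) has_sum ((norm f)\<^sup>2 * s)) (E \<times> tuples E 0) \<longleftrightarrow>
        ((\<lambda>(e, es). (cmod (cinner e f * \<Phi> es))\<^sup>2) has_sum ((norm f)\<^sup>2 * s)) (E \<times> tuples E 0)"
      by (rule has_sum_cong) auto
    then have "((\<lambda>es. (cmod (cr f es \<Phi>))\<^sup>2) has_sum ((norm f)\<^sup>2 * s)) (tuples E (Suc 0))"
      unfolding has_sum_tuples_Suc using tensor by blast
    then show "\<exists>t. ((\<lambda>es. (cmod (cr f es \<Phi>))\<^sup>2) has_sum t) (tuples E (Suc 0)) \<and> t \<le> (norm f)\<^sup>2 * s"
      by blast
  qed
next
  case (Suc n)
  then obtain C where C: "\<And>\<Phi> s. ((\<lambda>es. (cmod (\<Phi> es))\<^sup>2) has_sum s) (tuples E n) \<Longrightarrow>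
    \<exists>t. ((\<lambda>es. (cmod (cr f es \<Phi>))\<^sup>2) has_sum t) (tuples E (Suc n)) \<and> t \<le> C * s" by blast
  show ?case
  proof (rule exI[of _ "2 * (norm f)\<^sup>2 + 2 * C"], intro allI impI)
    fix \<Phi> :: "'k list \<Rightarrow> complex" and s
    assume s: "((\<lambda>es. (cmod (\<Phi> es))\<^sup>2) has_sum s) (tuples E (Suc n))"
    define g where "g e = infsum (\<lambda>es. (cmod (\<Phi> (e # es)))\<^sup>2) (tuples E n)" for e
    have sum: "((\<lambda>(e, es). (cmod (\<Phi> (e # es)))\<^sup>2) has_sum s) (E \<times> tuples E n)"
      using s by (simp only: has_sum_tuples_Suc)
    have g: "((\<lambda>es. (cmod (\<Phi> (e # es)))\<^sup>2) has_sum g e) (tuples E n)" if "e \<in> E" for e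
      unfolding g_def by (rule has_sum_infsum, rule summable_on_SigmaD1[OF has_sum_imp_summable[OF sum] that])
    have gs: "(g has_sum s) E"
      by (rule has_sum_SigmaD[OF sum]) (simp add: g)
    have "\<exists>h. \<forall>e\<in>E. ((\<lambda>es. (cmod (cr f es (\<lambda>es. \<Phi> (e # es))))\<^sup>2) has_sum h e) (tuples E (Suc n)) \<and> h e \<le> C * g e"
      using C[OF g] by (intro bchoice) blast
    then obtain h where h: "\<And>e. e \<in> E \<Longrightarrow> ((\<lambda>es. (cmod (cr f es (\<lambda>es. \<Phi> (e # es))))\<^sup>2) has_sum h e) (tuples E (Suc n))"
      "\<And>e. e \<in> E \<Longrightarrow> h e \<le> C * g e" by blast
    have Cgs: "((\<lambda>e. C * g e) has_sum (C * s)) E" by (rule has_sum_cmult_right[OF gs])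
    have "h summable_on E"
      by (rule summable_on_comparison_test[OF has_sum_imp_summable[OF Cgs]])
         (use h in \<open>auto intro: has_sum_nonneg[OF h(1)]\<close>)
    then obtain H where H: "(h has_sum H) E" by (auto simp: summable_on_def)
    have HC: "H \<le> C * s" by (rule has_sum_mono[OF H Cgs h(2)])
    have tail: "((\<lambda>(e, es). (cmod (cr f es (\<lambda>es. \<Phi> (e # es))))\<^sup>2) has_sum H) (E \<times> tuples E (Suc n))"
      by (rule has_sum_Sigma_nonneg[OF _ H]) (auto intro: h)
    let ?b = "\<lambda>(e, es). 2 * (cmod (cinner e f * \<Phi> es))\<^sup>2 + 2 * (cmod (cr f es (\<lambda>es. \<Phi> (e # es))))\<^sup>2"
    have b: "(?b has_sum (2 * ((norm f)\<^sup>2 * s) + 2 * H)) (E \<times> tuples E (Suc n))"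
      using has_sum_add[OF has_sum_cmult_right[OF has_sum_tensor_sq[OF f s], of 2] has_sum_cmult_right[OF tail, of 2]]
      by (simp add: case_prod_unfold)
    let ?c = "\<lambda>(e, es). (cmod (cr f (e # es) \<Phi>))\<^sup>2"
    have cb: "?c z \<le> ?b z" for z
      using norm_add_sq_le[of "cinner (fst z) f * \<Phi> (snd z)" "- cr f (snd z) (\<lambda>es. \<Phi> (fst z # es))"]
      by (simp add: case_prod_unfold)
    have "?c summable_on E \<times> tuples E (Suc n)"
      by (rule summable_on_comparison_test[OF has_sum_imp_summable[OF b] cb]) (auto simp: case_prod_unfold)
    then obtain t where t: "(?c has_sum t) (E \<times> tuples E (Suc n))" by (auto simp: summable_on_def)
    have "t \<le> 2 * ((norm f)\<^sup>2 * s) + 2 * H" by (rule has_sum_mono[OF t b cb])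
    then have "t \<le> (2 * (norm f)\<^sup>2 + 2 * C) * s" using HC by (simp add: algebra_simps)
    then show "\<exists>t. ((\<lambda>es. (cmod (cr f es \<Phi>))\<^sup>2) has_sum t) (tuples E (Suc (Suc n))) \<and> t \<le> (2 * (norm f)\<^sup>2 + 2 * C) * s"
      using t unfolding has_sum_tuples_Suc[where n = "Suc n"] by blast
  qed
qed

lemma sqsum_cr: "f \<in> S \<Longrightarrow> sqsum n \<Phi> \<Longrightarrow> sqsum (Suc n) (\<lambda>es. cr f es \<Phi>)"
  using cr_square_sum[of f n] unfolding sqsum_def summable_on_def by blast

lemma sqsum_head:
  assumes "mform S (Suc n) \<Phi>" "sqsum (Suc n) \<Phi>" "f \<in> S"
  shows "sqsum n (\<lambda>es. \<Phi> (f # es))"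
proof -
  have ET: "es \<in> tuples S n" if "es \<in> tuples E n" for es using that tuples_mono[OF E_sub] by blast
  have "\<exists>N. \<forall>es\<in>tuples E n. ((\<lambda>e. (cmod (\<Phi> (e # es)))\<^sup>2) has_sum N es) E \<and>
      (cmod (\<Phi> (f # es)))\<^sup>2 \<le> (norm f)\<^sup>2 * N es"
    using mform_head_norm[OF assms(1) onb ET] onb assms(3) by (intro bchoice) blast
  then obtain N where N: "\<And>es. es \<in> tuples E n \<Longrightarrow> ((\<lambda>e. (cmod (\<Phi> (e # es)))\<^sup>2) has_sum N es) E"
    "\<And>es. es \<in> tuples E n \<Longrightarrow> (cmod (\<Phi> (f # es)))\<^sup>2 \<le> (norm f)\<^sup>2 * N es" by blast
  have "(\<lambda>(es, e). (cmod (\<Phi> (e # es)))\<^sup>2) summable_on tuples E n \<times> E"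
    using assms(2) unfolding sqsum_Suc by (subst (asm) summable_on_swap) simp
  then obtain s where "((\<lambda>(es, e). (cmod (\<Phi> (e # es)))\<^sup>2) has_sum s) (tuples E n \<times> E)" by (auto simp: summable_on_def)
  then have "(N has_sum s) (tuples E n)" by (rule has_sum_SigmaD) (simp add: N)
  then have "(\<lambda>es. (norm f)\<^sup>2 * N es) summable_on tuples E n"
    using has_sum_imp_summable summable_on_cmult_right by blast
  then show ?thesis unfolding sqsum_def
    by (rule summable_on_comparison_test) (auto simp: N)
qed

text \<open>By antisymmetry the $n+1$ summands of the creator contribute equally to the pairing.\<close>

lemma cr_pairing:
  assumes f: "f \<in> S"
  shows "sqsum n \<Phi> \<Longrightarrow> mform S (Suc n) \<Psi> \<Longrightarrow> alternating S \<Psi> \<Longrightarrow> sqsum (Suc n) \<Psi> \<Longrightarrow>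
    (\<Sum>\<^sub>\<infinity>es\<in>tuples E (Suc n). cnj (cr f es \<Phi>) * \<Psi> es) =
    of_nat (Suc n) * (\<Sum>\<^sub>\<infinity>es\<in>tuples E n. cnj (\<Phi> es) * \<Psi> (f # es))"
proof (induction n arbitrary: \<Phi> \<Psi>)
  have head: "((\<lambda>(e, es). cnj (cinner e f * \<Phi> es) * \<Psi> (e # es)) has_sum
        (\<Sum>\<^sub>\<infinity>es\<in>tuples E n. cnj (\<Phi> es) * \<Psi> (f # es))) (E \<times> tuples E n)"
    if \<Phi>: "sqsum n \<Phi>" and form: "mform S (Suc n) \<Psi>" and \<Psi>: "sqsum (Suc n) \<Psi>" for n \<Phi> \<Psi>
  proof -
    obtain s where "((\<lambda>es. (cmod (\<Phi> es))\<^sup>2) has_sum s) (tuples E n)" using \<Phi> by (auto simp: sqsum_def summable_on_def)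
    from has_sum_imp_summable[OF has_sum_tensor_sq[OF f this]]
    have "(\<lambda>z. cnj (case z of (e, es) \<Rightarrow> cinner e f * \<Phi> es) * (case z of (e, es) \<Rightarrow> \<Psi> (e # es))) summable_on E \<times> tuples E n"
      using \<Psi> unfolding sqsum_Suc by (intro summable_sq_mult) (simp_all add: case_prod_unfold)
    then have summ: "(\<lambda>(e, es). cnj (cinner e f * \<Phi> es) * \<Psi> (e # es)) summable_on E \<times> tuples E n"
      by (simp add: case_prod_unfold)
    then obtain t where t: "((\<lambda>(e, es). cnj (cinner e f * \<Phi> es) * \<Psi> (e # es)) has_sum t) (E \<times> tuples E n)"
      by (auto simp: summable_on_def)
    then have "((\<lambda>(es, e). cnj (cinner e f * \<Phi> es) * \<Psi> (e # es)) has_sum t) (tuples E n \<times> E)"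
      by (subst (asm) has_sum_swap) simp
    then have "((\<lambda>es. cnj (\<Phi> es) * \<Psi> (f # es)) has_sum t) (tuples E n)"
    proof (rule has_sum_SigmaD)
      fix es assume "es \<in> tuples E n"
      then have "es \<in> tuples S n" using tuples_mono[OF E_sub] by blast
      then have "((\<lambda>e. cinner f e * \<Psi> (e # es)) has_sum \<Psi> (f # es)) E"
        using mform_head_norm[OF form onb] onb f by blast
      from has_sum_cmult_right[OF this, of "cnj (\<Phi> es)"]
      show "((\<lambda>e. case (es, e) of (es, e) \<Rightarrow> cnj (cinner e f * \<Phi> es) * \<Psi> (e # es)) has_sum cnj (\<Phi> es) * \<Psi> (f # es)) E"
        by (simp add: cinner_commute[of _ f] ac_simps)
    qed
    then show ?thesis using t by (simp add: infsumI)
  qed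
  {
    case 0
    have "((\<lambda>(e, es). cnj (cr f (e # es) \<Phi>) * \<Psi> (e # es)) has_sum
        (\<Sum>\<^sub>\<infinity>es\<in>tuples E 0. cnj (\<Phi> es) * \<Psi> (f # es))) (E \<times> tuples E 0)"
      using head[OF 0(1,2,4)] by (rule has_sum_cong[THEN iffD1, rotated]) auto
    then have "((\<lambda>es. cnj (cr f es \<Phi>) * \<Psi> es) has_sum
        (\<Sum>\<^sub>\<infinity>es\<in>tuples E 0. cnj (\<Phi> es) * \<Psi> (f # es))) (tuples E (Suc 0))"
      by (simp only: has_sum_tuples_Suc)
    then show ?case by (simp only: infsumI) simp
  next
    case (Suc n)
    let ?R = "\<Sum>\<^sub>\<infinity>es\<in>tuples E (Suc n). cnj (\<Phi> es) * \<Psi> (f # es)"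
    have ES: "e \<in> S" if "e \<in> E" for e using that E_sub by blast
    have "(\<lambda>z. cnj (case z of (e, es) \<Rightarrow> cr f (e # es) \<Phi>) * (case z of (e, es) \<Rightarrow> \<Psi> (e # es))) summable_on E \<times> tuples E (Suc n)"
      using Suc.prems(4) sqsum_cr[OF f Suc.prems(1)] unfolding sqsum_Suc[of "Suc n"]
      by (intro summable_sq_mult) (simp_all add: case_prod_unfold)
    then obtain t where t: "((\<lambda>(e, es). cnj (cr f (e # es) \<Phi>) * \<Psi> (e # es)) has_sum t) (E \<times> tuples E (Suc n))"
      by (auto simp: summable_on_def case_prod_unfold)
    \<comment> \<open>Without the first term of the expansion, the induction hypothesis applies to each \<open>e\<close>;
      moving \<open>f\<close> past \<open>e\<close> compensates the sign.\<close>
    have split: "(\<lambda>z. (case z of (e, es) \<Rightarrow> cnj (cinner e f * \<Phi> es) * \<Psi> (e # es)) +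
          - (case z of (e, es) \<Rightarrow> cnj (cr f (e # es) \<Phi>) * \<Psi> (e # es))) =
        (\<lambda>(e, es). cnj (cr f es (\<lambda>es. \<Phi> (e # es))) * \<Psi> (e # es))"
      by (rule ext) (simp add: case_prod_unfold left_diff_distrib)
    have tail: "((\<lambda>(e, es). cnj (cr f es (\<lambda>es. \<Phi> (e # es))) * \<Psi> (e # es)) has_sum (?R - t)) (E \<times> tuples E (Suc n))"
      using has_sum_add[OF head[OF Suc.prems(1,2,4)] has_sum_uminusI[OF t]] unfolding split by simp
    have inner: "((\<lambda>es. cnj (cr f es (\<lambda>es. \<Phi> (e # es))) * \<Psi> (e # es)) has_sum
        - (of_nat (Suc n) * (\<Sum>\<^sub>\<infinity>es\<in>tuples E n. cnj (\<Phi> (e # es)) * \<Psi> (f # e # es)))) (tuples E (Suc n))"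
      if e: "e \<in> E" for e
    proof -
      have "(\<Sum>\<^sub>\<infinity>es\<in>tuples E (Suc n). cnj (cr f es (\<lambda>es. \<Phi> (e # es))) * \<Psi> (e # es)) =
          of_nat (Suc n) * (\<Sum>\<^sub>\<infinity>es\<in>tuples E n. cnj (\<Phi> (e # es)) * \<Psi> (e # f # es))"
        by (rule Suc.IH) (use Suc.prems e ES in \<open>auto intro: sqsum_Cons mform_Cons alternating_Cons\<close>)
      also have "(\<Sum>\<^sub>\<infinity>es\<in>tuples E n. cnj (\<Phi> (e # es)) * \<Psi> (e # f # es)) =
          (\<Sum>\<^sub>\<infinity>es\<in>tuples E n. - (cnj (\<Phi> (e # es)) * \<Psi> (f # e # es)))"
      proof (rule infsum_cong)
        fix es assume "es \<in> tuples E n"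
        then have "es \<in> lists S" using E_sub by (auto simp: tuples_def)
        then show "cnj (\<Phi> (e # es)) * \<Psi> (e # f # es) = - (cnj (\<Phi> (e # es)) * \<Psi> (f # e # es))"
          using alternatingD[OF Suc.prems(3), of "[]" es e f] f ES[OF e] by simp
      qed
      finally have pairing_value: "(\<Sum>\<^sub>\<infinity>es\<in>tuples E (Suc n). cnj (cr f es (\<lambda>es. \<Phi> (e # es))) * \<Psi> (e # es)) =
        - (of_nat (Suc n) * (\<Sum>\<^sub>\<infinity>es\<in>tuples E n. cnj (\<Phi> (e # es)) * \<Psi> (f # e # es)))"
        unfolding infsum_uminus mult_minus_right .
      have "(\<lambda>es. cnj (cr f es (\<lambda>es. \<Phi> (e # es))) * \<Psi> (e # es)) summable_on tuples E (Suc n)"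
        using summable_on_SigmaD1[OF has_sum_imp_summable[OF tail] e] .
      from has_sum_infsum[OF this] show ?thesis unfolding pairing_value .
    qed
    have R: "((\<lambda>e. \<Sum>\<^sub>\<infinity>es\<in>tuples E n. cnj (\<Phi> (e # es)) * \<Psi> (f # e # es)) has_sum ?R) E"
    proof -
      have "(\<lambda>es. cnj (\<Phi> es) * \<Psi> (f # es)) summable_on tuples E (Suc n)"
        using Suc.prems(1) sqsum_head[OF Suc.prems(2,4) f] unfolding sqsum_def by (rule summable_sq_mult)
      then have sumR: "((\<lambda>(e, es). cnj (\<Phi> (e # es)) * \<Psi> (f # e # es)) has_sum ?R) (E \<times> tuples E n)"
        unfolding has_sum_tuples_Suc[symmetric, of "\<lambda>es. cnj (\<Phi> es) * \<Psi> (f # es)"] by (rule has_sum_infsum)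
      show ?thesis
        by (rule has_sum_SigmaD[OF sumR], unfold case_prod_conv, rule has_sum_infsum,
            rule summable_on_SigmaD1[OF has_sum_imp_summable[OF sumR]])
    qed
    have "((\<lambda>e. - (of_nat (Suc n) * (\<Sum>\<^sub>\<infinity>es\<in>tuples E n. cnj (\<Phi> (e # es)) * \<Psi> (f # e # es)))) has_sum (?R - t)) E"
      by (rule has_sum_SigmaD[OF tail], unfold case_prod_conv, rule inner)
    moreover have "((\<lambda>e. - (of_nat (Suc n) * (\<Sum>\<^sub>\<infinity>es\<in>tuples E n. cnj (\<Phi> (e # es)) * \<Psi> (f # e # es)))) has_sum (- (of_nat (Suc n) * ?R))) E"
      by (intro has_sum_uminusI has_sum_cmult_right R)
    ultimately have "?R - t = - (of_nat (Suc n) * ?R)" by (rule has_sum_unique)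
    then have "t = of_nat (Suc (Suc n)) * ?R" by (simp add: algebra_simps)
    moreover have "(\<Sum>\<^sub>\<infinity>es\<in>tuples E (Suc (Suc n)). cnj (cr f es \<Phi>) * \<Psi> es) = t"
      using t unfolding has_sum_tuples_Suc[symmetric, of "\<lambda>es. cnj (cr f es \<Phi>) * \<Psi> es"] by (rule infsumI)
    ultimately show ?case by simp
  }
qed

end

context fock_onb
begin

text \<open>The requirements on Fock vectors which can be checked at each particle number separately.\<close>

definition lv :: "('k list \<Rightarrow> complex) \<Rightarrow> bool"
  where "lv \<Phi> \<longleftrightarrow> (\<forall>n. mform S n \<Phi> \<and> sqsum n \<Phi>) \<and> alternating S \<Phi>"

text \<open>The adjoint of the annihilator.  On the empty list it vanishes, as it should, because \<open>cr\<close> does.\<close>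

definition creator :: "'k \<Rightarrow> 'k fock \<Rightarrow> 'k fock"
  where "creator f \<Phi> = (\<lambda>xs. if set xs \<subseteq> S then cr f xs \<Phi> / complex_of_real (sqrt (real (length xs))) else 0)"

definition ann :: "'k \<Rightarrow> 'k fock \<Rightarrow> 'k fock"
  where "ann f \<Phi> = (\<lambda>xs. complex_of_real (sqrt (real (length xs + 1))) * \<Phi> (f # xs))"

text \<open>Inner product and squared norm of the \<open>n\<close>-particle components.\<close>

definition lip :: "nat \<Rightarrow> 'k fock \<Rightarrow> 'k fock \<Rightarrow> complex"
  where "lip n \<Phi> \<Psi> = (\<Sum>\<^sub>\<infinity>xs\<in>tuples E n. cnj (\<Phi> xs) * \<Psi> xs)"

definition lsq :: "nat \<Rightarrow> 'k fock \<Rightarrow> real"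
  where "lsq n \<Phi> = (\<Sum>\<^sub>\<infinity>xs\<in>tuples E n. (cmod (\<Phi> xs))\<^sup>2)"

lemma tuples_E_sub: "es \<in> tuples E n \<Longrightarrow> es \<in> tuples S n"
  using tuples_mono[OF E_sub] by blast

lemma sqsum_cong:
  assumes "\<And>xs. xs \<in> tuples S n \<Longrightarrow> \<Phi> xs = \<Psi> xs" "sqsum n \<Phi>" shows "sqsum n \<Psi>"
proof -
  have "(\<lambda>es. (cmod (\<Phi> es))\<^sup>2) summable_on tuples E n \<longleftrightarrow> (\<lambda>es. (cmod (\<Psi> es))\<^sup>2) summable_on tuples E n"
    by (rule summable_on_cong) (simp add: assms(1) tuples_E_sub)
  then show ?thesis using assms(2) by (simp add: sqsum_def)
qed

lemma sqsum_fsc: "sqsum n \<Phi> \<Longrightarrow> sqsum n (fsc c \<Phi>)"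
  unfolding sqsum_def fsc_apply norm_mult power_mult_distrib by (rule summable_on_cmult_right)

lemma mform_eq_on: "mform S n \<Phi> \<Longrightarrow> (\<And>xs. xs \<in> tuples S n \<Longrightarrow> \<Phi> xs = \<Psi> xs) \<Longrightarrow> mform S n \<Psi>"
  by (rule mform_cong[OF _ _ S.add_mem S.sc_mem])

lemma mform_0: "mform S 0 \<Phi>"
  by (rule mformI[where M = "cmod (\<Phi> [])"]) auto

lemma sqsum_0: "sqsum 0 \<Phi>"
  by (simp add: sqsum_def)

lemma lv_creator: assumes f: "f \<in> S" and \<Phi>: "lv \<Phi>" shows "lv (creator f \<Phi>)"
  unfolding lv_def
proof (intro conjI allI)
  fix n
  have eq: "fsc (1 / complex_of_real (sqrt (real (Suc m)))) (\<lambda>xs. cr f xs \<Phi>) xs = creator f \<Phi> xs"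
    if "xs \<in> tuples S (Suc m)" for m xs
    using that by (auto simp: creator_def tuples_def)
  show "mform S n (creator f \<Phi>)"
  proof (cases n)
    case (Suc m)
    have "mform S (Suc m) (\<lambda>xs. cr f xs \<Phi>)" using \<Phi> by (intro mform_cr) (simp add: lv_def)
    from mform_eq_on[OF mform_fsc[OF this] eq] show ?thesis by (simp add: Suc)
  qed (simp add: mform_0)
  show "sqsum n (creator f \<Phi>)"
  proof (cases n)
    case (Suc m)
    have "sqsum (Suc m) (\<lambda>xs. cr f xs \<Phi>)" using \<Phi> f by (intro sqsum_cr) (simp_all add: lv_def)
    from sqsum_cong[OF eq sqsum_fsc[OF this]] show ?thesis by (simp add: Suc)
  qed (simp add: sqsum_0)
next
  have alt: "alternating S (\<lambda>xs. cr f xs \<Phi>)" using \<Phi> by (intro alternating_cr) (simp add: lv_def)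
  show "alternating S (creator f \<Phi>)"
  proof (rule alternatingI)
    fix xs ys x y assume *: "xs \<in> lists S" "ys \<in> lists S" "x \<in> S" "y \<in> S"
    have "set (xs @ x # y # ys) \<subseteq> S" "set (xs @ y # x # ys) \<subseteq> S" using * by auto
    then show "creator f \<Phi> (xs @ x # y # ys) = - creator f \<Phi> (xs @ y # x # ys)"
      unfolding creator_def alternatingD[OF alt *] by simp
  qed
qed

lemma lv_ann: assumes f: "f \<in> S" and \<Phi>: "lv \<Phi>" shows "lv (ann f \<Phi>)"
  unfolding lv_def
proof (intro conjI allI)
  fix n
  have eq: "fsc (complex_of_real (sqrt (real (n + 1)))) (\<lambda>xs. \<Phi> (f # xs)) xs = ann f \<Phi> xs"
    if "xs \<in> tuples S n" for xs
    using that by (auto simp: ann_def tuples_def)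
  have "mform S n (\<lambda>xs. \<Phi> (f # xs))" using \<Phi> f by (intro mform_Cons) (simp_all add: lv_def)
  from mform_eq_on[OF mform_fsc[OF this] eq] show "mform S n (ann f \<Phi>)" .
  have "sqsum n (\<lambda>xs. \<Phi> (f # xs))" using \<Phi> f by (intro sqsum_head) (simp_all add: lv_def)
  from sqsum_cong[OF eq sqsum_fsc[OF this]] show "sqsum n (ann f \<Phi>)" .
next
  have alt: "alternating S (\<lambda>xs. \<Phi> (f # xs))" using \<Phi> f by (intro alternating_Cons) (simp_all add: lv_def)
  show "alternating S (ann f \<Phi>)"
  proof (rule alternatingI)
    fix xs ys x y assume *: "xs \<in> lists S" "ys \<in> lists S" "x \<in> S" "y \<in> S"
    show "ann f \<Phi> (xs @ x # y # ys) = - ann f \<Phi> (xs @ y # x # ys)"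
      unfolding ann_def alternatingD[OF alt *] by simp
  qed
qed

lemma creator_ann_anticommute:
  assumes "f \<in> S" "g \<in> S" "xs \<in> lists S"
  shows "ann g (creator f \<Phi>) xs + creator f (ann g \<Phi>) xs = cinner g f * \<Phi> xs"
proof -
  have xs: "set xs \<subseteq> S" using assms(3) by auto
  have "cr f xs (ann g \<Phi>) = cr f xs (\<lambda>ys. complex_of_real (sqrt (real (length xs))) * \<Phi> (g # ys))"
    by (rule cr_cong[OF _ assms(3)]) (simp add: ann_def)
  then have "creator f (ann g \<Phi>) xs = cr f xs (\<lambda>ys. \<Phi> (g # ys))"
    using xs by (cases "xs = []") (simp_all add: creator_def cr_scale)
  moreover have "ann g (creator f \<Phi>) xs = cr f (g # xs) \<Phi>"
    using xs assms(2) by (simp add: ann_def creator_def)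
  ultimately show ?thesis by simp
qed

text \<open>The factor \<open>Suc n\<close> of the pairing is divided between the two operators.\<close>

lemma lip_creator:
  assumes f: "f \<in> S" and "lv \<Phi>" "lv \<Psi>"
  shows "lip (Suc n) (creator f \<Phi>) \<Psi> = lip n \<Phi> (ann f \<Psi>)"
proof -
  define r where "r = complex_of_real (sqrt (real (Suc n)))"
  have r: "r * r = of_nat (Suc n)" "r \<noteq> 0" "cnj r = r"
    by (auto simp: r_def simp flip: of_real_mult simp del: of_nat_Suc)
  have "lip (Suc n) (creator f \<Phi>) \<Psi> = (\<Sum>\<^sub>\<infinity>es\<in>tuples E (Suc n). (1 / r) * (cnj (cr f es \<Phi>) * \<Psi> es))"
    unfolding lip_def
  proof (rule infsum_cong)
    fix es assume "es \<in> tuples E (Suc n)"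
    then have "set es \<subseteq> S" "length es = Suc n" using tuples_E_sub[of es] by (auto simp: tuples_def)
    then show "cnj (creator f \<Phi> es) * \<Psi> es = (1 / r) * (cnj (cr f es \<Phi>) * \<Psi> es)"
      using r(3) by (simp add: creator_def r_def[symmetric] del: of_nat_Suc)
  qed
  also have "\<dots> = (1 / r) * (\<Sum>\<^sub>\<infinity>es\<in>tuples E (Suc n). cnj (cr f es \<Phi>) * \<Psi> es)"
    by (rule infsum_cmult_right')
  also have "\<dots> = (1 / r) * (r * r * (\<Sum>\<^sub>\<infinity>es\<in>tuples E n. cnj (\<Phi> es) * \<Psi> (f # es)))"
    unfolding r(1) using assms by (subst cr_pairing) (auto simp: lv_def)
  also have "\<dots> = r * (\<Sum>\<^sub>\<infinity>es\<in>tuples E n. cnj (\<Phi> es) * \<Psi> (f # es))"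
    using r(2) by simp
  also have "\<dots> = (\<Sum>\<^sub>\<infinity>es\<in>tuples E n. r * (cnj (\<Phi> es) * \<Psi> (f # es)))"
    by (rule infsum_cmult_right'[symmetric])
  also have "\<dots> = lip n \<Phi> (ann f \<Psi>)"
    unfolding lip_def by (rule infsum_cong) (simp add: ann_def r_def tuples_def)
  finally show ?thesis .
qed

lemma lv_summable: "lv \<Phi> \<Longrightarrow> lv \<Psi> \<Longrightarrow> (\<lambda>xs. cnj (\<Phi> xs) * \<Psi> xs) summable_on tuples E n"
  unfolding lv_def sqsum_def by (intro summable_sq_mult) auto

lemma lip_commute: "lip n \<Psi> \<Phi> = cnj (lip n \<Phi> \<Psi>)"
  unfolding lip_def by (simp flip: infsum_cnj add: mult.commute)

lemma lsq_has_sum: "lv \<Phi> \<Longrightarrow> ((\<lambda>xs. (cmod (\<Phi> xs))\<^sup>2) has_sum lsq n \<Phi>) (tuples E n)"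
  unfolding lsq_def by (rule has_sum_infsum) (simp add: lv_def sqsum_def)

lemma lip_self: "lv \<Phi> \<Longrightarrow> lip n \<Phi> \<Phi> = complex_of_real (lsq n \<Phi>)"
proof -
  assume "lv \<Phi>"
  then have "((\<lambda>xs. complex_of_real ((cmod (\<Phi> xs))\<^sup>2)) has_sum complex_of_real (lsq n \<Phi>)) (tuples E n)"
    unfolding has_sum_of_real_iff by (rule lsq_has_sum)
  then show ?thesis
    unfolding lip_def by (simp add: infsumI complex_norm_square mult.commute del: of_real_power)
qed

lemma lsq_nonneg: "0 \<le> lsq n \<Phi>"
  unfolding lsq_def by (rule infsum_nonneg) simp

text \<open>The anticommutation relation turns the level-wise adjointness into
  $\Vert a(f)^*\Phi\Vert^2 + \Vert a(f)\Phi\Vert^2 = \Vert f\Vert^2\Vert\Phi\Vert^2$.\<close>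

lemma lsq_creator_ann:
  assumes f: "f \<in> S" and \<Phi>: "lv \<Phi>"
  shows "lsq (Suc (Suc n)) (creator f \<Phi>) + lsq n (ann f \<Phi>) = (norm f)\<^sup>2 * lsq (Suc n) \<Phi>"
    and "lsq (Suc 0) (creator f \<Phi>) = (norm f)\<^sup>2 * lsq 0 \<Phi>"
proof -
  have c: "lv (creator f \<Phi>)" and a: "lv (ann f \<Phi>)" and ca: "lv (creator f (ann f \<Phi>))"
    using f \<Phi> by (auto intro: lv_creator lv_ann)
  have ac: "lv (ann f (creator f \<Phi>))" using f c by (rule lv_ann)
  have "complex_of_real (lsq (Suc n) (creator f \<Phi>)) + lip n \<Phi> (creator f (ann f \<Phi>)) =
      complex_of_real ((norm f)\<^sup>2 * lsq n \<Phi>)" for n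
  proof -
    have "complex_of_real (lsq (Suc n) (creator f \<Phi>)) = lip n \<Phi> (ann f (creator f \<Phi>))"
      using lip_creator[OF f \<Phi> c] lip_self[OF c] by simp
    moreover have "lip n \<Phi> (ann f (creator f \<Phi>)) + lip n \<Phi> (creator f (ann f \<Phi>)) =
        (\<Sum>\<^sub>\<infinity>xs\<in>tuples E n. cnj (\<Phi> xs) * ann f (creator f \<Phi>) xs + cnj (\<Phi> xs) * creator f (ann f \<Phi>) xs)"
      unfolding lip_def by (rule infsum_add[symmetric]) (intro lv_summable \<Phi> ac ca)+
    moreover have "\<dots> = (\<Sum>\<^sub>\<infinity>xs\<in>tuples E n. cinner f f * (cnj (\<Phi> xs) * \<Phi> xs))"
    proof (rule infsum_cong)
      fix xs assume "xs \<in> tuples E n"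
      then have "xs \<in> lists S" using tuples_E_sub by (auto simp: tuples_def)
      from creator_ann_anticommute[OF f f this, of \<Phi>]
      show "cnj (\<Phi> xs) * ann f (creator f \<Phi>) xs + cnj (\<Phi> xs) * creator f (ann f \<Phi>) xs =
          cinner f f * (cnj (\<Phi> xs) * \<Phi> xs)"
        by (simp flip: distrib_left)
    qed
    moreover have "\<dots> = cinner f f * lip n \<Phi> \<Phi>" unfolding lip_def by (rule infsum_cmult_right')
    ultimately show ?thesis using lip_self[OF \<Phi>] by (simp add: cinner_self)
  qed
  note * = this
  have "lip (Suc n) \<Phi> (creator f (ann f \<Phi>)) = complex_of_real (lsq n (ann f \<Phi>))"
    using lip_creator[OF f a \<Phi>, of n] lip_self[OF a, of n] lip_commute[of "Suc n" \<Phi> "creator f (ann f \<Phi>)"] by simp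
  with *[of "Suc n"] show "lsq (Suc (Suc n)) (creator f \<Phi>) + lsq n (ann f \<Phi>) = (norm f)\<^sup>2 * lsq (Suc n) \<Phi>"
    by (metis of_real_add of_real_eq_iff)
  have "lip 0 \<Phi> (creator f (ann f \<Phi>)) = 0" by (simp add: lip_def creator_def)
  with *[of 0] show "lsq (Suc 0) (creator f \<Phi>) = (norm f)\<^sup>2 * lsq 0 \<Phi>"
    by (metis add.right_neutral of_real_eq_iff)
qed

lemma fock_lv: "\<Phi> \<in> F \<Longrightarrow> lv \<Phi>"
  unfolding lv_def sqsum_def using summable_on_tuples[OF fock_summable] fock_mform fock_alternating by blast

lemma fock_lsq_has_sum: "\<Phi> \<in> F \<Longrightarrow> ((\<lambda>n. lsq n \<Phi>) has_sum fnsq \<Phi>) UNIV"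
  by (rule has_sum_SigmaD[OF fnsq_has_sum[unfolded has_sum_lists]]) (simp_all add: lsq_has_sum[OF fock_lv])

lemma fock_lip_sums: "\<Phi> \<in> F \<Longrightarrow> \<Psi> \<in> F \<Longrightarrow> (\<lambda>n. lip n \<Phi> \<Psi>) sums fip S \<Phi> \<Psi>"
proof (rule has_sum_imp_sums)
  assume \<Phi>: "\<Phi> \<in> F" and \<Psi>: "\<Psi> \<in> F"
  have "((\<lambda>xs. cnj (\<Phi> xs) * \<Psi> xs) has_sum fip S \<Phi> \<Psi>) (lists E)"
    unfolding fip_def by (rule has_sum_infsum[OF fock_ip_summable[OF \<Phi> \<Psi>]])
  then show "((\<lambda>n. lip n \<Phi> \<Psi>) has_sum fip S \<Phi> \<Psi>) UNIV"
    unfolding has_sum_lists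
    by (rule has_sum_SigmaD)
       (simp add: lip_def lv_summable[OF fock_lv[OF \<Phi>] fock_lv[OF \<Psi>]])
qed

lemma fock_memI:
  assumes "\<And>xs. \<not> set xs \<subseteq> S \<Longrightarrow> \<Phi> xs = 0" "lv \<Phi>" "summable (\<lambda>n. lsq n \<Phi>)"
  shows "\<Phi> \<in> F"
proof -
  have "(\<lambda>n. lsq n \<Phi>) summable_on UNIV"
    using assms(3) lsq_nonneg by (intro summable_nonneg_imp_summable_on)
  then have "(\<lambda>(n, es). (cmod (\<Phi> es))\<^sup>2) summable_on Sigma UNIV (tuples E)"
    by (rule summable_on_SigmaI[rotated]) (simp_all add: lsq_has_sum[OF assms(2)])
  then have "(\<lambda>xs. (cmod (\<Phi> xs))\<^sup>2) summable_on lists E"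
    unfolding summable_on_def has_sum_lists .
  then show ?thesis using assms unfolding fock_vectors_iff lv_def by simp
qed

lemma fock_summable_lsq: "\<Phi> \<in> F \<Longrightarrow> summable (\<lambda>n. lsq n \<Phi>)"
  using has_sum_imp_sums[OF fock_lsq_has_sum] sums_summable by blast

text \<open>Both operators are bounded by \<open>norm f\<close> at every particle number, which the antisymmetry of the
  vectors makes possible.\<close>

lemma creator_mem: assumes f: "f \<in> S" and \<Phi>: "\<Phi> \<in> F" shows "creator f \<Phi> \<in> F"
proof (rule fock_memI[OF _ lv_creator[OF f fock_lv[OF \<Phi>]]])
  have "norm (lsq (Suc n) (creator f \<Phi>)) \<le> (norm f)\<^sup>2 * lsq n \<Phi>" for n
    using lsq_creator_ann(1)[OF f fock_lv[OF \<Phi>], of "n - 1"] lsq_creator_ann(2)[OF f fock_lv[OF \<Phi>]] lsq_nonneg[of "n - 1" "ann f \<Phi>"]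
      lsq_nonneg[of "Suc n" "creator f \<Phi>"] by (cases n) simp_all
  then have "summable (\<lambda>n. lsq (Suc n) (creator f \<Phi>))"
    by (intro summable_comparison_test'[OF summable_mult[OF fock_summable_lsq[OF \<Phi>], of "(norm f)\<^sup>2"]])
  then show "summable (\<lambda>n. lsq n (creator f \<Phi>))" using summable_Suc_iff[of "\<lambda>n. lsq n (creator f \<Phi>)"] by blast
qed (simp add: creator_def)

lemma ann_mem: assumes f: "f \<in> S" and \<Phi>: "\<Phi> \<in> F" shows "ann f \<Phi> \<in> F"
proof (rule fock_memI[OF _ lv_ann[OF f fock_lv[OF \<Phi>]]])
  have le: "norm (lsq n (ann f \<Phi>)) \<le> (norm f)\<^sup>2 * lsq (Suc n) \<Phi>" for n
    using lsq_creator_ann(1)[OF f fock_lv[OF \<Phi>], of n] lsq_nonneg[of n "ann f \<Phi>"]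
      lsq_nonneg[of "Suc (Suc n)" "creator f \<Phi>"] by simp
  have S: "summable (\<lambda>n. lsq (Suc n) \<Phi>)" using fock_summable_lsq[OF \<Phi>] summable_Suc_iff[of "\<lambda>n. lsq n \<Phi>"] by blast
  show "summable (\<lambda>n. lsq n (ann f \<Phi>))"
    by (rule summable_comparison_test'[OF summable_mult[OF S]], rule le)
  show "ann f \<Phi> xs = 0" if "\<not> set xs \<subseteq> S" for xs
    using that fock_outside[OF \<Phi>, of "f # xs"] by (simp add: ann_def)
qed

lemma fip_creator:
  assumes f: "f \<in> S" and \<Phi>: "\<Phi> \<in> F" and \<Psi>: "\<Psi> \<in> F"
  shows "fip S (creator f \<Phi>) \<Psi> = fip S \<Phi> (ann f \<Psi>)"
proof -
  have "(\<lambda>n. lip (Suc n) (creator f \<Phi>) \<Psi>) sums fip S \<Phi> (ann f \<Psi>)"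
    unfolding lip_creator[OF f fock_lv[OF \<Phi>] fock_lv[OF \<Psi>]]
    by (rule fock_lip_sums[OF \<Phi> ann_mem[OF f \<Psi>]])
  then have "(\<lambda>n. lip n (creator f \<Phi>) \<Psi>) sums (fip S \<Phi> (ann f \<Psi>) + lip 0 (creator f \<Phi>) \<Psi>)"
    using sums_Suc_iff[of "\<lambda>n. lip n (creator f \<Phi>) \<Psi>"] by blast
  moreover have "lip 0 (creator f \<Phi>) \<Psi> = 0" by (simp add: lip_def creator_def)
  ultimately show ?thesis
    using fock_lip_sums[OF creator_mem[OF f \<Phi>] \<Psi>] by (simp add: sums_unique2)
qed

subsection \<open>Bounded operators on Fock space\<close>

lemma hnorm_fock: "hnorm (fock_space S) \<Phi> = fock.nrm \<Phi>"
  by (simp add: hnorm_def fock.nrm_def)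

lemma fock_hadj_eqI:
  assumes "X \<in> F" "Y \<in> F" "\<And>Z. Z \<in> F \<Longrightarrow> fip S X Z = fip S Y (A Z)"
  shows "hadj (fock_space S) A Y = X"
proof -
  have "the_or (fsc 0 Y) (\<lambda>x. x \<in> F \<and> (\<forall>z\<in>F. fip S x z = fip S Y (A z))) = X"
    by (rule the_or_eqI) (use assms in \<open>auto intro: fock.ip_eqI\<close>)
  then show ?thesis using assms(2) by (simp add: hadj_def)
qed

lemma annihilator_apply: "\<Phi> \<in> F \<Longrightarrow> annihilator S f \<Phi> = ann f \<Phi>"
  by (simp add: annihilator_def ann_def)

lemma hadj_annihilator: "f \<in> S \<Longrightarrow> \<Phi> \<in> F \<Longrightarrow> hadj (fock_space S) (annihilator S f) \<Phi> = creator f \<Phi>"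
  by (rule fock_hadj_eqI) (simp_all add: creator_mem annihilator_apply fip_creator)

context
  fixes A assumes A: "A \<in> hbop (fock_space S)"
begin

lemma hbop_mem: "x \<in> F \<Longrightarrow> A x \<in> F" using A by (auto simp: hbop_def)
lemma hbop_add: "x \<in> F \<Longrightarrow> y \<in> F \<Longrightarrow> A (x + y) = A x + A y" using A by (auto simp: hbop_def)
lemma hbop_fsc: "x \<in> F \<Longrightarrow> A (fsc c x) = fsc c (A x)" using A by (auto simp: hbop_def)
lemma hbop_ext: "A \<in> extensional F" using A by (auto simp: hbop_def PiE_def)

lemma hbop_bound: "\<exists>M\<ge>0. \<forall>x\<in>F. fock.nrm (A x) \<le> M * fock.nrm x"
proof -
  obtain M where M: "\<forall>x\<in>F. fock.nrm (A x) \<le> M * fock.nrm x" using A by (auto simp: hbop_def hnorm_fock)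
  have "fock.nrm (A x) \<le> \<bar>M\<bar> * fock.nrm x" if "x \<in> F" for x
    using M that mult_right_mono[OF abs_ge_self[of M] fock.nrm_nonneg[OF that]] by fastforce
  then show ?thesis by (intro exI[of _ "\<bar>M\<bar>"]) auto
qed

lemma hadj_ex: assumes y: "y \<in> F" shows "\<exists>!x. x \<in> F \<and> (\<forall>z\<in>F. fip S x z = fip S y (A z))"
proof -
  obtain M where M: "M \<ge> 0" "\<And>x. x \<in> F \<Longrightarrow> fock.nrm (A x) \<le> M * fock.nrm x" using hbop_bound by blast
  show ?thesis
  proof (rule fock.riesz_representation[of _ "fock.nrm y * M"])
    fix x assume x: "x \<in> F"
    have "cmod (fip S y (A x)) \<le> fock.nrm y * fock.nrm (A x)" by (rule fock.cauchy_schwarz[OF y hbop_mem[OF x]])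
    also have "\<dots> \<le> fock.nrm y * (M * fock.nrm x)" by (rule mult_left_mono[OF M(2)[OF x] fock.nrm_nonneg[OF y]])
    finally show "cmod (fip S y (A x)) \<le> fock.nrm y * M * fock.nrm x" by (simp add: mult.assoc)
  qed (use y hbop_mem in \<open>auto simp: hbop_add hbop_fsc fock.ip_add_right fock.ip_sc_right\<close>)
qed

lemma hadj_mem: "y \<in> F \<Longrightarrow> hadj (fock_space S) A y \<in> F"
  using hadj_ex[of y] fock_hadj_eqI[of _ y A] by metis

lemma fip_hadj: "y \<in> F \<Longrightarrow> z \<in> F \<Longrightarrow> fip S (hadj (fock_space S) A y) z = fip S y (A z)"
  using hadj_ex[of y] fock_hadj_eqI[of _ y A] by metis

end

lemma hbopI:
  assumes "A \<in> extensional F" "\<And>x. x \<in> F \<Longrightarrow> A x \<in> F" "\<And>x y. x \<in> F \<Longrightarrow> y \<in> F \<Longrightarrow> A (x + y) = A x + A y"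
    "\<And>c x. x \<in> F \<Longrightarrow> A (fsc c x) = fsc c (A x)" "\<And>x. x \<in> F \<Longrightarrow> fock.nrm (A x) \<le> M * fock.nrm x"
  shows "A \<in> hbop (fock_space S)"
proof -
  have "\<exists>M. \<forall>x\<in>F. fock.nrm (A x) \<le> M * fock.nrm x" using assms(5) by blast
  then show ?thesis using assms(1-4) by (simp add: hbop_def hnorm_fock PiE_def)
qed

subsection \<open>Second quantization of unitary and antiunitary maps\<close>

text \<open>With \<open>\<sigma>\<close> the identity or the complex conjugation, linear and antilinear isometries are
  treated at once.\<close>

definition pull :: "('k \<Rightarrow> 'k) \<Rightarrow> (complex \<Rightarrow> complex) \<Rightarrow> 'k fock \<Rightarrow> 'k fock"
  where "pull A \<sigma> \<Phi> = (\<lambda>xs. if set xs \<subseteq> S then \<sigma> (\<Phi> (map A xs)) else 0)"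

context
  fixes A :: "'k \<Rightarrow> 'k" and \<sigma> :: "complex \<Rightarrow> complex"
  assumes A_mem: "\<And>x. x \<in> S \<Longrightarrow> A x \<in> S" and A_add: "\<And>x y. A (x + y) = A x + A y"
    and A_sc: "\<And>c x. A (c *\<^sub>C x) = \<sigma> c *\<^sub>C A x" and A_norm: "\<And>x. norm (A x) = norm x"
    and A_onb: "is_onb S (A ` E)" and A_inj: "inj A"
    and \<sigma>: "\<sigma> = id \<or> \<sigma> = cnj"
begin

lemma sigma_simps: "\<sigma> (a + b) = \<sigma> a + \<sigma> b" "\<sigma> (a * b) = \<sigma> a * \<sigma> b" "\<sigma> (cnj (\<sigma> a)) = cnj a"
  "cmod (\<sigma> a) = cmod a" "\<sigma> (- a) = - \<sigma> a"
  using \<sigma> by auto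

lemma bij_betw_map_tuples: "bij_betw (map A) (tuples E n) (tuples (A ` E) n)"
proof -
  have "inj_on (map A) (tuples E n)"
    using inj_on_map_lists[of A E] A_inj by (auto simp: tuples_def inj_on_def)
  moreover have "map A ` tuples E n = tuples (A ` E) n"
    unfolding tuples_def lists_image by auto
  ultimately show ?thesis by (simp add: bij_betw_def)
qed

lemma pull_level:
  assumes "lv \<Phi>" shows "((\<lambda>es. (cmod (pull A \<sigma> \<Phi> es))\<^sup>2) has_sum lsq n \<Phi>) (tuples E n)"
proof -
  have "mform S n \<Phi>" using assms by (simp add: lv_def)
  from mform_basis_change[OF this onb A_onb lsq_has_sum[OF assms]]
  have "((\<lambda>es. (cmod (\<Phi> (map A es)))\<^sup>2) has_sum lsq n \<Phi>) (tuples E n)"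
    using has_sum_reindex_bij_betw[OF bij_betw_map_tuples, of "\<lambda>es. (cmod (\<Phi> es))\<^sup>2" n "lsq n \<Phi>"] by simp
  moreover have "((\<lambda>es. (cmod (pull A \<sigma> \<Phi> es))\<^sup>2) has_sum lsq n \<Phi>) (tuples E n) \<longleftrightarrow>
      ((\<lambda>es. (cmod (\<Phi> (map A es)))\<^sup>2) has_sum lsq n \<Phi>) (tuples E n)"
    by (rule has_sum_cong) (use tuples_E_sub in \<open>auto simp: pull_def tuples_def sigma_simps\<close>)
  ultimately show ?thesis by blast
qed

lemma pull_lsq: "lv \<Phi> \<Longrightarrow> lsq n (pull A \<sigma> \<Phi>) = lsq n \<Phi>"
  unfolding lsq_def[of n "pull A \<sigma> \<Phi>"] by (rule infsumI[OF pull_level])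

lemma pull_mem: assumes \<Phi>: "\<Phi> \<in> F" shows "pull A \<sigma> \<Phi> \<in> F"
proof (rule fock_memI)
  have lv: "lv \<Phi>" by (rule fock_lv[OF \<Phi>])
  have lists: "map A xs \<in> lists S" if "xs \<in> lists S" for xs
    using that A_mem by auto
  show "pull A \<sigma> \<Phi> xs = 0" if "\<not> set xs \<subseteq> S" for xs
    using that by (simp add: pull_def)
  show "summable (\<lambda>n. lsq n (pull A \<sigma> \<Phi>))" unfolding pull_lsq[OF lv] by (rule fock_summable_lsq[OF \<Phi>])
  have pull: "pull A \<sigma> \<Phi> xs = \<sigma> (\<Phi> (map A xs))" if "xs \<in> lists S" for xs
    using that by (auto simp: pull_def)
  show "lv (pull A \<sigma> \<Phi>)"
    unfolding lv_def
  proof (intro conjI allI)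
    fix n
    show "sqsum n (pull A \<sigma> \<Phi>)" unfolding sqsum_def by (rule has_sum_imp_summable[OF pull_level[OF lv]])
    have form: "mform S n \<Phi>" by (rule fock_mform[OF \<Phi>])
    obtain M where M: "\<And>xs. xs\<in>tuples S n \<Longrightarrow> cmod (\<Phi> xs) \<le> M * prod_list (map norm xs)"
      using mform_bound[OF form] by blast
    show "mform S n (pull A \<sigma> \<Phi>)"
    proof (rule mformI[where M = M])
      fix xs ys x y c assume *: "xs \<in> lists S" "ys \<in> lists S" "length xs + length ys + 1 = n" "x \<in> S"
      have **: "map A xs \<in> lists S" "map A ys \<in> lists S" "length (map A xs) + length (map A ys) + 1 = n" "A x \<in> S"
        using * lists A_mem by auto
      show "pull A \<sigma> \<Phi> (xs @ (x + y) # ys) = pull A \<sigma> \<Phi> (xs @ x # ys) + pull A \<sigma> \<Phi> (xs @ y # ys)" if "y \<in> S"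
        using mform_add_arg[OF form **, of "A y"] that * S.add_mem[of x y]
        by (simp add: pull A_add A_mem sigma_simps)
      show "pull A \<sigma> \<Phi> (xs @ (c *\<^sub>C x) # ys) = cnj c * pull A \<sigma> \<Phi> (xs @ x # ys)"
        using mform_scale_arg[OF form **, of "\<sigma> c"] * S.sc_mem[of x c]
        by (simp add: pull A_sc sigma_simps)
    next
      fix xs assume xs: "xs \<in> tuples S n"
      then have "map A xs \<in> tuples S n" using lists by (auto simp: tuples_def)
      from M[OF this] show "cmod (pull A \<sigma> \<Phi> xs) \<le> M * prod_list (map norm xs)"
        using xs by (simp add: pull tuples_def o_def A_norm sigma_simps)
    qed
  next
    show "alternating S (pull A \<sigma> \<Phi>)"
    proof (rule alternatingI)
      fix xs ys x y assume *: "xs \<in> lists S" "ys \<in> lists S" "x \<in> S" "y \<in> S"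
      show "pull A \<sigma> \<Phi> (xs @ x # y # ys) = - pull A \<sigma> \<Phi> (xs @ y # x # ys)"
        using alternatingD[OF fock_alternating[OF \<Phi>] lists[OF *(1)] lists[OF *(2)], of "A x" "A y"] *
        by (simp add: pull A_mem sigma_simps)
    qed
  qed
qed

lemma pull_nrm: assumes \<Phi>: "\<Phi> \<in> F" shows "fock.nrm (pull A \<sigma> \<Phi>) = fock.nrm \<Phi>"
proof -
  have "fnsq (pull A \<sigma> \<Phi>) = fnsq \<Phi>"
    using fock_lsq_has_sum[OF \<Phi>] fock_lsq_has_sum[OF pull_mem[OF \<Phi>]]
    by (simp add: pull_lsq[OF fock_lv[OF \<Phi>]] has_sum_unique)
  then show ?thesis unfolding fock.nrm_def by (simp add: fip_self \<Phi> pull_mem)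
qed

end

text \<open>The antiunitary second quantization of a conjugation of the one-particle space.\<close>

context
  fixes K :: "'k \<Rightarrow> 'k"
  assumes K: "complex_conjugation K" and KS: "K ` S = S"
begin

definition theta :: "'k fock \<Rightarrow> 'k fock"
  where "theta \<Phi> = (\<lambda>xs. cnj (\<Phi> (map K xs)))"

lemma conj_mem: "K x \<in> S \<longleftrightarrow> x \<in> S"
  using KS mem_conj_image[OF K] by metis

lemma theta_theta: "theta (theta \<Phi>) = \<Phi>"
  by (rule ext) (simp add: theta_def o_def conj_conj[OF K])

lemma theta_add: "theta (\<Phi> + \<Psi>) = theta \<Phi> + theta \<Psi>"
  by (rule ext) (simp add: theta_def)

lemma theta_fsc: "theta (fsc c \<Phi>) = fsc (cnj c) (theta \<Phi>)"
  by (rule ext) (simp add: theta_def)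

lemma theta_eq_pull: assumes "\<Phi> \<in> F" shows "theta \<Phi> = pull K cnj \<Phi>"
proof (rule ext)
  fix xs
  have "set (map K xs) \<subseteq> S \<longleftrightarrow> set xs \<subseteq> S" using conj_mem by auto
  then show "theta \<Phi> xs = pull K cnj \<Phi> xs"
    using fock_outside[OF assms, of "map K xs"] by (simp add: theta_def pull_def)
qed

lemma theta_isometry:
  assumes "\<Phi> \<in> F" shows "theta \<Phi> \<in> F" "fock.nrm (theta \<Phi>) = fock.nrm \<Phi>"
proof -
  have "is_onb S (K ` E)" using is_onb_conj[OF K onb] KS by simp
  moreover have "inj K" using conj_conj[OF K] by (metis injI)
  ultimately show "theta \<Phi> \<in> F" "fock.nrm (theta \<Phi>) = fock.nrm \<Phi>"
    unfolding theta_eq_pull[OF assms]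
    by (intro pull_mem pull_nrm assms; simp add: conj_mem conj_add[OF K] conj_scaleC[OF K] norm_conj[OF K])+
qed

lemmas theta_mem = theta_isometry(1)
lemmas theta_nrm = theta_isometry(2)

lemma fip_theta: "\<Phi> \<in> F \<Longrightarrow> \<Psi> \<in> F \<Longrightarrow> fip S (theta \<Phi>) (theta \<Psi>) = cnj (fip S \<Phi> \<Psi>)"
  by (rule fock.antilinear_isometry_ip[OF theta_mem theta_add theta_fsc theta_nrm])

lemma theta_ann: "theta (ann f \<Phi>) = ann (K f) (theta \<Phi>)"
  by (rule ext) (simp add: theta_def ann_def conj_conj[OF K])

lemma theta_creator: "theta (creator f \<Phi>) = creator (K f) (theta \<Phi>)"
proof (rule ext)
  fix xs
  have "cnj (cr f (map K xs) \<Phi>) = cr (K f) xs (\<lambda>ys. cnj (\<Phi> (map K ys)))" for xs \<Phi>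
  proof (induction xs arbitrary: \<Phi>)
    case (Cons a xs)
    have "cnj (cinner (K a) f) = cinner a (K f)" by (metis cinner_conj_left[OF K] cinner_commute)
    then show ?case using Cons.IH by simp
  qed simp
  moreover have "set (map K xs) \<subseteq> S \<longleftrightarrow> set xs \<subseteq> S" using conj_mem by auto
  ultimately show "theta (creator f \<Phi>) xs = creator (K f) (theta \<Phi>) xs"
    by (simp add: theta_def creator_def)
qed

end

end

section \<open>Clifford families\<close>

text \<open>Orthogonal families of \<open>J\<close>-invariant vectors.  With squared norm \<open>2\<close> the corresponding elements
  of the CAR algebra are selfadjoint unitaries which anticommute pairwise.\<close>

primrec cliff :: "('k::chilbert_space \<Rightarrow> 'k) \<Rightarrow> 'k list \<Rightarrow> bool" where
  "cliff J [] \<longleftrightarrow> True"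
| "cliff J (e # es) \<longleftrightarrow> J e = e \<and> cinner e e = 2 \<and> (\<forall>e'\<in>set es. cinner e e' = 0) \<and> cliff J es"

lemma cliff_real: "cliff J es \<Longrightarrow> e \<in> set es \<Longrightarrow> J e = e \<and> cinner e e = 2"
  by (induction es) auto

context
  fixes J :: "'k::chilbert_space \<Rightarrow> 'k"
  assumes J: "complex_conjugation J"
begin

text \<open>The inner product of invariant vectors is real, so Gram--Schmidt orthogonalization stays among
  invariant vectors.\<close>

lemma cliff_projection:
  assumes "cliff J es" "J g = g"
  shows "\<exists>p\<in>cspan (set es). J p = p \<and> (\<forall>e\<in>set es. cinner e (g - p) = 0)"
  using assms(1)
proof (induction es)
  case Nil
  then show ?case by (intro bexI[of _ 0]) (auto simp: conj_zero[OF J] cvec.span_zero)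
next
  case (Cons e es)
  then obtain p where p: "p \<in> cspan (set es)" "J p = p" "\<forall>e\<in>set es. cinner e (g - p) = 0" by auto
  define c where "c = cinner e (g - p) / 2"
  have "cinner e (g - p) = cinner (g - p) e"
    using cinner_conj[OF J, of e "g - p"] Cons.prems assms(2) p(2) by (simp add: conj_diff[OF J])
  then have c: "cnj c = c" unfolding c_def by (metis cinner_commute complex_cnj_divide complex_cnj_numeral)
  show ?case
  proof (intro bexI[of _ "p + c *\<^sub>C e"] conjI ballI)
    show "p + c *\<^sub>C e \<in> cspan (set (e # es))"
      using p(1) cvec.span_mono[of "set es" "set (e # es)"]
      by (intro cvec.span_add cvec.span_scale) (auto intro: cvec.span_base)
    show "J (p + c *\<^sub>C e) = p + c *\<^sub>C e" using Cons.prems p(2) c by (simp add: conj_add[OF J] conj_scaleC[OF J])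
    fix e' assume "e' \<in> set (e # es)"
    moreover have "cinner e (g - (p + c *\<^sub>C e)) = 0"
    proof -
      have "cinner e e = 2" using Cons.prems by simp
      then have "cinner e (g - (p + c *\<^sub>C e)) = cinner e (g - p) - c * 2" by (simp add: cinner_simps)
      then show ?thesis by (simp add: c_def)
    qed
    moreover have "cinner e' (g - (p + c *\<^sub>C e)) = 0" if "e' \<in> set es"
    proof -
      have "cinner e' e = 0" using Cons.prems that by (metis cinner_commute cliff.simps(2) complex_cnj_zero)
      then show ?thesis using p(3) that by (simp add: cinner_simps)
    qed
    ultimately show "cinner e' (g - (p + c *\<^sub>C e)) = 0" by auto
  qed
qed

lemma cliff_extend_real:
  assumes es: "cliff J es" and g: "J g = g" "g \<notin> cspan (set es)"
  shows "\<exists>f. cliff J (f # es) \<and> g \<in> cspan (set (f # es))"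
proof -
  obtain p where p: "p \<in> cspan (set es)" "J p = p" "\<forall>e\<in>set es. cinner e (g - p) = 0"
    using cliff_projection[OF es g(1)] by blast
  have nz: "norm (g - p) \<noteq> 0" using p(1) g(2) by auto
  define r where "r = complex_of_real (sqrt 2 / norm (g - p))"
  have r: "r \<noteq> 0" "cnj r = r" "r * r * complex_of_real ((norm (g - p))\<^sup>2) = 2"
    using nz by (auto simp: r_def power2_eq_square simp flip: of_real_mult)
  show ?thesis
  proof (intro exI[of _ "r *\<^sub>C (g - p)"] conjI)
    have "cinner (r *\<^sub>C (g - p)) (r *\<^sub>C (g - p)) = r * r * complex_of_real ((norm (g - p))\<^sup>2)"
      unfolding cinner_scaleC_left cinner_scaleC_right cinner_self[of "g - p"] r(2) by (simp only: mult.assoc)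
    moreover have "cinner (r *\<^sub>C (g - p)) e = 0" if "e \<in> set es" for e
      using p(3) that unfolding cinner_scaleC_left by (metis cinner_commute complex_cnj_zero mult_zero_right)
    ultimately show "cliff J (r *\<^sub>C (g - p) # es)"
      using es p(2) g(1) r(2,3) by (simp add: conj_scaleC[OF J] conj_diff[OF J])
    have "p \<in> cspan (set (r *\<^sub>C (g - p) # es))"
      using p(1) cvec.span_mono[of "set es" "set (r *\<^sub>C (g - p) # es)"] by auto
    moreover have "r *\<^sub>C (g - p) \<in> cspan (set (r *\<^sub>C (g - p) # es))" by (rule cvec.span_base) simp
    ultimately have "p + (1 / r) *\<^sub>C (r *\<^sub>C (g - p)) \<in> cspan (set (r *\<^sub>C (g - p) # es))"
      by (intro cvec.span_add cvec.span_scale[of "r *\<^sub>C (g - p)"])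
    then show "g \<in> cspan (set (r *\<^sub>C (g - p) # es))" using r(1) by simp
  qed
qed

lemma real_imaginary_parts:
  obtains g k where "J g = g" "J k = k" "v = g + \<i> *\<^sub>C k"
proof
  let ?g = "(1/2) *\<^sub>C (v + J v)" and ?k = "(- \<i> / 2) *\<^sub>C (v - J v)"
  show "J ?g = ?g" by (simp add: conj_scaleC[OF J] conj_add[OF J] conj_conj[OF J] add.commute)
  show "J ?k = ?k" by (simp add: conj_minus[OF J] conj_scaleC[OF J] conj_diff[OF J] conj_conj[OF J] cvec.scale_right_diff_distrib)
  show "v = ?g + \<i> *\<^sub>C ?k"
    by (simp add: cvec.scale_right_diff_distrib cvec.scale_right_distrib cvec.scale_left_distrib[symmetric])
qed

lemma cliff_extend:
  assumes es: "cliff J es" shows "\<exists>es'. cliff J es' \<and> set es \<subseteq> set es' \<and> v \<in> cspan (set es')"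
proof -
  have real: "\<exists>es'. cliff J es' \<and> set es \<subseteq> set es' \<and> g \<in> cspan (set es')" if "cliff J es" "J g = g" for es g
  proof (cases "g \<in> cspan (set es)")
    case False
    obtain f where "cliff J (f # es)" "g \<in> cspan (set (f # es))"
      using cliff_extend_real[OF \<open>cliff J es\<close> \<open>J g = g\<close> False] by blast
    then show ?thesis by (intro exI[of _ "f # es"]) auto
  qed (use that in blast)
  obtain g k where v: "J g = g" "J k = k" "v = g + \<i> *\<^sub>C k" by (rule real_imaginary_parts)
  obtain es1 where 1: "cliff J es1" "set es \<subseteq> set es1" "g \<in> cspan (set es1)" using real[OF es v(1)] by blast
  obtain es2 where 2: "cliff J es2" "set es1 \<subseteq> set es2" "k \<in> cspan (set es2)" using real[OF 1(1) v(2)] by blast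
  have "g \<in> cspan (set es2)" using 1(3) cvec.span_mono[OF 2(2)] by blast
  then have "v \<in> cspan (set es2)" unfolding v(3) by (intro cvec.span_add cvec.span_scale 2(3))
  then show ?thesis using 1 2 by blast
qed

lemma cliff_cover: "finite X \<Longrightarrow> \<exists>es. cliff J es \<and> X \<subseteq> cspan (set es)"
proof (induction X rule: finite_induct)
  case empty
  then show ?case by (intro exI[of _ "[]"]) simp
next
  case (insert x X)
  then obtain es where es: "cliff J es" "X \<subseteq> cspan (set es)" by blast
  obtain es' where es': "cliff J es'" "set es \<subseteq> set es'" "x \<in> cspan (set es')" using cliff_extend[OF es(1)] by blast
  then show ?case using es(2) cvec.span_mono[OF es'(2)] by (intro exI[of _ es']) auto
qed

text \<open>Infinite dimension enters here: a finite family always leaves room for one more generator.\<close>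

lemma cliff_fresh:
  assumes "\<nexists>B :: 'k set. finite B \<and> cspan B = UNIV" and es: "cliff J es"
  shows "\<exists>f. cliff J (f # es)"
proof -
  obtain v where v: "v \<notin> cspan (set es)" using assms(1) by (metis List.finite_set UNIV_eq_I)
  obtain g k where gk: "J g = g" "J k = k" "v = g + \<i> *\<^sub>C k" by (rule real_imaginary_parts)
  then have "g \<notin> cspan (set es) \<or> k \<notin> cspan (set es)" using v cvec.span_add cvec.span_scale by metis
  then show ?thesis using cliff_extend_real[OF es] gk by blast
qed

end

section \<open>Universal property of the CAR algebra\<close>

lemma star_one: "star (1::'a::cstar_algebra) = 1"
  by (metis mult.left_neutral mult.right_neutral star_mult star_star)

lemma norm_star: "norm (star (x::'a::cstar_algebra)) = norm x"
proof -
  have le: "norm x \<le> norm (star x)" for x :: 'a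
  proof (cases "norm x = 0")
    case False
    have "norm x * norm x \<le> norm (star x) * norm x"
      using norm_mult_ineq[of "star x" x] by (simp add: cstar_identity power2_eq_square)
    then show ?thesis using False by simp
  qed simp
  show ?thesis using le[of x] le[of "star x"] by (simp add: star_star)
qed

lemma star_diff: "star (x - y) = star x - star (y::'a::cstar_algebra)"
  using star_add[of "x - y" y] by simp

lemma star_tendsto: "(X \<longlongrightarrow> x) A \<Longrightarrow> ((\<lambda>k. star (X k)) \<longlongrightarrow> star (x::'a::cstar_algebra)) A"
  unfolding tendsto_iff dist_norm star_diff[symmetric] norm_star .

lemma scaleC_tendsto: "(X \<longlongrightarrow> x) A \<Longrightarrow> ((\<lambda>k. c *\<^sub>C X k) \<longlongrightarrow> c *\<^sub>C (x::'a::cstar_algebra)) A"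
proof -
  assume "(X \<longlongrightarrow> x) A"
  then have "((\<lambda>k. (c *\<^sub>C 1) * X k) \<longlongrightarrow> (c *\<^sub>C 1) * x) A" by (rule tendsto_mult_left)
  then show ?thesis by (simp add: scaleC_mult_left)
qed

locale car_algebra =
  fixes J :: "'k::chilbert_space \<Rightarrow> 'k" and car :: "'k \<Rightarrow> 'a::cstar_algebra"
  assumes infinite_dim: "\<nexists>B :: 'k set. finite B \<and> cspan B = UNIV"
    and J: "complex_conjugation J" and CAR: "CAR_algebra J car"
begin

lemma car_add: "car (f + g) = car f + car g"
  using CAR by (simp add: CAR_algebra_def Vector_Spaces.linear_iff)

lemma car_scaleC: "car (c *\<^sub>C f) = c *\<^sub>C car f"
  using CAR by (simp add: CAR_algebra_def Vector_Spaces.linear_iff)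

lemma car_zero: "car 0 = 0"
  using car_scaleC[of 0 0] by simp

lemma star_car: "star (car f) = car (J f)"
  using CAR by (simp add: CAR_algebra_def)

lemma car_anticommute: "car f * car g + car g * car f = cinner (J f) g *\<^sub>C 1"
proof -
  have "star (car (J f)) * car g + car g * star (car (J f)) = cinner (J f) g *\<^sub>C 1"
    using CAR unfolding CAR_algebra_def by blast
  then show ?thesis unfolding star_car conj_conj[OF J] .
qed

lemma car_generates:
  assumes "1 \<in> S" "range car \<subseteq> S" "\<And>x y. x \<in> S \<Longrightarrow> y \<in> S \<Longrightarrow> x + y \<in> S" "\<And>x c. x \<in> S \<Longrightarrow> c *\<^sub>C x \<in> S"
    "\<And>x y. x \<in> S \<Longrightarrow> y \<in> S \<Longrightarrow> x * y \<in> S" "\<And>x. x \<in> S \<Longrightarrow> star x \<in> S" "closed S"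
  shows "x \<in> S"
proof -
  have "\<forall>S. 1 \<in> S \<and> range car \<subseteq> S \<and> (\<forall>x\<in>S. \<forall>y\<in>S. x + y \<in> S) \<and> (\<forall>x\<in>S. \<forall>c. c *\<^sub>C x \<in> S) \<and>
      (\<forall>x\<in>S. \<forall>y\<in>S. x * y \<in> S) \<and> (\<forall>x\<in>S. star x \<in> S) \<and> closed S \<longrightarrow> S = UNIV"
    using CAR unfolding CAR_algebra_def by (elim conjE)
  from spec[OF this, of S] have "S = UNIV" by (rule mp) (intro conjI ballI allI assms)
  then show ?thesis by simp
qed

lemma car_square: assumes "J e = e" "cinner e e = 2" shows "car e * car e = 1"
proof -
  have "car e * car e + car e * car e = (2::complex) *\<^sub>C 1"
    using car_anticommute[of e e] unfolding assms .
  moreover have "(2::complex) *\<^sub>C (car e * car e) = car e * car e + car e * car e"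
    unfolding one_add_one[symmetric] scaleC_add_left scaleC_one ..
  ultimately have "(2::complex) *\<^sub>C (car e * car e) = (2::complex) *\<^sub>C 1" by (simp only:)
  then show ?thesis by simp
qed

lemma car_orthogonal: "J e = e \<Longrightarrow> cinner e e' = 0 \<Longrightarrow> car e * car e' = - (car e' * car e)"
  using car_anticommute[of e e'] by (simp add: eq_neg_iff_add_eq_0)

lemma norm_car: assumes "J e = e" "cinner e e = 2" shows "norm (car e) = 1"
proof -
  have "(norm (car e))\<^sup>2 = 1"
    using cstar_identity[of "car e"] by (simp add: star_car assms car_square)
  then show ?thesis using power2_eq_imp_eq[of "norm (car e)" 1] by simp
qed

lemma norm_car_mult: assumes "J e = e" "cinner e e = 2" shows "norm (car e * x) = norm x"
proof (rule antisym)
  show "norm (car e * x) \<le> norm x" using norm_mult_ineq[of "car e" x] by (simp add: norm_car[OF assms])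
  have "norm (car e * (car e * x)) \<le> norm (car e * x)"
    using norm_mult_ineq[of "car e" "car e * x"] by (simp add: norm_car[OF assms])
  then show "norm x \<le> norm (car e * x)" by (simp add: mult.assoc[symmetric] car_square[OF assms])
qed

end

text \<open>A module \<open>W\<close> over the generators and relations of the CAR algebra, with a form \<open>h\<close> for which the
  generators are adjointable.  The form may take values in any normed space: besides the Fock space
  with its inner product, this covers the algebra as a left module over itself with
  \<open>h v w = star v * w\<close>, so that representations and endomorphisms are obtained by the same
  argument.\<close>

locale car_rep = car_algebra J car
  for J :: "'k::chilbert_space \<Rightarrow> 'k" and car :: "'k \<Rightarrow> 'a::cstar_algebra" +
  fixes W :: "'w::ab_group_add set" and sc :: "complex \<Rightarrow> 'w \<Rightarrow> 'w" and n :: "'w \<Rightarrow> real"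
    and h :: "'w \<Rightarrow> 'w \<Rightarrow> 'c::real_normed_vector" and b :: "'k \<Rightarrow> 'w \<Rightarrow> 'w"
  assumes vector_space_sc: "vector_space sc"
    and W_zero: "0 \<in> W" and W_add: "v \<in> W \<Longrightarrow> w \<in> W \<Longrightarrow> v + w \<in> W" and W_sc: "v \<in> W \<Longrightarrow> sc c v \<in> W"
    and n_nonneg: "v \<in> W \<Longrightarrow> 0 \<le> n v" and n_eq_0: "v \<in> W \<Longrightarrow> n v = 0 \<Longrightarrow> v = 0"
    and n_add: "v \<in> W \<Longrightarrow> w \<in> W \<Longrightarrow> n (v + w) \<le> n v + n w"
    and n_sc: "v \<in> W \<Longrightarrow> n (sc c v) = cmod c * n v"
    and h_add_left: "u \<in> W \<Longrightarrow> v \<in> W \<Longrightarrow> w \<in> W \<Longrightarrow> h (u + v) w = h u w + h v w"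
    and h_add_right: "u \<in> W \<Longrightarrow> v \<in> W \<Longrightarrow> w \<in> W \<Longrightarrow> h u (v + w) = h u v + h u w"
    and h_sc: "v \<in> W \<Longrightarrow> w \<in> W \<Longrightarrow> h v (sc c w) = h (sc (cnj c) v) w"
    and h_self: "v \<in> W \<Longrightarrow> norm (h v v) = (n v)\<^sup>2"
    and h_bound: "v \<in> W \<Longrightarrow> w \<in> W \<Longrightarrow> norm (h v w) \<le> n v * n w"
    and b_mem: "v \<in> W \<Longrightarrow> b f v \<in> W"
    and b_add_right: "v \<in> W \<Longrightarrow> w \<in> W \<Longrightarrow> b f (v + w) = b f v + b f w"
    and b_sc_right: "v \<in> W \<Longrightarrow> b f (sc c v) = sc c (b f v)"
    and b_add_left: "v \<in> W \<Longrightarrow> b (f + g) v = b f v + b g v"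
    and b_sc_left: "v \<in> W \<Longrightarrow> b (c *\<^sub>C f) v = sc c (b f v)"
    and b_star: "v \<in> W \<Longrightarrow> w \<in> W \<Longrightarrow> h v (b f w) = h (b (J f) v) w"
    and b_anticommute: "v \<in> W \<Longrightarrow> b f (b g v) + b g (b f v) = sc (cinner (J f) g) v"
    and W_complete: "(\<And>k. X k \<in> W) \<Longrightarrow>
      (\<And>e::real. e > 0 \<Longrightarrow> \<exists>N. \<forall>k\<ge>N. \<forall>l\<ge>N. n (X k - X l) < e) \<Longrightarrow>
      \<exists>w\<in>W. (\<lambda>k. n (X k - w)) \<longlonglongrightarrow> 0"
begin

sublocale vs: vector_space sc by (rule vector_space_sc)

lemma W_minus: "v \<in> W \<Longrightarrow> - v \<in> W" using W_sc[of v "-1"] by simp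
lemma W_diff: "v \<in> W \<Longrightarrow> w \<in> W \<Longrightarrow> v - w \<in> W" using W_add[of v "- w"] W_minus by simp
lemma n_minus: "v \<in> W \<Longrightarrow> n (- v) = n v" using n_sc[of v "-1"] by simp
lemma n_commute: "v \<in> W \<Longrightarrow> w \<in> W \<Longrightarrow> n (v - w) = n (w - v)" using n_minus[of "v - w"] by (simp add: W_diff)

lemma n_triangle: "u \<in> W \<Longrightarrow> v \<in> W \<Longrightarrow> w \<in> W \<Longrightarrow> n (u - w) \<le> n (u - v) + n (v - w)"
  using n_add[of "u - v" "v - w"] by (simp add: W_diff)

lemma b_zero: "b f 0 = 0" using b_sc_right[of 0 f 0] W_zero by simp
lemma b_zero_left: "v \<in> W \<Longrightarrow> b 0 v = 0" using b_sc_left[of v 0 0] by simp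
lemma b_minus: "v \<in> W \<Longrightarrow> b f (- v) = - b f v" using b_sc_right[of v f "-1"] by simp

lemma b_square: assumes "J e = e" "cinner e e = 2" "v \<in> W" shows "b e (b e v) = v"
proof -
  have "sc 2 (b e (b e v)) = sc 2 v"
    using b_anticommute[OF assms(3), of e e] assms vs.scale_left_distrib[of 1 1 "b e (b e v)"] by simp
  then show ?thesis by simp
qed

lemma b_orthogonal: "J e = e \<Longrightarrow> cinner e e' = 0 \<Longrightarrow> v \<in> W \<Longrightarrow> b e (b e' v) = - b e' (b e v)"
  using b_anticommute[of v e e'] by (simp add: eq_neg_iff_add_eq_0)

lemma b_contraction: assumes "J e = e" "cinner e e = 2" "v \<in> W" shows "n (b e v) \<le> n v"
proof -
  have "(n (b e v))\<^sup>2 = norm (h v (b e (b e v)))"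
    using h_self[OF b_mem[OF assms(3)], of e] b_star[OF assms(3) b_mem[OF assms(3)], of e e] assms(1) by simp
  also have "\<dots> = (n v)\<^sup>2" using b_square[OF assms] h_self[OF assms(3)] by simp
  finally have "(n (b e v))\<^sup>2 \<le> (n v)\<^sup>2" by simp
  then show ?thesis by (rule power2_le_imp_le[OF _ n_nonneg[OF assms(3)]])
qed

text \<open>The elements of the Clifford algebra generated by \<open>es\<close>, as pairs of an element of the CAR algebra
  and the operator on \<open>W\<close> given by the same polynomial in the generators.  Splitting off the leading
  generator gives a normal form without sums over subsets.\<close>

primrec cl :: "'k list \<Rightarrow> 'a \<Rightarrow> ('w \<Rightarrow> 'w) \<Rightarrow> bool" where
  "cl [] x y \<longleftrightarrow> (\<exists>c. x = c *\<^sub>C 1 \<and> (\<forall>v\<in>W. y v = sc c v))"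
| "cl (e # es) x y \<longleftrightarrow> (\<exists>x0 y0 x1 y1. cl es x0 y0 \<and> cl es x1 y1 \<and> x = x0 + car e * x1 \<and>
    (\<forall>v\<in>W. y v = y0 v + b e (y1 v)))"

lemma cl_cong:
  assumes "cl es x y" "\<And>v. v \<in> W \<Longrightarrow> y' v = y v" shows "cl es x y'"
proof (cases es)
  case Nil
  then show ?thesis using assms by auto
next
  case (Cons e es')
  then obtain x0 y0 x1 y1 where "cl es' x0 y0" "cl es' x1 y1" "x = x0 + car e * x1"
    "\<forall>v\<in>W. y v = y0 v + b e (y1 v)" using assms(1) unfolding Cons cl.simps by blast
  then show ?thesis unfolding Cons cl.simps using assms(2) by metis
qed

lemma cl_mem: "cl es x y \<Longrightarrow> v \<in> W \<Longrightarrow> y v \<in> W"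
proof (induction es arbitrary: x y)
  case Nil
  then show ?case by (auto intro: W_sc)
next
  case (Cons e es)
  from Cons.prems(1) obtain x0 y0 x1 y1 where "cl es x0 y0" "cl es x1 y1" "\<forall>v\<in>W. y v = y0 v + b e (y1 v)"
    unfolding cl.simps by blast
  then show ?case using Cons.IH Cons.prems(2) by (auto intro!: W_add b_mem)
qed

lemma cl_linear:
  "cl es x y \<Longrightarrow> v \<in> W \<Longrightarrow> w \<in> W \<Longrightarrow> y (v + w) = y v + y w \<and> y (sc c v) = sc c (y v)"
proof (induction es arbitrary: x y)
  case Nil
  then show ?case by (auto simp: W_add W_sc vs.scale_right_distrib mult.commute)
next
  case (Cons e es)
  from Cons.prems(1) obtain x0 y0 x1 y1 where *: "cl es x0 y0" "cl es x1 y1" "\<forall>v\<in>W. y v = y0 v + b e (y1 v)"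
    unfolding cl.simps by blast
  then show ?case
    using Cons.IH[OF *(1) Cons.prems(2,3)] Cons.IH[OF *(2) Cons.prems(2,3)] Cons.prems(2,3) cl_mem[OF *(2)]
    by (simp add: W_add W_sc b_add_right b_sc_right vs.scale_right_distrib)
qed

lemma cl_scalar: "cl es (c *\<^sub>C 1) (sc c)"
proof (induction es arbitrary: c)
  case (Cons e es)
  show ?case
    unfolding cl.simps
    by (rule exI[of _ "c *\<^sub>C 1"], rule exI[of _ "sc c"], rule exI[of _ "0 *\<^sub>C 1"], rule exI[of _ "sc 0"])
       (use Cons in \<open>simp add: b_zero del: cvec.scale_zero_left\<close>, simp)
qed auto

lemma cl_add: "cl es x y \<Longrightarrow> cl es x' y' \<Longrightarrow> cl es (x + x') (\<lambda>v. y v + y' v)"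
proof (induction es arbitrary: x y x' y')
  case Nil
  then show ?case by (auto simp flip: scaleC_add_left vs.scale_left_distrib)
next
  case (Cons e es)
  from Cons.prems(1) obtain x0 y0 x1 y1 where 1: "cl es x0 y0" "cl es x1 y1" "x = x0 + car e * x1"
    "\<forall>v\<in>W. y v = y0 v + b e (y1 v)" unfolding cl.simps by blast
  from Cons.prems(2) obtain x0' y0' x1' y1' where 2: "cl es x0' y0'" "cl es x1' y1'" "x' = x0' + car e * x1'"
    "\<forall>v\<in>W. y' v = y0' v + b e (y1' v)" unfolding cl.simps by blast
  show ?case
    unfolding cl.simps
    by (rule exI[of _ "x0 + x0'"], rule exI[of _ "\<lambda>v. y0 v + y0' v"], rule exI[of _ "x1 + x1'"],
        rule exI[of _ "\<lambda>v. y1 v + y1' v"])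
       (use 1 2 Cons.IH[OF 1(1) 2(1)] Cons.IH[OF 1(2) 2(2)] cl_mem[OF 1(2)] cl_mem[OF 2(2)] in
         \<open>simp add: distrib_left b_add_right\<close>)
qed

lemma cl_sc: "cl es x y \<Longrightarrow> cl es (c *\<^sub>C x) (\<lambda>v. sc c (y v))"
proof (induction es arbitrary: x y)
  case Nil
  then show ?case by auto
next
  case (Cons e es)
  from Cons.prems(1) obtain x0 y0 x1 y1 where 1: "cl es x0 y0" "cl es x1 y1" "x = x0 + car e * x1"
    "\<forall>v\<in>W. y v = y0 v + b e (y1 v)" unfolding cl.simps by blast
  show ?case
    unfolding cl.simps
    by (rule exI[of _ "c *\<^sub>C x0"], rule exI[of _ "\<lambda>v. sc c (y0 v)"], rule exI[of _ "c *\<^sub>C x1"],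
        rule exI[of _ "\<lambda>v. sc c (y1 v)"])
       (use 1 Cons.IH[OF 1(1)] Cons.IH[OF 1(2)] cl_mem[OF 1(2)] in
         \<open>simp add: scaleC_add_right scaleC_mult_right vs.scale_right_distrib b_sc_right\<close>)
qed

lemma cl_generator:
  "cliff J es \<Longrightarrow> e \<in> set es \<Longrightarrow> cl es x y \<Longrightarrow> cl es (car e * x) (\<lambda>v. b e (y v))"
proof (induction es arbitrary: x y)
  case (Cons a es)
  from Cons.prems(3) obtain x0 y0 x1 y1 where 1: "cl es x0 y0" "cl es x1 y1" "x = x0 + car a * x1"
    "\<forall>v\<in>W. y v = y0 v + b a (y1 v)" unfolding cl.simps by blast
  have mem: "y0 v \<in> W" "y1 v \<in> W" if "v \<in> W" for v using cl_mem that 1 by blast+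
  show ?case
  proof (cases "e = a")
    case True
    have a: "J a = a" "cinner a a = 2" using Cons.prems(1) by auto
    show ?thesis
      unfolding cl.simps
      by (rule exI[of _ x1], rule exI[of _ y1], rule exI[of _ x0], rule exI[of _ y0])
         (use 1 mem in \<open>simp add: True distrib_left mult.assoc[symmetric] car_square[OF a] b_square[OF a]
            b_add_right b_mem add.commute\<close>)
  next
    case False
    then have e: "e \<in> set es" "cliff J es" using Cons.prems by auto
    have "J e = e" using cliff_real[OF e(2,1)] by blast
    moreover have "cinner e a = 0" using Cons.prems(1) e(1) by (metis cinner_commute cliff.simps(2) complex_cnj_zero)
    ultimately have anti: "car e * (car a * x1) = - (car a * (car e * x1))" "\<And>v. v \<in> W \<Longrightarrow> b e (b a v) = - b a (b e v)"
      using car_orthogonal[of e a] b_orthogonal[of e a] by (simp_all add: mult.assoc[symmetric])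
    show ?thesis
      unfolding cl.simps
      by (rule exI[of _ "car e * x0"], rule exI[of _ "\<lambda>v. b e (y0 v)"], rule exI[of _ "(-1) *\<^sub>C (car e * x1)"],
          rule exI[of _ "\<lambda>v. sc (-1) (b e (y1 v))"])
         (use 1 mem Cons.IH[OF e(2,1) 1(1)] cl_sc[OF Cons.IH[OF e(2,1) 1(2)], of "-1"] anti in
            \<open>simp add: distrib_left b_add_right b_mem b_minus\<close>)
  qed
qed simp

lemma cl_generator_span:
  assumes es: "cliff J es" and f: "f \<in> cspan (set es)" and xy: "cl es x y"
  shows "cl es (car f * x) (\<lambda>v. b f (y v))"
  using f
proof (induction rule: cvec.span_induct_alt)
  case base
  show ?case
    using cl_cong[OF cl_scalar[of es 0], of "\<lambda>v. b 0 (y v)"] cl_mem[OF xy] by (simp add: car_zero b_zero_left)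
next
  case (step c e f)
  show ?case
    using cl_cong[OF cl_add[OF cl_sc[OF cl_generator[OF es step(1) xy], of c] step(2)], of "\<lambda>v. b (c *\<^sub>C e + f) (y v)"]
      cl_mem[OF xy]
    by (simp add: car_add car_scaleC distrib_right scaleC_mult_left b_add_left b_sc_left)
qed

text \<open>Allowing different families for the two factors makes monotonicity in the family the special case
  in which the second factor is the unit.\<close>

lemma cl_mult:
  assumes es': "cliff J es'" and uw: "cl es' u w"
  shows "set es \<subseteq> cspan (set es') \<Longrightarrow> cl es x y \<Longrightarrow> cl es' (x * u) (\<lambda>v. y (w v))"
proof (induction es arbitrary: x y)
  case Nil
  then obtain c where c: "x = c *\<^sub>C 1" "\<forall>v\<in>W. y v = sc c v" by auto
  show ?case
    using cl_cong[OF cl_sc[OF uw, of c], of "\<lambda>v. y (w v)"] c cl_mem[OF uw] by (simp add: scaleC_mult_left)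
next
  case (Cons e es)
  from Cons.prems(2) obtain x0 y0 x1 y1 where 1: "cl es x0 y0" "cl es x1 y1" "x = x0 + car e * x1"
    "\<forall>v\<in>W. y v = y0 v + b e (y1 v)" unfolding cl.simps by blast
  have "cl es' (x0 * u) (\<lambda>v. y0 (w v))" "cl es' (x1 * u) (\<lambda>v. y1 (w v))"
    using Cons.IH 1 Cons.prems(1) by auto
  then have "cl es' (x0 * u + car e * (x1 * u)) (\<lambda>v. y0 (w v) + b e (y1 (w v)))"
    using Cons.prems(1) by (intro cl_add cl_generator_span[OF es']) auto
  then show ?case
    using cl_cong[of es' _ _ "\<lambda>v. y (w v)"] 1 cl_mem[OF uw] by (simp add: distrib_right mult.assoc)
qed

lemma cl_mono:
  assumes "cliff J es'" "set es \<subseteq> cspan (set es')" "cl es x y"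
  shows "cl es' x y"
proof -
  have "cl es' 1 (\<lambda>v. v)" using cl_cong[OF cl_scalar[of es' 1], of "\<lambda>v. v"] by (simp add: scaleC_one)
  from cl_mult[OF assms(1) this assms(2,3)] show ?thesis by simp
qed

lemma cl_car: "cliff J es \<Longrightarrow> f \<in> cspan (set es) \<Longrightarrow> cl es (car f) (b f)"
  using cl_generator_span[of es f 1 "sc 1"] cl_scalar[of es 1] cl_cong[of es "car f" "\<lambda>v. b f (sc 1 v)" "b f"]
  by (simp add: scaleC_one)

lemma cl_star:
  assumes es': "cliff J es'"
  shows "cliff J es \<Longrightarrow> set es \<subseteq> cspan (set es') \<Longrightarrow> cl es x y \<Longrightarrow>
    \<exists>y'. cl es' (star x) y' \<and> (\<forall>v\<in>W. \<forall>w\<in>W. h v (y w) = h (y' v) w \<and> h v (y' w) = h (y v) w)"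
proof (induction es arbitrary: x y)
  case Nil
  then obtain c where c: "x = c *\<^sub>C 1" "\<forall>v\<in>W. y v = sc c v" by auto
  show ?case
    by (rule exI[of _ "sc (cnj c)"])
       (use c cl_scalar[of es' "cnj c"] in \<open>simp add: star_scaleC star_one h_sc\<close>)
next
  case (Cons e es)
  from Cons.prems(3) obtain x0 y0 x1 y1 where 1: "cl es x0 y0" "cl es x1 y1" "x = x0 + car e * x1"
    "\<forall>v\<in>W. y v = y0 v + b e (y1 v)" unfolding cl.simps by blast
  obtain y0' where A0: "cl es' (star x0) y0'" "\<forall>v\<in>W. \<forall>w\<in>W. h v (y0 w) = h (y0' v) w \<and> h v (y0' w) = h (y0 v) w"
    using Cons.IH[OF _ _ 1(1)] Cons.prems by auto
  obtain y1' where A1: "cl es' (star x1) y1'" "\<forall>v\<in>W. \<forall>w\<in>W. h v (y1 w) = h (y1' v) w \<and> h v (y1' w) = h (y1 v) w"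
    using Cons.IH[OF _ _ 1(2)] Cons.prems by auto
  have e: "J e = e" "e \<in> cspan (set es')" using Cons.prems by auto
  have "cl es' (star x1 * car e) (\<lambda>v. y1' (b e v))"
    by (rule cl_mult[OF es' cl_car[OF es' e(2)] cvec.span_superset A1(1)])
  from cl_add[OF A0(1) this]
  have "cl es' (star x) (\<lambda>v. y0' v + y1' (b e v))"
    by (simp add: 1(3) star_add star_mult star_car e(1))
  moreover have "h v (y w) = h (y0' v + y1' (b e v)) w \<and> h v (y0' w + y1' (b e w)) = h (y v) w"
    if "v \<in> W" "w \<in> W" for v w
  proof -
    have mem: "u \<in> W \<Longrightarrow> y0 u \<in> W" "u \<in> W \<Longrightarrow> y1 u \<in> W" "u \<in> W \<Longrightarrow> y0' u \<in> W" "u \<in> W \<Longrightarrow> y1' u \<in> W" for u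
      using cl_mem 1 A0 A1 by blast+
    have "h v (b e (y1 w)) = h (y1' (b e v)) w" "h v (y1' (b e w)) = h (b e (y1 v)) w"
      using that A1(2) b_star[of v "y1 w" e] b_star[of "y1 v" w e] e(1) by (simp_all add: mem b_mem)
    then show ?thesis using that A0(2) 1(4) by (simp add: mem b_mem h_add_left h_add_right)
  qed
  ultimately show ?case by blast
qed

lemma cl_commute:
  assumes "J e = e" "J f = f" "\<And>a. a \<in> set es \<Longrightarrow> cinner e a = 0 \<and> cinner f a = 0"
  shows "cl es x y \<Longrightarrow> car e * car f * x = x * (car e * car f)"
  using assms(3)
proof (induction es arbitrary: x y)
  case Nil
  then show ?case by (auto simp: scaleC_mult_left scaleC_mult_right)
next
  case (Cons a es)
  from Cons.prems(1) obtain x0 y0 x1 y1 where 1: "cl es x0 y0" "cl es x1 y1" "x = x0 + car a * x1"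
    unfolding cl.simps by blast
  have IH: "car e * car f * x0 = x0 * (car e * car f)" "car e * car f * x1 = x1 * (car e * car f)"
    using Cons.IH 1 Cons.prems(2) by auto
  have "car e * car f * car a = car a * (car e * car f)"
    using car_orthogonal[of e a] car_orthogonal[of f a] assms(1,2) Cons.prems(2)[of a]
    by (simp add: mult.assoc) (simp add: mult.assoc[symmetric])
  then have "car e * car f * (car a * x1) = car a * (car e * car f * x1)" by (metis mult.assoc)
  then show ?case using IH by (simp add: 1(3) distrib_left distrib_right mult.assoc)
qed

text \<open>Let \<open>car f\<close> be a further generator.  The product \<open>car e * car f\<close> commutes with \<open>x0\<close> and \<open>x1\<close> and
  anticommutes with \<open>car e\<close>.  Conjugation with this unitary therefore separates \<open>x0\<close> from
  \<open>car e * x1\<close>, so neither of them exceeds the norm of \<open>x\<close>.\<close>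

lemma cl_bound:
  "cliff J (f # es) \<Longrightarrow> cl es x y \<Longrightarrow> v \<in> W \<Longrightarrow> n (y v) \<le> 2 ^ length es * norm x * n v"
proof (induction es arbitrary: x y)
  case Nil
  then obtain c where c: "x = c *\<^sub>C 1" "\<forall>v\<in>W. y v = sc c v" by auto
  then show ?case using Nil.prems(3) by (simp add: n_sc norm_scaleC)
next
  case (Cons e es)
  from Cons.prems(2) obtain x0 y0 x1 y1 where 1: "cl es x0 y0" "cl es x1 y1" "x = x0 + car e * x1"
    "\<forall>v\<in>W. y v = y0 v + b e (y1 v)" unfolding cl.simps by blast
  have e: "J e = e" "cinner e e = 2" and f: "J f = f" "cinner f f = 2" and fe: "cinner f e = 0"
    and orth: "\<And>a. a \<in> set es \<Longrightarrow> cinner e a = 0 \<and> cinner f a = 0" and cliff: "cliff J (f # es)"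
    using Cons.prems(1) by auto
  define w where "w = car e * car f"
  define w' where "w' = car f * car e"
  have ww': "w * w' = 1"
    using car_square[OF f] car_square[OF e] by (metis mult.assoc mult.right_neutral w'_def w_def)
  have comm: "w * x0 = x0 * w" "w * x1 = x1 * w"
    unfolding w_def by (rule cl_commute[OF e(1) f(1) orth 1(1)], assumption)
      (rule cl_commute[OF e(1) f(1) orth 1(2)], assumption)
  have "car f * car e = - (car e * car f)" by (rule car_orthogonal[OF f(1) fe])
  then have anti: "w * car e = - (car e * w)"
    by (simp add: w_def mult.assoc)
  have "norm (w * x * w') \<le> norm w * norm x * norm w'"
    by (meson mult_right_mono norm_ge_zero norm_mult_ineq order_trans)
  moreover have "norm w = 1" "norm w' = 1"
    by (simp_all add: w_def w'_def norm_car_mult[OF e] norm_car_mult[OF f] norm_car[OF e] norm_car[OF f])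
  ultimately have nw: "norm (w * x * w') \<le> norm x" by simp
  have "w * x0 * w' = x0" by (simp add: comm ww' mult.assoc)
  moreover have "w * (car e * x1) * w' = - (car e * x1)"
  proof -
    have "w * (car e * x1) * w' = (w * car e) * x1 * w'" by (simp add: mult.assoc)
    also have "\<dots> = - (car e * (w * x1) * w')" by (simp add: anti mult.assoc)
    also have "\<dots> = - (car e * x1 * (w * w'))" by (simp add: comm mult.assoc)
    finally show ?thesis by (simp add: ww')
  qed
  ultimately have conj: "w * x * w' = x0 - car e * x1" by (simp add: 1(3) distrib_left distrib_right)
  have "2 *\<^sub>R x0 = x + w * x * w'" "2 *\<^sub>R (car e * x1) = x - w * x * w'"
    unfolding conj by (simp_all add: 1(3) scaleR_2)
  then have "norm (2 *\<^sub>R x0) \<le> norm x + norm x" "norm (2 *\<^sub>R (car e * x1)) \<le> norm x + norm x"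
    using nw norm_triangle_ineq[of x "w * x * w'"] norm_triangle_ineq4[of x "w * x * w'"] by simp_all
  then have le: "norm x0 \<le> norm x" "norm x1 \<le> norm x" by (simp_all add: norm_car_mult[OF e])
  have v: "v \<in> W" "0 \<le> n v" using Cons.prems(3) n_nonneg by auto
  have mem: "y0 v \<in> W" "y1 v \<in> W" using cl_mem v 1 by blast+
  have "n (y v) \<le> n (y0 v) + n (y1 v)"
    using n_add[OF mem(1) b_mem[OF mem(2)], of e] b_contraction[OF e mem(2)] 1(4) v by simp
  also have "\<dots> \<le> 2 ^ length es * norm x0 * n v + 2 ^ length es * norm x1 * n v"
    using Cons.IH[OF cliff 1(1) v(1)] Cons.IH[OF cliff 1(2) v(1)] by (rule add_mono)
  also have "\<dots> \<le> 2 ^ length es * norm x * n v + 2 ^ length es * norm x * n v"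
    using le v(2) by (intro add_mono mult_right_mono mult_left_mono) auto
  finally show ?case by (simp add: algebra_simps)
qed

lemma power_compare:
  fixes a c M :: real
  assumes "\<And>k. a ^ (2 ^ k) \<le> M * c ^ (2 ^ k)" "0 \<le> a" "0 \<le> c"
  shows "a \<le> c"
proof (rule ccontr)
  assume "\<not> a \<le> c"
  then have ac: "c < a" by simp
  show False
  proof (cases "c = 0")
    case True
    then show ?thesis using assms(1)[of 0] ac by simp
  next
    case False
    then have r: "a / c > 1" using ac assms(3) by simp
    have "(a / c) ^ (2 ^ k) \<le> M" for k
      using assms(1)[of k] False assms(3) by (simp add: power_divide divide_le_eq)
    moreover obtain m where "M < (a / c) ^ m" using real_arch_pow[OF r] by blast
    moreover have "(a / c) ^ m \<le> (a / c) ^ (2 ^ m)" using r by (intro power_increasing) (auto intro: less_imp_le)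
    ultimately show False by (metis not_less order_trans)
  qed
qed

text \<open>For a selfadjoint element the $C^*$-identity allows repeated squaring, which removes the
  dimension-dependent constant.\<close>

lemma cl_contraction:
  assumes es: "cliff J es" and xy: "cl es x y" and v: "v \<in> W"
  shows "n (y v) \<le> norm x * n v"
proof -
  obtain f where f: "cliff J (f # es)" using cliff_fresh[OF J infinite_dim es] by blast
  have "n (y v) ^ (2 ^ k) \<le> 2 ^ length es * (norm x * n v) ^ (2 ^ k)"
    if "cl es x y" "\<forall>v\<in>W. \<forall>w\<in>W. h v (y w) = h (y v) w" for k x y
    using that
  proof (induction k arbitrary: x y)
    case 0
    then show ?case using cl_bound[OF f 0(1) v] by (simp add: mult.assoc)
  next
    case (Suc k)
    have mem: "y v \<in> W" "y (y v) \<in> W" using cl_mem[OF Suc.prems(1)] v by auto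
    have yy: "cl es (x * x) (\<lambda>v. y (y v))" by (rule cl_mult[OF es Suc.prems(1) cvec.span_superset Suc.prems(1)])
    have IH: "n (y (y v)) ^ (2 ^ k) \<le> 2 ^ length es * (norm (x * x) * n v) ^ (2 ^ k)"
      by (rule Suc.IH[OF yy]) (use Suc.prems(2) cl_mem[OF Suc.prems(1)] in simp)
    have "(n (y v))\<^sup>2 = norm (h v (y (y v)))" using h_self[OF mem(1)] Suc.prems(2) v mem(1) by simp
    also have "\<dots> \<le> n v * n (y (y v))" by (rule h_bound[OF v mem(2)])
    finally have "((n (y v))\<^sup>2) ^ (2 ^ k) \<le> (n v * n (y (y v))) ^ (2 ^ k)" by (rule power_mono) simp
    also have "\<dots> = n v ^ (2 ^ k) * n (y (y v)) ^ (2 ^ k)" by (rule power_mult_distrib)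
    also have "\<dots> \<le> n v ^ (2 ^ k) * (2 ^ length es * (norm (x * x) * n v) ^ (2 ^ k))"
      by (rule mult_left_mono[OF IH]) (simp add: n_nonneg[OF v])
    also have "\<dots> \<le> n v ^ (2 ^ k) * (2 ^ length es * (norm x * norm x * n v) ^ (2 ^ k))"
      using n_nonneg[OF v] by (intro mult_left_mono power_mono mult_right_mono norm_mult_ineq) auto
    also have "\<dots> = 2 ^ length es * (norm x * n v) ^ (2 ^ Suc k)"
      by (simp add: power_mult power_mult_distrib power2_eq_square ac_simps power_add mult_2)
    finally show ?case by (simp add: power_mult)
  qed
  then have selfadjoint: "n (y v) \<le> norm x * n v"
    if "cl es x y" "\<forall>v\<in>W. \<forall>w\<in>W. h v (y w) = h (y v) w" for x y
    using that n_nonneg v cl_mem[OF that(1) v] by (intro power_compare[of "n (y v)" "2 ^ length es" "norm x * n v"]) auto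
  obtain y' where y': "cl es (star x) y'" "\<forall>v\<in>W. \<forall>w\<in>W. h v (y w) = h (y' v) w \<and> h v (y' w) = h (y v) w"
    using cl_star[OF es es cvec.span_superset xy] by blast
  have mem: "u \<in> W \<Longrightarrow> y u \<in> W" "u \<in> W \<Longrightarrow> y' u \<in> W" for u using cl_mem xy y'(1) by blast+
  have "cl es (star x * x) (\<lambda>v. y' (y v))" by (rule cl_mult[OF es xy cvec.span_superset y'(1)])
  then have "n (y' (y v)) \<le> norm (star x * x) * n v"
    by (rule selfadjoint) (use y'(2) mem in simp)
  moreover have "(n (y v))\<^sup>2 \<le> n (y' (y v)) * n v"
    using h_self[of "y v"] y'(2) mem v h_bound[of "y' (y v)" v] by simp
  ultimately have "(n (y v))\<^sup>2 \<le> (norm (star x * x) * n v) * n v"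
    using n_nonneg[OF v] by (meson mult_right_mono order_trans)
  then have "(n (y v))\<^sup>2 \<le> (norm x * n v)\<^sup>2" by (simp add: cstar_identity power2_eq_square ac_simps)
  then show ?thesis by (rule power2_le_imp_le) (simp add: n_nonneg[OF v])
qed

text \<open>By the contraction estimate this relation is the graph of a map on a dense subalgebra.\<close>

definition D :: "'a \<Rightarrow> ('w \<Rightarrow> 'w) \<Rightarrow> bool"
  where "D x y \<longleftrightarrow> (\<exists>es. cliff J es \<and> cl es x y)"

lemma D_mem: "D x y \<Longrightarrow> v \<in> W \<Longrightarrow> y v \<in> W" unfolding D_def using cl_mem by blast

lemma D_linear: "D x y \<Longrightarrow> v \<in> W \<Longrightarrow> w \<in> W \<Longrightarrow> y (v + w) = y v + y w \<and> y (sc c v) = sc c (y v)"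
  unfolding D_def using cl_linear by blast

lemma D_diff_right: "D x y \<Longrightarrow> v \<in> W \<Longrightarrow> w \<in> W \<Longrightarrow> y (v - w) = y v - y w"
  using D_linear[of x y v "- w" 0] D_linear[of x y w 0 "-1"] W_zero W_minus by simp

lemma D_bound: "D x y \<Longrightarrow> v \<in> W \<Longrightarrow> n (y v) \<le> norm x * n v"
  unfolding D_def using cl_contraction by blast

text \<open>The spans of the two generating families lie in the span of a larger family.\<close>

lemma D_common:
  assumes "D x y" "D x' y'" shows "\<exists>es. cliff J es \<and> cl es x y \<and> cl es x' y'"
proof -
  obtain es1 es2 where *: "cliff J es1" "cl es1 x y" "cliff J es2" "cl es2 x' y'" using assms D_def by blast
  obtain es where "cliff J es" "set es1 \<union> set es2 \<subseteq> cspan (set es)"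
    using cliff_cover[OF J, of "set es1 \<union> set es2"] by auto
  then show ?thesis using * cl_mono by (intro exI[of _ es]) auto
qed

lemma D_add: "D x y \<Longrightarrow> D x' y' \<Longrightarrow> D (x + x') (\<lambda>v. y v + y' v)"
  using D_common[of x y x' y'] cl_add[of _ x y x' y'] unfolding D_def by blast

lemma D_sc: "D x y \<Longrightarrow> D (c *\<^sub>C x) (\<lambda>v. sc c (y v))"
  using cl_sc[of _ x y c] unfolding D_def by blast

lemma D_diff: assumes "D x y" "D x' y'" shows "D (x - x') (\<lambda>v. y v - y' v)"
  using D_add[OF assms(1) D_sc[OF assms(2), of "-1"]] by simp

lemma D_mult: "D x y \<Longrightarrow> D x' y' \<Longrightarrow> D (x * x') (\<lambda>v. y (y' v))"
  using D_common[of x y x' y'] cl_mult[OF _ _ cvec.span_superset, of _ x' y' x y] unfolding D_def by blast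

lemma D_one: "D 1 (\<lambda>v. v)"
  unfolding D_def using cl_cong[OF cl_scalar[of "[]" 1], of "\<lambda>v. v"]
  by (intro exI[of _ "[]"]) (simp add: scaleC_one)

lemma D_zero: "D 0 (\<lambda>v. 0)"
  using D_sc[OF D_one, of 0] by (simp only: cvec.scale_zero_left vs.scale_zero_left)

lemma D_car: "D (car f) (b f)"
  unfolding D_def using cliff_cover[OF J, of "{f}"] cl_car[of _ f] by auto

lemma D_star: "D x y \<Longrightarrow> \<exists>y'. D (star x) y' \<and> (\<forall>v\<in>W. \<forall>w\<in>W. h v (y w) = h (y' v) w)"
  unfolding D_def using cl_star[OF _ _ cvec.span_superset, of _ x y] by blast

lemma D_dense: "\<exists>X Y. (\<forall>k. D (X k) (Y k)) \<and> X \<longlonglongrightarrow> x"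
proof -
  define S where "S = closure {x. \<exists>y. D x y}"
  have seq: "x \<in> S \<longleftrightarrow> (\<exists>X. (\<forall>k. \<exists>y. D (X k) y) \<and> X \<longlonglongrightarrow> x)" for x
    unfolding S_def closure_sequential by simp
  have "x \<in> S"
  proof (rule car_generates)
    have "{x. \<exists>y. D x y} \<subseteq> S" unfolding S_def by (rule closure_subset)
    then show "1 \<in> S" "range car \<subseteq> S" using D_one D_car by blast+
    show "closed S" by (simp add: S_def)
  next
    fix x y c assume "x \<in> S"
    then obtain X where X: "\<forall>k. \<exists>y. D (X k) y" "X \<longlonglongrightarrow> x" using seq by blast
    show "c *\<^sub>C x \<in> S" unfolding seq
      using X D_sc by (intro exI[of _ "\<lambda>k. c *\<^sub>C X k"]) (blast intro: scaleC_tendsto)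
    show "star x \<in> S" unfolding seq
      using X D_star by (intro exI[of _ "\<lambda>k. star (X k)"]) (blast intro: star_tendsto)
    assume "y \<in> S"
    then obtain Y where Y: "\<forall>k. \<exists>y. D (Y k) y" "Y \<longlonglongrightarrow> y" using seq by blast
    show "x + y \<in> S" unfolding seq
      using X Y D_add by (intro exI[of _ "\<lambda>k. X k + Y k"]) (blast intro: tendsto_add)
    show "x * y \<in> S" unfolding seq
      using X Y D_mult by (intro exI[of _ "\<lambda>k. X k * Y k"]) (blast intro: tendsto_mult)
  qed
  then show ?thesis unfolding seq by metis
qed

lemma W_limit_unique:
  assumes "\<And>k. Z k \<in> W" "u \<in> W" "w \<in> W" "(\<lambda>k. n (Z k - u)) \<longlonglongrightarrow> 0" "(\<lambda>k. n (Z k - w)) \<longlonglongrightarrow> 0"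
  shows "u = w"
proof -
  have le: "n (u - w) \<le> n (Z k - u) + n (Z k - w)" for k
    using n_triangle[OF assms(2) assms(1) assms(3), of k] unfolding n_commute[OF assms(2) assms(1), of k] .
  have "(\<lambda>k. n (Z k - u) + n (Z k - w)) \<longlonglongrightarrow> 0" using tendsto_add[OF assms(4,5)] by simp
  then have "n (u - w) \<le> 0" by (rule LIMSEQ_le_const) (simp add: le)
  moreover have mem: "u - w \<in> W" by (rule W_diff[OF assms(2,3)])
  ultimately have "n (u - w) = 0" using n_nonneg[OF mem] by linarith
  then show ?thesis using n_eq_0[OF mem] by simp
qed

text \<open>The extension by continuity of the graph \<open>D\<close> to the whole algebra, described by its distance from
  all Clifford elements.\<close>

definition ext :: "'a \<Rightarrow> 'w \<Rightarrow> 'w"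
  where "ext x v = (THE w. w \<in> W \<and> (\<forall>x' y. D x' y \<longrightarrow> n (w - y v) \<le> norm (x - x') * n v))"

lemma null_comparison: "f \<longlonglongrightarrow> 0 \<Longrightarrow> (\<And>k. 0 \<le> g k) \<Longrightarrow> (\<And>k. g k \<le> f k) \<Longrightarrow> g \<longlonglongrightarrow> (0::real)"
  by (rule Lim_null_comparison[of g f]) auto

lemma ext_char:
  assumes v: "v \<in> W"
  shows "ext x v \<in> W \<and> (\<forall>x' y. D x' y \<longrightarrow> n (ext x v - y v) \<le> norm (x - x') * n v)"
  unfolding ext_def
proof (rule theI', rule ex_ex1I)
  obtain X Y where XY: "\<And>k. D (X k) (Y k)" "X \<longlonglongrightarrow> x" using D_dense by blast
  have Yv: "Y k v \<in> W" for k using D_mem[OF XY(1) v] .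
  have lim0: "(\<lambda>k. norm (x - X k) * n v) \<longlonglongrightarrow> 0"
    using tendsto_mult_left_zero[OF tendsto_norm_zero[OF LIM_zero[OF XY(2)]], of "n v"]
    by (simp add: norm_minus_commute)
  {
    fix w w' assume w: "w \<in> W \<and> (\<forall>x' y. D x' y \<longrightarrow> n (w - y v) \<le> norm (x - x') * n v)"
      and w': "w' \<in> W \<and> (\<forall>x' y. D x' y \<longrightarrow> n (w' - y v) \<le> norm (x - x') * n v)"
    show "w = w'"
    proof (rule W_limit_unique[of "\<lambda>k. Y k v"])
      have lim: "(\<lambda>k. n (Y k v - w)) \<longlonglongrightarrow> 0"
        if w: "w \<in> W \<and> (\<forall>x' y. D x' y \<longrightarrow> n (w - y v) \<le> norm (x - x') * n v)" for w
      proof (rule null_comparison[OF lim0])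
        have wW: "w \<in> W" using w by blast
        show "0 \<le> n (Y k v - w)" for k by (rule n_nonneg[OF W_diff[OF Yv wW]])
        show "n (Y k v - w) \<le> norm (x - X k) * n v" for k
          unfolding n_commute[OF Yv wW] using w XY(1) by blast
      qed
      show "(\<lambda>k. n (Y k v - w)) \<longlonglongrightarrow> 0" "(\<lambda>k. n (Y k v - w')) \<longlonglongrightarrow> 0"
        by (rule lim[OF w], rule lim[OF w'])
    qed (use w w' Yv in auto)
  }
  have bound: "n (Y k v - y v) \<le> norm (X k - x') * n v" if "D x' y" for k x' y
    using D_bound[OF D_diff[OF XY(1) that] v] .
  have "\<exists>w\<in>W. (\<lambda>k. n (Y k v - w)) \<longlonglongrightarrow> 0"
  proof (rule W_complete[OF Yv])
    fix e :: real assume e: "e > 0"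
    have nv: "n v + 1 > 0" using n_nonneg[OF v] by simp
    have "Cauchy X" using XY(2) LIMSEQ_imp_Cauchy by blast
    then obtain N where N: "\<forall>k\<ge>N. \<forall>l\<ge>N. norm (X k - X l) < e / (n v + 1)"
      using e nv unfolding Cauchy_def dist_norm by (metis divide_pos_pos)
    have "n (Y k v - Y l v) < e" if "k \<ge> N" "l \<ge> N" for k l
    proof -
      have "n (Y k v - Y l v) \<le> norm (X k - X l) * n v" by (rule bound[OF XY(1)])
      also have "\<dots> \<le> e / (n v + 1) * n v"
        using N that n_nonneg[OF v] by (intro mult_right_mono) (auto intro: less_imp_le)
      also have "\<dots> < e" using e nv by (simp add: field_simps)
      finally show ?thesis .
    qed
    then show "\<exists>N. \<forall>k\<ge>N. \<forall>l\<ge>N. n (Y k v - Y l v) < e" by blast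
  qed
  then obtain w where w: "w \<in> W" "(\<lambda>k. n (Y k v - w)) \<longlonglongrightarrow> 0" by blast
  have "n (w - y v) \<le> norm (x - x') * n v" if D': "D x' y" for x' y
  proof (rule LIMSEQ_le_const)
    have "(\<lambda>k. n (Y k v - w) + norm (X k - x') * n v) \<longlonglongrightarrow> 0 + norm (x - x') * n v"
      by (intro tendsto_intros w XY)
    then show "(\<lambda>k. n (Y k v - w) + norm (X k - x') * n v) \<longlonglongrightarrow> norm (x - x') * n v" by simp
    have "n (w - y v) \<le> n (Y k v - w) + norm (X k - x') * n v" for k
      using n_triangle[OF w(1) Yv D_mem[OF D' v], of k] n_commute[OF w(1) Yv, of k] bound[OF D', of k] by simp
    then show "\<exists>N. \<forall>k\<ge>N. n (w - y v) \<le> n (Y k v - w) + norm (X k - x') * n v" by blast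
  qed
  then show "\<exists>w. w \<in> W \<and> (\<forall>x' y. D x' y \<longrightarrow> n (w - y v) \<le> norm (x - x') * n v)" using w(1) by blast
qed

lemma ext_mem: "v \<in> W \<Longrightarrow> ext x v \<in> W"
  by (rule conjunct1[OF ext_char])

lemma ext_approx: "v \<in> W \<Longrightarrow> D x' y \<Longrightarrow> n (ext x v - y v) \<le> norm (x - x') * n v"
  using ext_char[of v x] by blast

lemma ext_D: assumes "D x y" "v \<in> W" shows "ext x v = y v"
proof -
  have mem: "ext x v - y v \<in> W" by (rule W_diff[OF ext_mem[OF assms(2)] D_mem[OF assms]])
  have "n (ext x v - y v) \<le> 0" using ext_approx[OF assms(2,1), of x] by simp
  then have "n (ext x v - y v) = 0" using n_nonneg[OF mem] by linarith
  then show ?thesis using n_eq_0[OF mem] by simp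
qed

lemma ext_bound: "v \<in> W \<Longrightarrow> n (ext x v) \<le> norm x * n v"
  using ext_approx[OF _ D_zero, of v x] by simp

lemma ext_tendsto:
  assumes "\<And>k. D (X k) (Y k)" "X \<longlonglongrightarrow> x" "v \<in> W"
  shows "(\<lambda>k. n (Y k v - ext x v)) \<longlonglongrightarrow> 0"
proof (rule null_comparison)
  show "(\<lambda>k. norm (x - X k) * n v) \<longlonglongrightarrow> 0"
    using tendsto_mult_left_zero[OF tendsto_norm_zero[OF LIM_zero[OF assms(2)]], of "n v"]
    by (simp add: norm_minus_commute)
  show "n (Y k v - ext x v) \<le> norm (x - X k) * n v" for k
    unfolding n_commute[OF D_mem[OF assms(1,3)] ext_mem[OF assms(3)]]
    by (rule ext_approx[OF assms(3) assms(1)])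
  show "0 \<le> n (Y k v - ext x v)" for k
    by (intro n_nonneg W_diff ext_mem D_mem[OF assms(1)] assms(3))
qed

lemma ext_eqI:
  assumes "\<And>k. D (X k) (Y k)" "X \<longlonglongrightarrow> x" "v \<in> W" "w \<in> W" "(\<lambda>k. n (Y k v - w)) \<longlonglongrightarrow> 0"
  shows "ext x v = w"
  by (rule W_limit_unique[OF D_mem[OF assms(1,3)] ext_mem[OF assms(3)] assms(4)
        ext_tendsto[OF assms(1-3)] assms(5)])

lemma n_add_null:
  assumes "\<And>k. A k \<in> W" "\<And>k. B k \<in> W" "u \<in> W" "w \<in> W" "(\<lambda>k. n (A k - u)) \<longlonglongrightarrow> 0" "(\<lambda>k. n (B k - w)) \<longlonglongrightarrow> 0"
  shows "(\<lambda>k. n ((A k + B k) - (u + w))) \<longlonglongrightarrow> 0"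
proof (rule null_comparison)
  show "(\<lambda>k. n (A k - u) + n (B k - w)) \<longlonglongrightarrow> 0" using tendsto_add[OF assms(5,6)] by simp
  show "n ((A k + B k) - (u + w)) \<le> n (A k - u) + n (B k - w)" for k
    using n_add[of "A k - u" "B k - w"] assms by (simp add: W_diff algebra_simps)
qed (use assms in \<open>auto intro!: n_nonneg W_diff W_add\<close>)

lemma ext_add: assumes v: "v \<in> W" shows "ext (x + x') v = ext x v + ext x' v"
proof -
  obtain X Y where 1: "\<And>k. D (X k) (Y k)" "X \<longlonglongrightarrow> x" using D_dense by blast
  obtain X' Y' where 2: "\<And>k. D (X' k) (Y' k)" "X' \<longlonglongrightarrow> x'" using D_dense by blast
  show ?thesis
    by (rule ext_eqI[OF D_add[OF 1(1) 2(1)] tendsto_add[OF 1(2) 2(2)] v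
          W_add[OF ext_mem[OF v] ext_mem[OF v]]
          n_add_null[OF D_mem[OF 1(1) v] D_mem[OF 2(1) v] ext_mem[OF v] ext_mem[OF v]
            ext_tendsto[OF 1 v] ext_tendsto[OF 2 v]]])
qed

lemma ext_sc: assumes v: "v \<in> W" shows "ext (c *\<^sub>C x) v = sc c (ext x v)"
proof -
  obtain X Y where 1: "\<And>k. D (X k) (Y k)" "X \<longlonglongrightarrow> x" using D_dense by blast
  show ?thesis
  proof (rule ext_eqI[OF D_sc[OF 1(1)] scaleC_tendsto[OF 1(2)] v W_sc[OF ext_mem[OF v]]])
    have "n (sc c (Y k v) - sc c (ext x v)) = cmod c * n (Y k v - ext x v)" for k
      using v D_mem[OF 1(1) v] by (simp add: vs.scale_right_diff_distrib[symmetric] n_sc W_diff ext_mem)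
    then show "(\<lambda>k. n (sc c (Y k v) - sc c (ext x v))) \<longlonglongrightarrow> 0"
      using tendsto_mult_right_zero[OF ext_tendsto[OF 1 v], of "cmod c"] by simp
  qed
qed

lemma ext_add_right: assumes v: "v \<in> W" and w: "w \<in> W" shows "ext x (v + w) = ext x v + ext x w"
proof -
  obtain X Y where 1: "\<And>k. D (X k) (Y k)" "X \<longlonglongrightarrow> x" using D_dense by blast
  have eq: "Y k (v + w) = Y k v + Y k w" for k using D_linear[OF 1(1) v w] by simp
  show ?thesis
    by (rule ext_eqI[OF 1 W_add[OF v w] W_add[OF ext_mem[OF v] ext_mem[OF w]]], unfold eq)
       (rule n_add_null[OF D_mem[OF 1(1) v] D_mem[OF 1(1) w] ext_mem[OF v] ext_mem[OF w]
            ext_tendsto[OF 1 v] ext_tendsto[OF 1 w]])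
qed

lemma ext_sc_right: assumes v: "v \<in> W" shows "ext x (sc c v) = sc c (ext x v)"
proof -
  obtain X Y where 1: "\<And>k. D (X k) (Y k)" "X \<longlonglongrightarrow> x" using D_dense by blast
  have eq: "Y k (sc c v) = sc c (Y k v)" for k using D_linear[OF 1(1) v v] by simp
  show ?thesis
  proof (rule ext_eqI[OF 1 W_sc[OF v] W_sc[OF ext_mem[OF v]]], unfold eq)
    have "n (sc c (Y k v) - sc c (ext x v)) = cmod c * n (Y k v - ext x v)" for k
      using v D_mem[OF 1(1) v] by (simp add: vs.scale_right_diff_distrib[symmetric] n_sc W_diff ext_mem)
    then show "(\<lambda>k. n (sc c (Y k v) - sc c (ext x v))) \<longlonglongrightarrow> 0"
      using tendsto_mult_right_zero[OF ext_tendsto[OF 1 v], of "cmod c"] by simp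
  qed
qed

lemma ext_mult: assumes v: "v \<in> W" shows "ext (x * x') v = ext x (ext x' v)"
proof -
  obtain X Y where 1: "\<And>k. D (X k) (Y k)" "X \<longlonglongrightarrow> x" using D_dense by blast
  obtain X' Y' where 2: "\<And>k. D (X' k) (Y' k)" "X' \<longlonglongrightarrow> x'" using D_dense by blast
  define u where "u = ext x' v"
  have u: "u \<in> W" unfolding u_def by (rule ext_mem[OF v])
  have Y': "Y' k v \<in> W" for k by (rule D_mem[OF 2(1) v])
  show ?thesis
    unfolding u_def[symmetric]
  proof (rule ext_eqI[OF D_mult[OF 1(1) 2(1)] tendsto_mult[OF 1(2) 2(2)] v ext_mem[OF u]])
    show "(\<lambda>k. n (Y k (Y' k v) - ext x u)) \<longlonglongrightarrow> 0"
    proof (rule null_comparison)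
      have "(\<lambda>k. n (Y' k v - u)) \<longlonglongrightarrow> 0" unfolding u_def by (rule ext_tendsto[OF 2 v])
      then have "(\<lambda>k. norm (X k) * n (Y' k v - u) + n (Y k u - ext x u)) \<longlonglongrightarrow> norm x * 0 + 0"
        by (intro tendsto_add tendsto_mult tendsto_norm 1(2) ext_tendsto[OF 1 u])
      then show "(\<lambda>k. norm (X k) * n (Y' k v - u) + n (Y k u - ext x u)) \<longlonglongrightarrow> 0" by simp
      show "n (Y k (Y' k v) - ext x u) \<le> norm (X k) * n (Y' k v - u) + n (Y k u - ext x u)" for k
      proof -
        have "n (Y k (Y' k v) - ext x u) \<le> n (Y k (Y' k v) - Y k u) + n (Y k u - ext x u)"
          by (rule n_triangle[OF D_mem[OF 1(1) Y'] D_mem[OF 1(1) u] ext_mem[OF u]])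
        also have "Y k (Y' k v) - Y k u = Y k (Y' k v - u)"
          by (rule D_diff_right[OF 1(1) Y' u, symmetric])
        also have "n (Y k (Y' k v - u)) \<le> norm (X k) * n (Y' k v - u)"
          by (rule D_bound[OF 1(1) W_diff[OF Y' u]])
        finally show ?thesis by simp
      qed
    qed (intro n_nonneg W_diff D_mem[OF 1(1)] Y' ext_mem u)
  qed
qed

lemma ext_one: "v \<in> W \<Longrightarrow> ext 1 v = v" by (rule ext_D[OF D_one])

lemma ext_car: "v \<in> W \<Longrightarrow> ext (car f) v = b f v" by (rule ext_D[OF D_car])

lemma h_tendsto:
  assumes "\<And>k. A k \<in> W" "u \<in> W" "w \<in> W" "(\<lambda>k. n (A k - u)) \<longlonglongrightarrow> 0"
  shows "(\<lambda>k. h (A k) w) \<longlonglongrightarrow> h u w" "(\<lambda>k. h w (A k)) \<longlonglongrightarrow> h w u"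
proof -
  have lim: "(\<lambda>k. n (A k - u) * n w) \<longlonglongrightarrow> 0" using tendsto_mult_left_zero[OF assms(4)] by simp
  have Au: "A k - u \<in> W" for k by (rule W_diff[OF assms(1,2)])
  have "h (A k) w = h (A k - u) w + h u w" "h w (A k) = h w (A k - u) + h w u" for k
    using h_add_left[OF Au assms(2,3), of k] h_add_right[OF assms(3) Au assms(2), of k] by simp_all
  then have le: "norm (h (A k) w - h u w) \<le> n (A k - u) * n w" "norm (h w (A k) - h w u) \<le> n (A k - u) * n w" for k
    using h_bound[OF Au assms(3), of k] h_bound[OF assms(3) Au, of k] by (simp_all add: mult.commute)
  have "(\<lambda>k. h (A k) w - h u w) \<longlonglongrightarrow> 0" "(\<lambda>k. h w (A k) - h w u) \<longlonglongrightarrow> 0"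
    by (rule Lim_null_comparison[OF always_eventually lim], rule allI, rule le)+
  then show "(\<lambda>k. h (A k) w) \<longlonglongrightarrow> h u w" "(\<lambda>k. h w (A k)) \<longlonglongrightarrow> h w u"
    by (simp_all only: LIM_zero_cancel)
qed

lemma ext_star: assumes v: "v \<in> W" and w: "w \<in> W" shows "h v (ext x w) = h (ext (star x) v) w"
proof -
  obtain X Y where 1: "\<And>k. D (X k) (Y k)" "X \<longlonglongrightarrow> x" using D_dense by blast
  obtain Y' where 2: "\<And>k. D (star (X k)) (Y' k)" "\<And>k v w. v \<in> W \<Longrightarrow> w \<in> W \<Longrightarrow> h v (Y k w) = h (Y' k v) w"
  proof -
    have "\<forall>k. \<exists>y'. D (star (X k)) y' \<and> (\<forall>v\<in>W. \<forall>w\<in>W. h v (Y k w) = h (y' v) w)"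
      using D_star[OF 1(1)] by (rule allI)
    from choice[OF this] show ?thesis using that by blast
  qed
  have "(\<lambda>k. h v (Y k w)) \<longlonglongrightarrow> h v (ext x w)"
    by (rule h_tendsto(2)[OF D_mem[OF 1(1) w] ext_mem[OF w] v ext_tendsto[OF 1 w]])
  moreover have "(\<lambda>k. h v (Y k w)) \<longlonglongrightarrow> h (ext (star x) v) w"
    unfolding 2(2)[OF v w]
    by (rule h_tendsto(1)[OF D_mem[OF 2(1) v] ext_mem[OF v] w ext_tendsto[OF 2(1) star_tendsto[OF 1(2)] v]])
  ultimately show ?thesis by (rule LIMSEQ_unique)
qed

lemma ext_unique:
  assumes mem: "\<And>x v. v \<in> W \<Longrightarrow> \<psi> x v \<in> W"
    and add: "\<And>x y v. v \<in> W \<Longrightarrow> \<psi> (x + y) v = \<psi> x v + \<psi> y v"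
    and sc: "\<And>c x v. v \<in> W \<Longrightarrow> \<psi> (c *\<^sub>C x) v = sc c (\<psi> x v)"
    and mult: "\<And>x y v. v \<in> W \<Longrightarrow> \<psi> (x * y) v = \<psi> x (\<psi> y v)"
    and one: "\<And>v. v \<in> W \<Longrightarrow> \<psi> 1 v = v"
    and gen: "\<And>f v. v \<in> W \<Longrightarrow> \<psi> (car f) v = b f v"
    and bound: "\<And>x v. v \<in> W \<Longrightarrow> n (\<psi> x v) \<le> norm x * n v"
    and v: "v \<in> W"
  shows "\<psi> x v = ext x v"
proof -
  have cl: "cl es x y \<Longrightarrow> \<psi> x v = y v" if v: "v \<in> W" for es x y v
  proof (induction es arbitrary: x y)
    case Nil
    then obtain c where "x = c *\<^sub>C 1" "y v = sc c v" using v by auto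
    then show ?case using sc[OF v, of c 1] one[OF v] by simp
  next
    case (Cons e es)
    from Cons.prems obtain x0 y0 x1 y1 where *: "cl es x0 y0" "cl es x1 y1" "x = x0 + car e * x1"
      "\<forall>v\<in>W. y v = y0 v + b e (y1 v)" unfolding cl.simps by blast
    have "\<psi> x v = \<psi> x0 v + \<psi> (car e) (\<psi> x1 v)" unfolding *(3) add[OF v] mult[OF v] ..
    also have "\<dots> = y0 v + b e (y1 v)"
      unfolding Cons.IH[OF *(1)] Cons.IH[OF *(2)] gen[OF cl_mem[OF *(2) v]] ..
    finally show ?case using *(4) v by simp
  qed
  obtain X Y where 1: "\<And>k. D (X k) (Y k)" "X \<longlonglongrightarrow> x" using D_dense by blast
  have "ext x v = \<psi> x v"
  proof (rule ext_eqI[OF 1 v mem[OF v]], rule null_comparison)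
    show "(\<lambda>k. norm (X k - x) * n v) \<longlonglongrightarrow> 0"
      using tendsto_mult_left_zero[OF tendsto_norm_zero[OF LIM_zero[OF 1(2)]], of "n v"] .
    fix k
    obtain es where "cl es (X k) (Y k)" using 1(1)[of k] unfolding D_def by blast
    then have "Y k v = \<psi> (X k) v" by (rule cl[OF v, symmetric])
    moreover have "\<psi> (X k) v = \<psi> (X k - x) v + \<psi> x v" using add[OF v, of "X k - x" x] by simp
    ultimately show "n (Y k v - \<psi> x v) \<le> norm (X k - x) * n v" using bound[OF v, of "X k - x"] by simp
    show "0 \<le> n (Y k v - \<psi> x v)" by (intro n_nonneg W_diff D_mem[OF 1(1)] mem v)
  qed
  then show ?thesis by simp
qed

end

lemma bogoliubov_bop: "V \<in> bogoliubov J \<Longrightarrow> V \<in> bop"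
  by (simp add: bogoliubov_def)

lemma bogoliubov_isometry: "V \<in> bogoliubov J \<Longrightarrow> cinner (V x) (V y) = cinner x y"
  using isometry_iff[of V] unfolding bogoliubov_def by blast

lemma bogoliubov_conj:
  assumes "complex_conjugation J" "V \<in> bogoliubov J" shows "J (V f) = V (J f)"
proof -
  have "bar J V = V" using assms(2) by (simp add: bogoliubov_def)
  then have "J (V (J (J f))) = V (J f)" unfolding bar_def by (rule fun_cong)
  then show ?thesis by (simp add: conj_conj[OF assms(1)])
qed

text \<open>Since \<open>V\<close> is a real isometry, the elements \<open>car (V f)\<close> satisfy the relations of the generators.\<close>

lemma (in car_algebra) car_rep_left_mult:
  assumes V: "V \<in> bogoliubov J"
  shows "car_rep J car UNIV scaleC norm (\<lambda>v w. star v * w) (\<lambda>f v. car (V f) * v)"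
proof unfold_locales
  have bop: "V \<in> bop" by (rule bogoliubov_bop[OF V])
  note JV = bogoliubov_conj[OF J V]
  fix u v w :: 'a and f g :: 'k and c
  show "norm (star v * v) = (norm v)\<^sup>2" by (rule cstar_identity)
  show "norm (star v * w) \<le> norm v * norm w" using norm_mult_ineq[of "star v" w] by (simp add: norm_star)
  show "star (u + v) * w = star u * w + star v * w" by (simp add: star_add distrib_right)
  show "star u * (v + w) = star u * v + star u * w" by (simp add: distrib_left)
  show "star v * (c *\<^sub>C w) = star (cnj c *\<^sub>C v) * w" by (simp add: star_scaleC scaleC_mult_left scaleC_mult_right)
  show "car (V f) * (v + w) = car (V f) * v + car (V f) * w" by (simp add: distrib_left)
  show "car (V f) * (c *\<^sub>C v) = c *\<^sub>C (car (V f) * v)" by (simp add: scaleC_mult_right)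
  show "car (V (f + g)) * v = car (V f) * v + car (V g) * v"
    by (simp add: bop_add[OF bop] car_add distrib_right)
  show "car (V (c *\<^sub>C f)) * v = c *\<^sub>C (car (V f) * v)"
    by (simp add: bop_scaleC[OF bop] car_scaleC scaleC_mult_left)
  show "star v * (car (V f) * w) = star (car (V (J f)) * v) * w"
    by (simp add: star_mult star_car JV conj_conj[OF J] mult.assoc)
  have "car (V f) * (car (V g) * v) + car (V g) * (car (V f) * v) = (car (V f) * car (V g) + car (V g) * car (V f)) * v"
    by (simp add: distrib_right mult.assoc)
  then show "car (V f) * (car (V g) * v) + car (V g) * (car (V f) * v) = cinner (J f) g *\<^sub>C v"
    by (simp add: car_anticommute JV bogoliubov_isometry[OF V] scaleC_mult_left)
next
  fix X :: "nat \<Rightarrow> 'a"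
  assume "\<And>e. e > 0 \<Longrightarrow> \<exists>N. \<forall>k\<ge>N. \<forall>l\<ge>N. norm (X k - X l) < e"
  then have "Cauchy X" by (auto simp: Cauchy_def dist_norm)
  then obtain x where "X \<longlonglongrightarrow> x" using Cauchy_convergent convergent_def by blast
  then show "\<exists>w\<in>UNIV. (\<lambda>k. norm (X k - w)) \<longlonglongrightarrow> 0"
    using tendsto_norm_zero[OF LIM_zero] by blast
qed (simp_all add: norm_triangle_ineq norm_scaleC scaleC_add_right scaleC_add_left scaleC_scaleC scaleC_one)

text \<open>The operators of the module extension commute with right multiplications, hence are left
  multiplications by their values at \<open>1\<close>; these values define the endomorphism.\<close>

lemma (in car_algebra) car_endo:
  assumes V: "V \<in> bogoliubov J"
  shows "unital_star_endo (car_endo car V) \<and> (\<forall>f. car_endo car V (car f) = car (V f))"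
proof -
  interpret R: car_rep J car UNIV scaleC norm "\<lambda>v w. star v * w" "\<lambda>f v. car (V f) * v"
    by (rule car_rep_left_mult[OF V])
  have cl_right: "y (v * w) = y v * w" if "R.cl es x y" for es x y v w
    using that
  proof (induction es arbitrary: x y)
    case Nil
    then show ?case by (auto simp: scaleC_mult_left)
  next
    case (Cons e es)
    then obtain x0 y0 x1 y1 where *: "R.cl es x0 y0" "R.cl es x1 y1" "\<forall>v\<in>UNIV. y v = y0 v + car (V e) * y1 v"
      unfolding R.cl.simps by blast
    then show ?case using Cons.IH[OF *(1)] Cons.IH[OF *(2)] by (simp add: distrib_right mult.assoc)
  qed
  have right: "R.ext x v = R.ext x 1 * v" for x v
  proof -
    obtain X Y where 1: "\<And>k. R.D (X k) (Y k)" "X \<longlonglongrightarrow> x" using R.D_dense by blast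
    have eq: "Y k v = Y k 1 * v" for k
      using 1(1)[of k] cl_right[of _ "X k" "Y k" 1 v] unfolding R.D_def by auto
    show ?thesis
    proof (rule R.ext_eqI[OF 1 UNIV_I UNIV_I], unfold eq left_diff_distrib[symmetric], rule R.null_comparison)
      show "(\<lambda>k. norm (Y k 1 - R.ext x 1) * norm v) \<longlonglongrightarrow> 0"
        by (rule tendsto_mult_left_zero[OF R.ext_tendsto[OF 1 UNIV_I]])
    qed (simp_all add: norm_mult_ineq)
  qed
  define \<rho> where "\<rho> x = R.ext x 1" for x
  have "\<rho> (star x) = star (\<rho> x)" for x
    using R.ext_star[of 1 1 x] star_star[of "R.ext (star x) 1"] by (simp add: \<rho>_def star_one)
  moreover have "\<rho> (x * y) = \<rho> x * \<rho> y" for x y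
    using R.ext_mult[of 1 x y] right[of x "R.ext y 1"] by (simp add: \<rho>_def)
  moreover have "clinear \<rho>"
    by (simp add: Vector_Spaces.linear_iff cvec.vector_space_axioms \<rho>_def R.ext_add R.ext_sc)
  moreover have "norm (\<rho> x) \<le> norm x" for x using R.ext_bound[of 1 x] by (simp add: \<rho>_def)
  moreover have "\<rho> 1 = 1" by (simp add: \<rho>_def R.ext_one)
  moreover have "\<rho> (car f) = car (V f)" for f by (simp add: \<rho>_def R.ext_car)
  ultimately have ex: "unital_star_endo \<rho> \<and> (\<forall>f. \<rho> (car f) = car (V f))"
    unfolding unital_star_endo_def by blast
  have uniq: "\<rho>' x = R.ext x 1" if \<rho>': "unital_star_endo \<rho>' \<and> (\<forall>f. \<rho>' (car f) = car (V f))" for \<rho>' x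
  proof -
    have "\<rho>' x * 1 = R.ext x 1"
    proof (rule R.ext_unique)
      show "norm (\<rho>' x * v) \<le> norm x * norm v" for x v
        using \<rho>' norm_mult_ineq[of "\<rho>' x" v] mult_right_mono[of "norm (\<rho>' x)" "norm x" "norm v"]
        unfolding unital_star_endo_def by fastforce
    qed (use \<rho>' in \<open>auto simp: unital_star_endo_def Vector_Spaces.linear_iff distrib_right scaleC_mult_left mult.assoc\<close>)
    then show ?thesis by simp
  qed
  have "\<exists>!\<rho>. unital_star_endo \<rho> \<and> (\<forall>f. \<rho> (car f) = car (V f))"
  proof (rule ex1I)
    show "unital_star_endo \<rho> \<and> (\<forall>f. \<rho> (car f) = car (V f))" by (rule ex)
    show "\<rho>' = \<rho>" if "unital_star_endo \<rho>' \<and> (\<forall>f. \<rho>' (car f) = car (V f))" for \<rho>'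
      by (rule ext) (simp add: uniq[OF that] \<rho>_def)
  qed
  from theI'[OF this] show ?thesis unfolding car_endo_def .
qed

section \<open>The Fock representation\<close>

lemma basis_projection_props:
  assumes "complex_conjugation J" "basis_projection J P"
  shows "P \<in> bop" "P (P x) = P x" "cinner (P x) y = cinner x (P y)" "J (P x) = compl P (J x)"
    "P (compl P x) = 0" "compl P (P x) = 0"
proof -
  show bop: "P \<in> bop" using assms(2) by (simp add: basis_projection_def)
  show idem: "P (P x) = P x" for x using assms(2) unfolding basis_projection_def by (metis comp_apply)
  show "cinner (P x) y = cinner x (P y)"
    using assms(2) cinner_adj[OF bop, of x y] by (simp add: basis_projection_def)
  have "P (J x) + J (P (J (J x))) = J x" using assms(2) by (simp add: basis_projection_def bar_def)
  then show "J (P x) = compl P (J x)"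
    by (simp add: compl_def conj_conj[OF assms(1)] algebra_simps)
  show "P (compl P x) = 0" "compl P (P x) = 0" by (simp_all add: compl_def bop_diff[OF bop] idem)
qed

locale fock_setting = car_algebra J car
  for J :: "'k::chilbert_space \<Rightarrow> 'k" and car :: "'k \<Rightarrow> 'a::cstar_algebra" +
  fixes P1 :: "'k \<Rightarrow> 'k"
  assumes P1: "basis_projection J P1" and ex_onb_P1: "\<exists>E. is_onb (range P1) E"
begin

sublocale fock_onb "range P1" by unfold_locales (rule ex_onb_P1)

lemmas P1_props = basis_projection_props[OF J P1]

text \<open>The field operator $\pi_{P_1}(f) = a(P_1f)^* + a(P_1(f^*))$.\<close>

definition bf :: "'k \<Rightarrow> 'k fock \<Rightarrow> 'k fock"
  where "bf f \<Phi> = creator (P1 f) \<Phi> + ann (P1 (J f)) \<Phi>"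

lemma creator_add: "creator f (\<Phi> + \<Psi>) = creator f \<Phi> + creator f \<Psi>"
  by (rule ext) (simp add: creator_def plus_fun_def cr_add add_divide_distrib)

lemma creator_fsc: "creator f (fsc c \<Phi>) = fsc c (creator f \<Phi>)"
  by (rule ext) (simp add: creator_def fsc_def cr_scale)

lemma creator_add_vector: "creator (f + g) \<Phi> = creator f \<Phi> + creator g \<Phi>"
  by (rule ext) (simp add: creator_def cr_add_vector add_divide_distrib)

lemma creator_scale_vector: "creator (c *\<^sub>C f) \<Phi> = fsc c (creator f \<Phi>)"
  by (rule ext) (simp add: creator_def cr_scale_vector)

lemma ann_add: "ann f (\<Phi> + \<Psi>) = ann f \<Phi> + ann f \<Psi>"
  by (rule ext) (simp add: ann_def distrib_left)

lemma ann_fsc: "ann f (fsc c \<Phi>) = fsc c (ann f \<Phi>)"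
  by (rule ext) (simp add: ann_def)

lemma ann_add_vector:
  assumes "\<Phi> \<in> F" "f \<in> range P1" "g \<in> range P1" shows "ann (f + g) \<Phi> = ann f \<Phi> + ann g \<Phi>"
proof (rule ext)
  fix xs
  show "ann (f + g) \<Phi> xs = (ann f \<Phi> + ann g \<Phi>) xs"
  proof (cases "set xs \<subseteq> range P1")
    case True
    then have "xs \<in> lists (range P1)" by auto
    then show ?thesis
      using mform_add_arg[OF fock_mform[OF assms(1), of "Suc (length xs)"], of "[]" xs f g] assms(2,3)
      by (simp add: ann_def distrib_left)
  qed (use fock_outside[OF assms(1)] in \<open>simp add: ann_def\<close>)
qed

lemma ann_scale_vector:
  assumes "\<Phi> \<in> F" "f \<in> range P1" shows "ann (c *\<^sub>C f) \<Phi> = fsc (cnj c) (ann f \<Phi>)"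
proof (rule ext)
  fix xs
  show "ann (c *\<^sub>C f) \<Phi> xs = fsc (cnj c) (ann f \<Phi>) xs"
  proof (cases "set xs \<subseteq> range P1")
    case True
    then have "xs \<in> lists (range P1)" by auto
    then show ?thesis
      using mform_scale_arg[OF fock_mform[OF assms(1), of "Suc (length xs)"], of "[]" xs f c] assms(2)
      by (simp add: ann_def)
  qed (use fock_outside[OF assms(1)] in \<open>simp add: ann_def\<close>)
qed

lemma ann_anticommute:
  assumes \<Phi>: "\<Phi> \<in> F" and fg: "f \<in> range P1" "g \<in> range P1"
  shows "ann f (ann g \<Phi>) + ann g (ann f \<Phi>) = 0"
proof (rule ext)
  fix xs
  have "\<Phi> (g # f # xs) = - \<Phi> (f # g # xs)"
  proof (cases "set xs \<subseteq> range P1")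
    case True
    then have "xs \<in> lists (range P1)" by auto
    then show ?thesis using alternatingD[OF fock_alternating[OF \<Phi>], of "[]" xs g f] fg by simp
  qed (use fock_outside[OF \<Phi>] in simp)
  then show "(ann f (ann g \<Phi>) + ann g (ann f \<Phi>)) xs = 0 xs" by (simp add: ann_def)
qed

lemma fip_ann:
  assumes f: "f \<in> range P1" and \<Phi>: "\<Phi> \<in> F" and \<Psi>: "\<Psi> \<in> F"
  shows "fip (range P1) (ann f \<Phi>) \<Psi> = fip (range P1) \<Phi> (creator f \<Psi>)"
  using fip_creator[OF f \<Psi> \<Phi>] fock.ip_commute[OF ann_mem[OF f \<Phi>] \<Psi>]
    fock.ip_commute[OF creator_mem[OF f \<Psi>] \<Phi>] by (metis complex_cnj_cnj)

text \<open>Adjoint to the relation for annihilators.\<close>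

lemma creator_anticommute:
  assumes \<Phi>: "\<Phi> \<in> F" and fg: "f \<in> range P1" "g \<in> range P1"
  shows "creator f (creator g \<Phi>) + creator g (creator f \<Phi>) = 0"
proof (rule fock.ip_eqI)
  note mem = creator_mem[OF fg(1)] creator_mem[OF fg(2)] ann_mem[OF fg(1)] ann_mem[OF fg(2)]
  show "creator f (creator g \<Phi>) + creator g (creator f \<Phi>) \<in> F" by (intro fock_add mem \<Phi>)
  fix \<Psi> assume \<Psi>: "\<Psi> \<in> F"
  have "fip (range P1) (creator f (creator g \<Phi>) + creator g (creator f \<Phi>)) \<Psi> =
      fip (range P1) \<Phi> (ann g (ann f \<Psi>) + ann f (ann g \<Psi>))"
    using \<Phi> \<Psi> fg by (simp add: fock.ip_add_left fock.ip_add_right mem fip_creator)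
  then show "fip (range P1) (creator f (creator g \<Phi>) + creator g (creator f \<Phi>)) \<Psi> = fip (range P1) 0 \<Psi>"
    using \<Phi> \<Psi> fg by (simp add: ann_anticommute fock.ip_zero_left fock.ip_zero_right)
qed (rule fock_zero)

lemma ann_creator_anticommute:
  assumes \<Phi>: "\<Phi> \<in> F" and fg: "f \<in> range P1" "g \<in> range P1"
  shows "ann g (creator f \<Phi>) + creator f (ann g \<Phi>) = fsc (cinner g f) \<Phi>"
proof (rule ext)
  fix xs
  show "(ann g (creator f \<Phi>) + creator f (ann g \<Phi>)) xs = fsc (cinner g f) \<Phi> xs"
  proof (cases "set xs \<subseteq> range P1")
    case True
    then have "xs \<in> lists (range P1)" by auto
    from creator_ann_anticommute[OF fg this] show ?thesis by simp
  next
    case False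
    then show ?thesis using fock_outside[OF \<Phi> False] by (simp add: ann_def creator_def)
  qed
qed

lemma bf_mem: "\<Phi> \<in> F \<Longrightarrow> bf f \<Phi> \<in> F"
  unfolding bf_def by (intro fock_add creator_mem ann_mem) auto

text \<open>The mixed terms give $\langle P_1(g^*), P_1f\rangle + \langle P_1(f^*), P_1g\rangle$, which is
  $\langle f^*, g\rangle$ because the conjugation exchanges $P_1$ and $\mathbf 1 - P_1$.\<close>

lemma bf_anticommute:
  assumes \<Phi>: "\<Phi> \<in> F" shows "bf f (bf g \<Phi>) + bf g (bf f \<Phi>) = fsc (cinner (J f) g) \<Phi>"
proof -
  let ?a = "P1 f" and ?a' = "P1 (J f)" and ?b = "P1 g" and ?b' = "P1 (J g)"
  have mem: "?a \<in> range P1" "?a' \<in> range P1" "?b \<in> range P1" "?b' \<in> range P1" by auto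
  have "bf f (bf g \<Phi>) + bf g (bf f \<Phi>) =
      (creator ?a (creator ?b \<Phi>) + creator ?b (creator ?a \<Phi>)) +
      (ann ?a' (ann ?b' \<Phi>) + ann ?b' (ann ?a' \<Phi>)) +
      (ann ?b' (creator ?a \<Phi>) + creator ?a (ann ?b' \<Phi>)) +
      (ann ?a' (creator ?b \<Phi>) + creator ?b (ann ?a' \<Phi>))"
    by (simp add: bf_def creator_add ann_add algebra_simps)
  also have "\<dots> = fsc (cinner ?b' ?a) \<Phi> + fsc (cinner ?a' ?b) \<Phi>"
    using \<Phi> mem by (simp add: creator_anticommute ann_anticommute ann_creator_anticommute)
  also have "\<dots> = fsc (cinner ?b' ?a + cinner ?a' ?b) \<Phi>"
    by (rule ext) (simp add: distrib_right)
  also have "cinner ?b' ?a = cinner (J g) (P1 f)" by (simp add: P1_props(2,3))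
  also have "\<dots> = cinner (J (P1 f)) g" by (rule cinner_conj_left[OF J])
  also have "\<dots> = cinner (compl P1 (J f)) g" by (simp add: P1_props(4))
  also have "cinner ?a' ?b = cinner ?a' g" by (metis P1_props(2,3))
  also have "cinner (compl P1 (J f)) g + cinner ?a' g = cinner (J f) g"
    by (simp add: compl_def cinner_simps)
  finally show ?thesis .
qed

sublocale rep: car_rep J car "fock_vectors (range P1)" fsc fock.nrm "fip (range P1)" bf
proof unfold_locales
  fix \<Phi> \<Psi> f g c assume \<Phi>: "\<Phi> \<in> F"
  note mem = creator_mem[OF rangeI] ann_mem[OF rangeI]
  show "bf f \<Phi> \<in> F" by (rule bf_mem[OF \<Phi>])
  show "bf f (fsc c \<Phi>) = fsc c (bf f \<Phi>)"
    by (simp add: bf_def creator_fsc ann_fsc fock.vs.scale_right_distrib)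
  show "bf (f + g) \<Phi> = bf f \<Phi> + bf g \<Phi>"
    by (simp add: bf_def bop_add[OF P1_props(1)] conj_add[OF J] creator_add_vector ann_add_vector[OF \<Phi>] algebra_simps)
  show "bf (c *\<^sub>C f) \<Phi> = fsc c (bf f \<Phi>)"
    by (simp add: bf_def bop_scaleC[OF P1_props(1)] conj_scaleC[OF J] creator_scale_vector
        ann_scale_vector[OF \<Phi>] fock.vs.scale_right_distrib)
  show "bf f (bf g \<Phi>) + bf g (bf f \<Phi>) = fsc (cinner (J f) g) \<Phi>" by (rule bf_anticommute[OF \<Phi>])
  show "norm (fip (range P1) \<Phi> \<Phi>) = (fock.nrm \<Phi>)\<^sup>2"
    unfolding fock.ip_self[OF \<Phi>] norm_of_real by simp
  assume \<Psi>: "\<Psi> \<in> F"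
  show "bf f (\<Phi> + \<Psi>) = bf f \<Phi> + bf f \<Psi>"
    by (simp add: bf_def creator_add ann_add algebra_simps)
  show "norm (fip (range P1) \<Phi> \<Psi>) \<le> fock.nrm \<Phi> * fock.nrm \<Psi>" by (rule fock.cauchy_schwarz[OF \<Phi> \<Psi>])
  show "fip (range P1) \<Phi> (fsc c \<Psi>) = fip (range P1) (fsc (cnj c) \<Phi>) \<Psi>"
    using \<Phi> \<Psi> by (simp add: fock.ip_sc_left fock.ip_sc_right)
  show "fip (range P1) \<Phi> (bf f \<Psi>) = fip (range P1) (bf (J f) \<Phi>) \<Psi>"
    using \<Phi> \<Psi> by (simp add: bf_def conj_conj[OF J] fock.ip_add_left fock.ip_add_right mem fip_creator fip_ann)
next
  fix X :: "nat \<Rightarrow> 'k fock"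
  assume "\<And>k. X k \<in> F" "\<And>e. e > 0 \<Longrightarrow> \<exists>N. \<forall>k\<ge>N. \<forall>l\<ge>N. fock.nrm (X k - X l) < e"
  then show "\<exists>w\<in>F. (\<lambda>k. fock.nrm (X k - w)) \<longlonglongrightarrow> 0"
    unfolding fock.nrm_def by (rule fock.ip_complete)
qed (simp_all add: fock_zero fock_add fock_fsc fock.nrm_nonneg fock.nrm_eq_0 fock.nrm_triangle fock.nrm_sc
    fock.ip_add_left fock.ip_add_right)

text \<open>The universal property applied to the field operators; a representation takes extensional values,
  hence the restriction.\<close>

lemma fock_rep:
  "fock_rep J P1 car = (\<lambda>x. restrict (rep.ext x) F)"
proof -
  let ?\<pi> = "\<lambda>x. restrict (rep.ext x) F" and ?H = "fock_space (range P1)"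
  let ?Q = "\<lambda>\<pi>. unital_star_rep ?H \<pi> \<and> (\<forall>f. \<forall>\<Phi>\<in>hcarrier ?H. \<pi> (car f) \<Phi> =
      hadd ?H (hadj ?H (annihilator (range P1) (P1 f)) \<Phi>) (annihilator (range P1) (P1 (J f)) \<Phi>))"
  have gen: "hadd ?H (hadj ?H (annihilator (range P1) (P1 f)) \<Phi>) (annihilator (range P1) (P1 (J f)) \<Phi>) = bf f \<Phi>"
    if "\<Phi> \<in> F" for f \<Phi>
    using that by (simp add: bf_def hadj_annihilator annihilator_apply)
  have hbop: "?\<pi> x \<in> hbop ?H" for x
    by (rule hbopI[of _ "norm x"])
       (simp_all add: rep.ext_mem rep.ext_add_right rep.ext_sc_right rep.ext_bound fock_add fock_fsc)
  have star: "?\<pi> (star x) = hadj ?H (?\<pi> x)" for x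
  proof (rule ext)
    fix \<Phi>
    show "?\<pi> (star x) \<Phi> = hadj ?H (?\<pi> x) \<Phi>"
    proof (cases "\<Phi> \<in> F")
      case True
      have "hadj ?H (?\<pi> x) \<Phi> = rep.ext (star x) \<Phi>"
        by (rule fock_hadj_eqI) (use True in \<open>simp_all add: rep.ext_mem rep.ext_star\<close>)
      then show ?thesis using True by simp
    qed (simp add: hadj_def)
  qed
  have Q: "?Q ?\<pi>"
  proof
    show "unital_star_rep ?H ?\<pi>"
      unfolding unital_star_rep_def
      using hbop star
      by (auto simp: rep.ext_add rep.ext_sc rep.ext_mult rep.ext_one rep.ext_bound rep.ext_mem hcomp_def
          compose_def hnorm_fock)
    show "\<forall>f. \<forall>\<Phi>\<in>hcarrier ?H. ?\<pi> (car f) \<Phi> =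
      hadd ?H (hadj ?H (annihilator (range P1) (P1 f)) \<Phi>) (annihilator (range P1) (P1 (J f)) \<Phi>)"
    proof (intro allI ballI)
      fix f \<Phi> assume "\<Phi> \<in> hcarrier ?H"
      then have "\<Phi> \<in> F" by simp
      from gen[OF this] rep.ext_car[OF this]
      show "?\<pi> (car f) \<Phi> =
        hadd ?H (hadj ?H (annihilator (range P1) (P1 f)) \<Phi>) (annihilator (range P1) (P1 (J f)) \<Phi>)"
        using \<open>\<Phi> \<in> F\<close> by (simp only: restrict_apply if_True)
    qed
  qed
  have uniq: "\<pi> = ?\<pi>" if \<pi>: "?Q \<pi>" for \<pi>
  proof (rule ext)
    fix x
    have hb: "\<pi> x \<in> hbop ?H" for x using \<pi> by (simp add: unital_star_rep_def)
    have "\<pi> x \<Phi> = rep.ext x \<Phi>" if "\<Phi> \<in> F" for \<Phi>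
    proof (rule rep.ext_unique[of \<pi>, OF _ _ _ _ _ _ _ that])
      fix v y z c f assume v: "v \<in> F"
      show "\<pi> y v \<in> F" by (rule hbop_mem[OF hb v])
      show "\<pi> (y + z) v = \<pi> y v + \<pi> z v" "\<pi> (c *\<^sub>C y) v = fsc c (\<pi> y v)" "\<pi> 1 v = v"
        "fock.nrm (\<pi> y v) \<le> norm y * fock.nrm v"
        using \<pi> v unfolding unital_star_rep_def by (auto simp: hnorm_fock)
      have "\<pi> (y * z) = hcomp ?H (\<pi> y) (\<pi> z)" using \<pi> unfolding unital_star_rep_def by blast
      then show "\<pi> (y * z) v = \<pi> y (\<pi> z v)" using v by (simp add: hcomp_def compose_def)
      show "\<pi> (car f) v = bf f v" using \<pi> v gen[OF v] by simp
    qed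
    then show "\<pi> x = ?\<pi> x" using hbop_ext[OF hb[of x]] by (intro extensionalityI[of _ F]) auto
  qed
  have "(THE \<pi>. ?Q \<pi>) = ?\<pi>" by (rule the_equality[of ?Q, OF Q uniq])
  then show ?thesis by (simp add: fock_rep_def Let_def)
qed

end

section \<open>Implementers and antiunitary conjugation\<close>

context fock_setting
begin

abbreviation "H \<equiv> fock_space (range P1)"
abbreviation "Impl \<equiv> implementer_space J P1 car"

lemma rep_ext_diff: "v \<in> F \<Longrightarrow> rep.ext (x - y) v = rep.ext x v - rep.ext y v"
  using rep.ext_add[of v "x - y" y] by simp

text \<open>Both sides of the intertwining relation are continuous and multiplicative in the algebra element, so
  the relation need only be tested on field operators.  This replaces the endomorphism by the
  Bogoliubov operator itself.\<close>

lemma implementer_carrier: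
  assumes V: "V \<in> bogoliubov J"
  shows "\<Psi> \<in> hcarrier (Impl V) \<longleftrightarrow> \<Psi> \<in> hbop H \<and> (\<forall>f. \<forall>\<Phi>\<in>F. \<Psi> (bf f \<Phi>) = bf (V f) (\<Psi> \<Phi>))"
proof -
  define \<rho> where "\<rho> = car_endo car V"
  have \<rho>: "\<rho> (x + y) = \<rho> x + \<rho> y" "\<rho> (c *\<^sub>C x) = c *\<^sub>C \<rho> x" "\<rho> (x * y) = \<rho> x * \<rho> y" "\<rho> 1 = 1"
    "\<rho> (car f) = car (V f)" "norm (\<rho> x) \<le> norm x" for x y c f
    using car_endo[OF V] unfolding \<rho>_def[symmetric] unital_star_endo_def Vector_Spaces.linear_iff by blast+
  have intertwine: "hcomp H \<Psi> (fock_rep J P1 car x) = hcomp H (fock_rep J P1 car (\<rho> x)) \<Psi> \<longleftrightarrow>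
      (\<forall>\<Phi>\<in>F. \<Psi> (rep.ext x \<Phi>) = rep.ext (\<rho> x) (\<Psi> \<Phi>))" if "\<Psi> \<in> hbop H" for x
    using hbop_mem[OF that] by (auto simp: fock_rep hcomp_def compose_def fun_eq_iff)
  have extend: "\<Psi> (rep.ext x \<Phi>) = rep.ext (\<rho> x) (\<Psi> \<Phi>)"
    if \<Psi>: "\<Psi> \<in> hbop H" and gen: "\<And>f \<Phi>. \<Phi> \<in> F \<Longrightarrow> \<Psi> (bf f \<Phi>) = bf (V f) (\<Psi> \<Phi>)" and \<Phi>: "\<Phi> \<in> F" for x \<Phi>
  proof -
    note mem = hbop_mem[OF \<Psi>]
    note F1 = rep.ext_mem[OF \<Phi>] rep.ext_mem[OF mem[OF \<Phi>]]
    have cl: "\<Psi> (rep.ext x \<Phi>) = rep.ext (\<rho> x) (\<Psi> \<Phi>)" if "rep.cl es x y" for es x y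
      using that
    proof (induction es arbitrary: x y)
      case Nil
      then obtain c where "x = c *\<^sub>C 1" unfolding rep.cl.simps by blast
      then show ?case
        by (simp only: \<rho> rep.ext_sc[OF \<Phi>] rep.ext_one[OF \<Phi>] rep.ext_sc[OF mem[OF \<Phi>]]
            rep.ext_one[OF mem[OF \<Phi>]] hbop_fsc[OF \<Psi> \<Phi>])
    next
      case (Cons e es)
      then obtain x0 y0 x1 y1 where *: "rep.cl es x0 y0" "rep.cl es x1 y1" "x = x0 + car e * x1"
        unfolding rep.cl.simps by blast
      show ?case
        by (simp only: *(3) \<rho> rep.ext_add[OF \<Phi>] rep.ext_add[OF mem[OF \<Phi>]] rep.ext_mult[OF \<Phi>]
            rep.ext_mult[OF mem[OF \<Phi>]] rep.ext_car[OF F1(1)] rep.ext_car[OF F1(2)]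
            hbop_add[OF \<Psi> F1(1) bf_mem[OF F1(1)]] gen[OF F1(1)] Cons.IH[OF *(1)] Cons.IH[OF *(2)])
    qed
    obtain M where M: "M \<ge> 0" "\<And>u. u \<in> F \<Longrightarrow> fock.nrm (\<Psi> u) \<le> M * fock.nrm u" using hbop_bound[OF \<Psi>] by blast
    obtain X Y where 1: "\<And>k. rep.D (X k) (Y k)" "X \<longlonglongrightarrow> x" using rep.D_dense by blast
    have eq: "\<Psi> (rep.ext (X k) \<Phi>) = rep.ext (\<rho> (X k)) (\<Psi> \<Phi>)" for k
      using 1(1)[of k] cl unfolding rep.D_def by blast
    have lim: "(\<lambda>k. norm (X k - x)) \<longlonglongrightarrow> 0" by (rule tendsto_norm_zero[OF LIM_zero[OF 1(2)]])
    show ?thesis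
    proof (rule rep.W_limit_unique[OF mem[OF F1(1)] mem[OF F1(1)] F1(2)])
      show "(\<lambda>k. fock.nrm (\<Psi> (rep.ext (X k) \<Phi>) - \<Psi> (rep.ext x \<Phi>))) \<longlonglongrightarrow> 0"
      proof (rule rep.null_comparison)
        show "(\<lambda>k. M * (norm (X k - x) * fock.nrm \<Phi>)) \<longlonglongrightarrow> 0"
          by (rule tendsto_mult_right_zero[OF tendsto_mult_left_zero[OF lim]])
        fix k
        show "0 \<le> fock.nrm (\<Psi> (rep.ext (X k) \<Phi>) - \<Psi> (rep.ext x \<Phi>))"
          by (intro fock.nrm_nonneg fock_diff mem F1)
        have "rep.ext (X k) \<Phi> = rep.ext (X k - x) \<Phi> + rep.ext x \<Phi>"
          unfolding rep_ext_diff[OF \<Phi>] by simp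
        then have "\<Psi> (rep.ext (X k) \<Phi>) = \<Psi> (rep.ext (X k - x) \<Phi>) + \<Psi> (rep.ext x \<Phi>)"
          using hbop_add[OF \<Psi> F1(1) F1(1), of "X k - x" x] by (simp only:)
        then have "fock.nrm (\<Psi> (rep.ext (X k) \<Phi>) - \<Psi> (rep.ext x \<Phi>)) = fock.nrm (\<Psi> (rep.ext (X k - x) \<Phi>))" by simp
        also have "\<dots> \<le> M * fock.nrm (rep.ext (X k - x) \<Phi>)" by (rule M(2)[OF F1(1)])
        also have "\<dots> \<le> M * (norm (X k - x) * fock.nrm \<Phi>)" by (rule mult_left_mono[OF rep.ext_bound[OF \<Phi>] M(1)])
        finally show "fock.nrm (\<Psi> (rep.ext (X k) \<Phi>) - \<Psi> (rep.ext x \<Phi>)) \<le> M * (norm (X k - x) * fock.nrm \<Phi>)" .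
      qed
      show "(\<lambda>k. fock.nrm (\<Psi> (rep.ext (X k) \<Phi>) - rep.ext (\<rho> x) (\<Psi> \<Phi>))) \<longlonglongrightarrow> 0"
      proof (rule rep.null_comparison)
        show "(\<lambda>k. norm (X k - x) * fock.nrm (\<Psi> \<Phi>)) \<longlonglongrightarrow> 0" by (rule tendsto_mult_left_zero[OF lim])
        fix k
        show "0 \<le> fock.nrm (\<Psi> (rep.ext (X k) \<Phi>) - rep.ext (\<rho> x) (\<Psi> \<Phi>))"
          by (intro fock.nrm_nonneg fock_diff mem F1)
        have "\<rho> (X k) = \<rho> (X k - x) + \<rho> x" unfolding \<rho>(1)[symmetric] by simp
        then have "\<Psi> (rep.ext (X k) \<Phi>) - rep.ext (\<rho> x) (\<Psi> \<Phi>) = rep.ext (\<rho> (X k - x)) (\<Psi> \<Phi>)"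
          unfolding eq by (simp add: rep.ext_add[OF mem[OF \<Phi>]])
        then have "fock.nrm (\<Psi> (rep.ext (X k) \<Phi>) - rep.ext (\<rho> x) (\<Psi> \<Phi>)) \<le> norm (\<rho> (X k - x)) * fock.nrm (\<Psi> \<Phi>)"
          using rep.ext_bound[OF mem[OF \<Phi>]] by simp
        also have "\<dots> \<le> norm (X k - x) * fock.nrm (\<Psi> \<Phi>)"
          by (rule mult_right_mono[OF \<rho>(6) fock.nrm_nonneg[OF mem[OF \<Phi>]]])
        finally show "fock.nrm (\<Psi> (rep.ext (X k) \<Phi>) - rep.ext (\<rho> x) (\<Psi> \<Phi>)) \<le> norm (X k - x) * fock.nrm (\<Psi> \<Phi>)" .
      qed
    qed
  qed
  have "\<Psi> \<in> hcarrier (Impl V) \<longleftrightarrow> \<Psi> \<in> hbop H \<and>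
      (\<forall>x. hcomp H \<Psi> (fock_rep J P1 car x) = hcomp H (fock_rep J P1 car (\<rho> x)) \<Psi>)"
    by (simp add: implementer_space_def Let_def \<rho>_def)
  also have "\<dots> \<longleftrightarrow> \<Psi> \<in> hbop H \<and> (\<forall>x. \<forall>\<Phi>\<in>F. \<Psi> (rep.ext x \<Phi>) = rep.ext (\<rho> x) (\<Psi> \<Phi>))"
    using intertwine by blast
  also have "\<dots> \<longleftrightarrow> \<Psi> \<in> hbop H \<and> (\<forall>f. \<forall>\<Phi>\<in>F. \<Psi> (bf f \<Phi>) = bf (V f) (\<Psi> \<Phi>))"
  proof (intro conj_cong refl iffI allI ballI)
    fix f \<Phi> assume \<Psi>: "\<Psi> \<in> hbop H" and *: "\<forall>x. \<forall>\<Phi>\<in>F. \<Psi> (rep.ext x \<Phi>) = rep.ext (\<rho> x) (\<Psi> \<Phi>)" and \<Phi>: "\<Phi> \<in> F"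
    have "\<Psi> (rep.ext (car f) \<Phi>) = rep.ext (\<rho> (car f)) (\<Psi> \<Phi>)" using * \<Phi> by blast
    then show "\<Psi> (bf f \<Phi>) = bf (V f) (\<Psi> \<Phi>)"
      unfolding \<rho>(5) rep.ext_car[OF \<Phi>] rep.ext_car[OF hbop_mem[OF \<Psi> \<Phi>]] .
  next
    fix x \<Phi> assume "\<Psi> \<in> hbop H" "\<forall>f. \<forall>\<Phi>\<in>F. \<Psi> (bf f \<Phi>) = bf (V f) (\<Psi> \<Phi>)" "\<Phi> \<in> F"
    then show "\<Psi> (rep.ext x \<Phi>) = rep.ext (\<rho> x) (\<Psi> \<Phi>)" by (intro extend) auto
  qed
  finally show ?thesis .
qed

text \<open>Expressed by matrix elements the inner product is visibly hermitian; for the operator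
  $\Psi^*\Psi'$ this relies on the existence of adjoints.\<close>

lemma implementer_hip:
  assumes x: "x \<in> hbop H" and y: "y \<in> hbop H"
  shows "hip (Impl V) x y = the_or 0 (\<lambda>c. \<forall>\<Phi>\<in>F. \<forall>Z\<in>F. fip (range P1) (x Z) (y \<Phi>) = c * fip (range P1) Z \<Phi>)"
proof -
  note mem = hbop_mem[OF x] hbop_mem[OF y] hadj_mem[OF x]
  have "hcomp H (hadj H x) y = (\<lambda>\<Phi>\<in>F. fsc c \<Phi>) \<longleftrightarrow>
      (\<forall>\<Phi>\<in>F. \<forall>Z\<in>F. fip (range P1) (x Z) (y \<Phi>) = c * fip (range P1) Z \<Phi>)" for c
  proof -
    have "hcomp H (hadj H x) y = (\<lambda>\<Phi>\<in>F. fsc c \<Phi>) \<longleftrightarrow> (\<forall>\<Phi>\<in>F. hadj H x (y \<Phi>) = fsc c \<Phi>)"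
      by (auto simp: hcomp_def compose_def fun_eq_iff)
    also have "\<dots> \<longleftrightarrow> (\<forall>\<Phi>\<in>F. \<forall>Z\<in>F. fip (range P1) (hadj H x (y \<Phi>)) Z = fip (range P1) (fsc c \<Phi>) Z)"
    proof (intro ball_cong refl iffI ballI)
      fix \<Phi> assume \<Phi>: "\<Phi> \<in> F" "\<forall>Z\<in>F. fip (range P1) (hadj H x (y \<Phi>)) Z = fip (range P1) (fsc c \<Phi>) Z"
      show "hadj H x (y \<Phi>) = fsc c \<Phi>"
        by (rule fock.ip_eqI[OF mem(3)[OF mem(2)[OF \<Phi>(1)]] fock_fsc[OF \<Phi>(1)]]) (use \<Phi>(2) in blast)
    qed simp
    also have "\<dots> \<longleftrightarrow> (\<forall>\<Phi>\<in>F. \<forall>Z\<in>F. fip (range P1) (x Z) (y \<Phi>) = c * fip (range P1) Z \<Phi>)"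
    proof (intro ball_cong refl)
      fix \<Phi> Z assume "\<Phi> \<in> F" "Z \<in> F"
      show "fip (range P1) (hadj H x (y \<Phi>)) Z = fip (range P1) (fsc c \<Phi>) Z \<longleftrightarrow>
          fip (range P1) (x Z) (y \<Phi>) = c * fip (range P1) Z \<Phi>"
      proof -
        have *: "fip (range P1) (hadj H x (y \<Phi>)) Z = cnj (fip (range P1) (x Z) (y \<Phi>))"
          using fip_hadj[OF x mem(2)[OF \<open>\<Phi> \<in> F\<close>] \<open>Z \<in> F\<close>]
            fock.ip_commute[OF mem(1)[OF \<open>Z \<in> F\<close>] mem(2)[OF \<open>\<Phi> \<in> F\<close>]] by (simp only:)
        have "fip (range P1) (fsc c \<Phi>) Z = cnj (c * fip (range P1) Z \<Phi>)"
          unfolding fock.ip_sc_left[OF \<open>\<Phi> \<in> F\<close> \<open>Z \<in> F\<close>] fock.ip_commute[OF \<open>Z \<in> F\<close> \<open>\<Phi> \<in> F\<close>] by simp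
        then show ?thesis unfolding * by (simp only: complex_cnj_cancel_iff)
      qed
    qed
    finally show ?thesis .
  qed
  then show ?thesis by (simp add: implementer_space_def Let_def)
qed

lemma onb_image:
  assumes A: "A \<in> bop" and iso: "\<And>x y. cinner (A x) (A y) = cinner x y" and AS: "A ` range P1 = range P1"
  shows "is_onb (range P1) (A ` E)"
proof -
  have span: "A ` cspan E \<subseteq> cspan (A ` E)"
  proof
    fix y assume "y \<in> A ` cspan E"
    then obtain x where x: "x \<in> cspan E" "y = A x" by blast
    have "A x \<in> cspan (A ` E)" using x(1)
    proof (induction rule: cvec.span_induct_alt)
      case base
      then show ?case by (simp add: bop_zero[OF A] cvec.span_zero)
    next
      case (step c x y)
      then show ?case
        by (simp add: bop_add[OF A] bop_scaleC[OF A] cvec.span_add cvec.span_scale cvec.span_base)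
    qed
    then show "y \<in> cspan (A ` E)" by (simp add: x(2))
  qed
  have S: "range P1 = closure (cspan E)" using onb by (simp add: is_onb_def)
  have cont: "continuous_on X A" for X
    using A unfolding bop_def by (intro linear_continuous_on) blast
  have "range P1 = A ` closure (cspan E)" using AS S by simp
  also have "\<dots> \<subseteq> closure (cspan (A ` E))"
    by (rule image_closure_subset[OF cont closed_closure order_trans[OF span closure_subset]])
  finally have "range P1 \<subseteq> closure (cspan (A ` E))" .
  moreover have "closure (cspan (A ` E)) \<subseteq> range P1"
  proof (rule closure_minimal)
    have "cvec.subspace (range P1)"
      by (rule cvec.subspaceI[OF S.zero_mem S.add_mem S.sc_mem])
    then show "cspan (A ` E) \<subseteq> range P1" using E_sub AS by (intro cvec.span_minimal) blast
    show "closed (range P1)" by (subst S) (rule closed_closure)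
  qed
  moreover have "A ` E \<subseteq> range P1" using E_sub AS by blast
  moreover have "\<forall>e\<in>A ` E. \<forall>f\<in>A ` E. cinner e f = (if e = f then 1 else 0)"
  proof (intro ballI, elim imageE)
    fix e f x y assume *: "e = A x" "x \<in> E" "f = A y" "y \<in> E"
    have orth: "cinner u v = (if u = v then 1 else 0)" if "u \<in> E" "v \<in> E" for u v
      using onb that unfolding is_onb_def by blast
    have "A x = A y \<longleftrightarrow> x = y" using orth[OF *(2,4)] orth[OF *(4,4)] iso[of x y] iso[of y y] by (auto split: if_splits)
    then show "cinner e f = (if e = f then 1 else 0)"
      unfolding *(1,3) iso using orth[OF *(2,4)] by simp
  qed
  ultimately show ?thesis unfolding is_onb_def by blast
qed

text \<open>The unitary $U_{11}$ maps orthonormal bases to orthonormal bases, so the second quantization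
  preserves the Hilbert--Schmidt norm.\<close>

lemma second_quant_mem:
  assumes U: "U \<in> bogoliubov J" "is_unitary U" "U \<circ> P1 = P1 \<circ> U" and \<Phi>: "\<Phi> \<in> F"
  shows "second_quant P1 U \<Phi> \<in> F"
proof -
  have bop: "U \<in> bop" and "adj U \<circ> U = id" "U \<circ> adj U = id"
    using U(2) unfolding is_unitary_def by blast+
  then have UU: "U (adj U x) = x" "adj U (U x) = x" for x
    by (metis comp_apply id_apply)+
  have PU: "P1 (U x) = U (P1 x)" for x using fun_cong[OF U(3), of x] unfolding comp_apply by (rule sym)
  have PA: "P1 (adj U x) = adj U (P1 x)" for x
  proof -
    have "adj U (U (P1 (adj U x))) = adj U (P1 (U (adj U x)))" by (simp only: PU)
    then show ?thesis by (simp only: UU)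
  qed
  have "adj P1 = P1" using P1 by (simp add: basis_projection_def)
  then have "adj (corner P1 U P1) = P1 \<circ> (adj U \<circ> P1)"
    unfolding corner_def adj_comp[OF bop_comp[OF P1_props(1) bop] P1_props(1)] adj_comp[OF P1_props(1) bop]
    by simp
  have adj: "adj (corner P1 U P1) x = adj U x" if x: "x \<in> range P1" for x
  proof -
    obtain y where "x = P1 y" using x by blast
    then show ?thesis using \<open>adj (corner P1 U P1) = _\<close> by (simp add: PA P1_props(2))
  qed
  have iso: "cinner (adj U x) (adj U y) = cinner x y" for x y
    by (simp add: cinner_adj[OF bop] UU)
  have AS: "adj U ` range P1 = range P1"
  proof
    show "adj U ` range P1 \<subseteq> range P1"
    proof (rule image_subsetI)
      fix x assume "x \<in> range P1"
      then obtain y where "x = P1 y" by blast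
      then have "adj U x = P1 (adj U y)" by (simp only: PA)
      then show "adj U x \<in> range P1" by blast
    qed
    show "range P1 \<subseteq> adj U ` range P1"
    proof
      fix x assume "x \<in> range P1"
      then obtain y where "x = P1 y" by blast
      then have "x = adj U (P1 (U y))" by (simp only: PU UU)
      then show "x \<in> adj U ` range P1" by blast
    qed
  qed
  have "second_quant P1 U \<Phi> = pull (adj U) id \<Phi>"
  proof (rule ext)
    fix xs
    show "second_quant P1 U \<Phi> xs = pull (adj U) id \<Phi> xs"
    proof (cases "set xs \<subseteq> range P1")
      case True
      then have "map (adj (corner P1 U P1)) xs = map (adj U) xs"
        by (intro map_cong[OF refl] adj) blast
      then show ?thesis unfolding second_quant_def pull_def using \<Phi> by (simp only: restrict_apply if_True id_apply)
    next
      case False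
      then show ?thesis unfolding second_quant_def pull_def using \<Phi> by (simp only: restrict_apply if_True if_False)
    qed
  qed
  moreover have "pull (adj U) id \<Phi> \<in> F"
  proof (rule pull_mem)
    show "adj U x \<in> range P1" if "x \<in> range P1" for x using imageI[OF that, of "adj U"] unfolding AS .
    show "is_onb (range P1) (adj U ` E)" by (rule onb_image[OF adj_bop[OF bop] iso AS])
    show "norm (adj U x) = norm x" for x by (rule norm_eq_if_cinner_eq) (rule iso)
    show "inj (adj U)" by (rule inj_on_inverseI[of _ U]) (rule UU(1))
    show "adj U (x + y) = adj U x + adj U y" "adj U (c *\<^sub>C x) = id c *\<^sub>C adj U x" for x y c
      unfolding id_apply by (rule bop_add[OF adj_bop[OF bop]], rule bop_scaleC[OF adj_bop[OF bop]])
    show "(id :: complex \<Rightarrow> complex) = id \<or> id = cnj" by (rule disjI1) (rule refl)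
    show "\<Phi> \<in> F" by (rule \<Phi>)
  qed
  ultimately show ?thesis by simp
qed

context
  fixes K :: "'k \<Rightarrow> 'k"
  assumes K: "complex_conjugation K" and KP: "\<And>x. K (P1 x) = P1 (K x)" and JK: "\<And>x. J (K x) = K (J x)"
begin

lemma KS: "K ` range P1 = range P1"
proof
  show "K ` range P1 \<subseteq> range P1" by (auto simp: KP)
  show "range P1 \<subseteq> K ` range P1"
  proof
    fix x assume "x \<in> range P1"
    then obtain y where "x = P1 y" by blast
    then have "x = K (P1 (K y))" by (simp add: KP conj_conj[OF K])
    then show "x \<in> K ` range P1" by blast
  qed
qed

lemmas theta_F = theta_mem[OF K KS]
lemmas theta2 = theta_theta[OF K KS]

text \<open>The antiunitary second quantization implements the antilinear automorphism of the CAR algebra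
  given by \<open>K\<close> on generators.\<close>

lemma theta_bf: "theta K (bf f \<Phi>) = bf (K f) (theta K \<Phi>)"
  unfolding bf_def theta_add[OF K KS] theta_creator[OF K KS] theta_ann[OF K KS] KP JK ..

text \<open>As \<open>theta K\<close> is an involution, this is conjugation by it.\<close>

definition twist :: "('k fock \<Rightarrow> 'k fock) \<Rightarrow> 'k fock \<Rightarrow> 'k fock"
  where "twist \<Psi> = (\<lambda>\<Phi>\<in>F. theta K (\<Psi> (theta K \<Phi>)))"

lemma twist_apply: "\<Phi> \<in> F \<Longrightarrow> twist \<Psi> \<Phi> = theta K (\<Psi> (theta K \<Phi>))"
  by (simp add: twist_def)

lemma twist_hbop: assumes \<Psi>: "\<Psi> \<in> hbop H" shows "twist \<Psi> \<in> hbop H"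
proof -
  note mem = hbop_mem[OF \<Psi>]
  obtain M where M: "\<And>u. u \<in> F \<Longrightarrow> fock.nrm (\<Psi> u) \<le> M * fock.nrm u" using hbop_bound[OF \<Psi>] by blast
  show ?thesis
  proof (rule hbopI[of _ M])
    fix \<Phi> X c assume \<Phi>: "\<Phi> \<in> F"
    note t = theta_F[OF \<Phi>]
    show "twist \<Psi> \<Phi> \<in> F" unfolding twist_apply[OF \<Phi>] by (intro theta_F mem t)
    show "fock.nrm (twist \<Psi> \<Phi>) \<le> M * fock.nrm \<Phi>"
      unfolding twist_apply[OF \<Phi>] theta_nrm[OF K KS mem[OF t]]
      using M[OF t] unfolding theta_nrm[OF K KS \<Phi>] .
    show "twist \<Psi> (fsc c \<Phi>) = fsc c (twist \<Psi> \<Phi>)"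
      unfolding twist_apply[OF \<Phi>] twist_apply[OF fock_fsc[OF \<Phi>]] theta_fsc[OF K KS] hbop_fsc[OF \<Psi> t] by simp
    assume X: "X \<in> F"
    show "twist \<Psi> (\<Phi> + X) = twist \<Psi> \<Phi> + twist \<Psi> X"
      unfolding twist_apply[OF \<Phi>] twist_apply[OF X] twist_apply[OF fock_add[OF \<Phi> X]] theta_add[OF K KS]
        hbop_add[OF \<Psi> t theta_F[OF X]] ..
  qed (simp add: twist_def)
qed

lemma twist_twist: assumes \<Psi>: "\<Psi> \<in> hbop H" shows "twist (twist \<Psi>) = \<Psi>"
proof (rule extensionalityI)
  show "twist (twist \<Psi>) \<in> extensional F" by (simp add: twist_def)
  show "\<Psi> \<in> extensional F" by (rule hbop_ext[OF \<Psi>])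
  fix \<Phi> assume \<Phi>: "\<Phi> \<in> F"
  show "twist (twist \<Psi>) \<Phi> = \<Psi> \<Phi>"
    unfolding twist_apply[OF \<Phi>] twist_apply[OF theta_F[OF \<Phi>]] theta2 ..
qed

lemma twist_implementer:
  assumes V: "V \<in> bogoliubov J" "bar K V \<in> bogoliubov J" and \<Psi>: "\<Psi> \<in> hcarrier (Impl (bar K V))"
  shows "twist \<Psi> \<in> hcarrier (Impl V)"
  unfolding implementer_carrier[OF V(1)]
proof (intro conjI allI ballI)
  have \<Psi>': "\<Psi> \<in> hbop H" "\<And>f \<Phi>. \<Phi> \<in> F \<Longrightarrow> \<Psi> (bf f \<Phi>) = bf (bar K V f) (\<Psi> \<Phi>)"
    using \<Psi> unfolding implementer_carrier[OF V(2)] by blast+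
  show "twist \<Psi> \<in> hbop H" by (rule twist_hbop[OF \<Psi>'(1)])
  fix f \<Phi> assume \<Phi>: "\<Phi> \<in> F"
  show "twist \<Psi> (bf f \<Phi>) = bf (V f) (twist \<Psi> \<Phi>)"
    unfolding twist_apply[OF \<Phi>] twist_apply[OF bf_mem[OF \<Phi>]] theta_bf \<Psi>'(2)[OF theta_F[OF \<Phi>]]
    by (simp add: bar_def conj_conj[OF K])
qed

text \<open>Antiunitarity reverses inner products, so the arguments change places; this is the passage to the
  complex conjugate space.\<close>

lemma twist_pairing:
  assumes x: "x \<in> hbop H" and y: "y \<in> hbop H"
  shows "(\<forall>\<Phi>\<in>F. \<forall>Z\<in>F. fip (range P1) (twist y Z) (twist x \<Phi>) = c * fip (range P1) Z \<Phi>) \<longleftrightarrow>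
    (\<forall>\<Phi>\<in>F. \<forall>Z\<in>F. fip (range P1) (x Z) (y \<Phi>) = c * fip (range P1) Z \<Phi>)" (is "?l \<longleftrightarrow> ?r")
proof -
  have eq: "fip (range P1) (twist y Z) (twist x \<Phi>) = fip (range P1) (x (theta K \<Phi>)) (y (theta K Z))"
    "fip (range P1) Z \<Phi> = fip (range P1) (theta K \<Phi>) (theta K Z)" if "\<Phi> \<in> F" "Z \<in> F" for \<Phi> Z
  proof -
    note t = theta_F[OF that(1)] theta_F[OF that(2)]
    show "fip (range P1) (twist y Z) (twist x \<Phi>) = fip (range P1) (x (theta K \<Phi>)) (y (theta K Z))"
      unfolding twist_apply[OF that(1)] twist_apply[OF that(2)]
        fip_theta[OF K KS hbop_mem[OF y t(2)] hbop_mem[OF x t(1)]]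
      by (rule fock.ip_commute[symmetric]) (rule hbop_mem[OF y t(2)] hbop_mem[OF x t(1)])+
    show "fip (range P1) Z \<Phi> = fip (range P1) (theta K \<Phi>) (theta K Z)"
      unfolding fip_theta[OF K KS that] by (rule fock.ip_commute[OF that])
  qed
  show ?thesis
  proof
    assume l: ?l
    show ?r
    proof (intro ballI)
      fix \<Phi> Z assume *: "\<Phi> \<in> F" "Z \<in> F"
      note t = theta_F[OF *(2)] theta_F[OF *(1)]
      from l t have "fip (range P1) (twist y (theta K \<Phi>)) (twist x (theta K Z)) =
        c * fip (range P1) (theta K \<Phi>) (theta K Z)" by blast
      then show "fip (range P1) (x Z) (y \<Phi>) = c * fip (range P1) Z \<Phi>"
        unfolding eq[OF t] theta2 .
    qed
  next
    assume r: ?r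
    show ?l
    proof (intro ballI)
      fix \<Phi> Z assume *: "\<Phi> \<in> F" "Z \<in> F"
      show "fip (range P1) (twist y Z) (twist x \<Phi>) = c * fip (range P1) Z \<Phi>"
        unfolding eq[OF *] using r theta_F[OF *(1)] theta_F[OF *(2)] by blast
    qed
  qed
qed

lemma theta_second_quant:
  assumes UK: "U \<circ> K = K \<circ> U" and \<Phi>: "\<Phi> \<in> F"
  shows "theta K (second_quant P1 U \<Phi>) = second_quant P1 U (theta K \<Phi>)"
proof -
  define B where "B = adj (corner P1 U P1)"
  have "bar K U = U" "bar K P1 = P1"
    using UK by (auto simp: bar_def fun_eq_iff KP conj_conj[OF K])
  then have "bar K B = B" unfolding B_def adj_bar[OF K, symmetric] corner_bar[OF K, symmetric] by simp
  then have BK: "B (K x) = K (B x)" for x unfolding bar_def by (metis conj_conj[OF K])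
  show ?thesis
  proof (rule ext)
    fix xs
    have "set (map K xs) \<subseteq> range P1 \<longleftrightarrow> set xs \<subseteq> range P1"
      unfolding set_map image_subset_iff conj_mem[OF K KS] by blast
    then show "theta K (second_quant P1 U \<Phi>) xs = second_quant P1 U (theta K \<Phi>) xs"
      using \<Phi> theta_F[OF \<Phi>] by (simp add: theta_def[OF K KS] second_quant_def B_def[symmetric] o_def BK)
  qed
qed

lemma theta_hadj:
  assumes mem: "\<And>Z. Z \<in> F \<Longrightarrow> A Z \<in> F" and comm: "\<And>Z. Z \<in> F \<Longrightarrow> theta K (A Z) = A (theta K Z)" and \<Phi>: "\<Phi> \<in> F"
  shows "hadj H A (theta K \<Phi>) = theta K (hadj H A \<Phi>)"
proof -
  have zero: "fsc 0 X = 0" for X :: "'k fock" by (simp add: fun_eq_iff)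
  have "the_or 0 (\<lambda>x. x \<in> F \<and> (\<forall>z\<in>F. fip (range P1) x z = fip (range P1) (theta K \<Phi>) (A z))) =
      theta K (the_or 0 (\<lambda>x. x \<in> F \<and> (\<forall>z\<in>F. fip (range P1) x z = fip (range P1) \<Phi> (A z))))"
  proof (rule the_or_involution)
    show "theta K 0 = 0" by (simp add: theta_def[OF K KS] fun_eq_iff)
    fix x
    have "x \<in> F \<longleftrightarrow> theta K x \<in> F" using theta_F theta2 by metis
    moreover have "fip (range P1) x (theta K z) = fip (range P1) (theta K \<Phi>) (A (theta K z)) \<longleftrightarrow>
        fip (range P1) (theta K x) z = fip (range P1) \<Phi> (A z)" if "x \<in> F" "z \<in> F" for z
      using fip_theta[OF K KS theta_F[OF that(1)] that(2)] fip_theta[OF K KS \<Phi> mem[OF that(2)]] that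
      by (simp add: theta2 comm)
    ultimately show "x \<in> F \<and> (\<forall>z\<in>F. fip (range P1) x z = fip (range P1) (theta K \<Phi>) (A z)) \<longleftrightarrow>
        theta K x \<in> F \<and> (\<forall>z\<in>F. fip (range P1) (theta K x) z = fip (range P1) \<Phi> (A z))"
      using theta_F theta2 by metis
  qed (rule theta2)
  then show ?thesis using \<Phi> theta_F[OF \<Phi>] by (simp add: hadj_def zero)
qed

lemma hadj_default_mem: "\<Phi> \<in> F \<Longrightarrow> hadj H A \<Phi> \<in> F"
proof -
  assume \<Phi>: "\<Phi> \<in> F"
  have default: "the_or 0 Q \<in> F" if "\<And>x. Q x \<Longrightarrow> x \<in> F" for Q
  proof (cases "\<exists>!x. Q x")
    case True
    then show ?thesis using theI'[OF True] that by (simp add: the_or_def)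
  qed (simp add: the_or_def fock_zero)
  have "hadj H A \<Phi> = the_or 0 (\<lambda>x. x \<in> F \<and> (\<forall>z\<in>F. fip (range P1) x z = fip (range P1) \<Phi> (A z)))"
    using \<Phi> by (simp add: hadj_def)
  also have "\<dots> \<in> F" by (rule default) blast
  finally show ?thesis .
qed

lemma twist_gauge_action:
  assumes U: "U \<in> bogoliubov J" "is_unitary U" "U \<circ> P1 = P1 \<circ> U" and UK: "U \<circ> K = K \<circ> U" and x: "x \<in> hbop H"
  shows "twist (gauge_action P1 U x) = gauge_action P1 U (twist x)"
proof -
  let ?\<Gamma> = "second_quant P1 U"
  note comm = theta_second_quant[OF UK] and mem = second_quant_mem[OF U]
  have act: "gauge_action P1 U y = (\<lambda>\<Phi>\<in>F. ?\<Gamma> (y (hadj H ?\<Gamma> \<Phi>)))" for y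
    by (auto simp: gauge_action_def Let_def hcomp_def compose_def restrict_def)
  have key: "theta K (?\<Gamma> (x (hadj H ?\<Gamma> (theta K \<Phi>)))) = ?\<Gamma> (twist x (hadj H ?\<Gamma> \<Phi>))" if \<Phi>: "\<Phi> \<in> F" for \<Phi>
  proof -
    have h: "hadj H ?\<Gamma> \<Phi> \<in> F" by (rule hadj_default_mem[OF \<Phi>])
    have th: "hadj H ?\<Gamma> (theta K \<Phi>) = theta K (hadj H ?\<Gamma> \<Phi>)"
      by (rule theta_hadj[where A = ?\<Gamma>]) (rule mem, assumption, rule comm, assumption, rule \<Phi>)
    show ?thesis
      unfolding th twist_apply[OF h] by (rule comm[OF hbop_mem[OF x theta_F[OF h]]])
  qed
  show ?thesis
  proof (rule extensionalityI[of _ F])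
    show "twist (gauge_action P1 U x) \<in> extensional F" "gauge_action P1 U (twist x) \<in> extensional F"
      by (simp_all add: twist_def act)
    fix \<Phi> assume \<Phi>: "\<Phi> \<in> F"
    show "twist (gauge_action P1 U x) \<Phi> = gauge_action P1 U (twist x) \<Phi>"
      unfolding twist_apply[OF \<Phi>] act using key[OF \<Phi>] \<Phi> theta_F[OF \<Phi>] by (simp only: restrict_apply if_True)
  qed
qed

text \<open>Conjugation with the antiunitary \<open>theta K\<close> maps implementers of $KVK$ to implementers of $V$
  antiunitarily, and it commutes with the gauge action because \<open>theta K\<close> commutes with the second
  quantizations of the gauge group.\<close>

lemma implementers_conjugate:
  assumes V: "V \<in> bogoliubov J" "bar K V \<in> bogoliubov J"
    and G: "\<And>U. U \<in> G \<Longrightarrow> U \<in> bogoliubov J \<and> is_unitary U \<and> U \<circ> P1 = P1 \<circ> U \<and> U \<circ> K = K \<circ> U"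
  shows "unitarily_equivalent G (Impl (bar K V)) (gauge_action P1) (hconj (Impl V)) (gauge_action P1)"
  unfolding unitarily_equivalent_def
proof (intro exI[of _ twist] conjI ballI)
  have V': "bar K (bar K V) \<in> bogoliubov J" using V by (simp add: bar_bar[OF K])
  have hb: "x \<in> hbop H" if "x \<in> hcarrier (Impl (bar K V))" for x
    using that unfolding implementer_carrier[OF V(2)] by blast
  have hb': "x \<in> hbop H" if "x \<in> hcarrier (Impl V)" for x
    using that unfolding implementer_carrier[OF V(1)] by blast
  have add: "hadd (Impl W) x y = (\<lambda>\<Phi>\<in>F. x \<Phi> + y \<Phi>)" and scale: "hscale (Impl W) c x = (\<lambda>\<Phi>\<in>F. fsc c (x \<Phi>))" for W x y c
    by (simp_all add: implementer_space_def Let_def)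
  show "hunitary (Impl (bar K V)) (hconj (Impl V)) twist"
    unfolding hunitary_def
  proof (intro conjI ballI allI)
    show "bij_betw twist (hcarrier (Impl (bar K V))) (hcarrier (hconj (Impl V)))"
    proof (rule bij_betwI[of _ _ _ twist])
      show "twist \<in> hcarrier (Impl (bar K V)) \<rightarrow> hcarrier (hconj (Impl V))"
        using twist_implementer[OF V] by (simp add: hconj_def)
      show "twist \<in> hcarrier (hconj (Impl V)) \<rightarrow> hcarrier (Impl (bar K V))"
        using twist_implementer[OF V(2) V'] by (simp add: hconj_def bar_bar[OF K])
    qed (use hb hb' in \<open>simp_all add: twist_twist hconj_def\<close>)
  next
    fix x y c assume x: "x \<in> hcarrier (Impl (bar K V))"
    show "twist (hscale (Impl (bar K V)) c x) = hscale (hconj (Impl V)) c (twist x)"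
      unfolding hconj_def by (rule ext) (simp add: scale twist_def theta_F theta_fsc[OF K KS])
    assume y: "y \<in> hcarrier (Impl (bar K V))"
    show "twist (hadd (Impl (bar K V)) x y) = hadd (hconj (Impl V)) (twist x) (twist y)"
      unfolding hconj_def by (rule ext) (simp add: add twist_def theta_F theta_add[OF K KS])
    show "hip (hconj (Impl V)) (twist x) (twist y) = hip (Impl (bar K V)) x y"
      using twist_pairing[OF hb[OF x] hb[OF y]]
      by (simp add: hconj_def implementer_hip twist_hbop hb[OF x] hb[OF y])
  qed
next
  fix U x assume "U \<in> G" "x \<in> hcarrier (Impl (bar K V))"
  then show "twist (gauge_action P1 U x) = gauge_action P1 U (twist x)"
    using G[of U] unfolding implementer_carrier[OF V(2)] by (intro twist_gauge_action) auto
qed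

end

end

section \<open>The semigroup of implementable Bogoliubov operators\<close>

lemma bogoliubovI:
  assumes "V \<in> bop" "\<And>x y. cinner (V x) (V y) = cinner x y" "\<And>f. J (V (J f)) = V f"
  shows "V \<in> bogoliubov J"
  using assms isometry_iff[OF assms(1)] by (simp add: bogoliubov_def bar_def fun_eq_iff[of _ V])

lemma bogoliubov_comp:
  assumes J: "complex_conjugation J" and V: "V \<in> bogoliubov J" and W: "W \<in> bogoliubov J"
  shows "V \<circ> W \<in> bogoliubov J"
proof (rule bogoliubovI)
  show "V \<circ> W \<in> bop" by (rule bop_comp[OF V[THEN bogoliubov_bop] W[THEN bogoliubov_bop]])
  show "cinner ((V \<circ> W) x) ((V \<circ> W) y) = cinner x y" for x y
    by (simp add: bogoliubov_isometry[OF V] bogoliubov_isometry[OF W])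
  show "J ((V \<circ> W) (J f)) = (V \<circ> W) f" for f
    by (simp add: bogoliubov_conj[OF J V] bogoliubov_conj[OF J W] conj_conj[OF J])
qed

lemma symmetric_idempotent_contraction:
  fixes Q :: "'k::chilbert_space \<Rightarrow> 'k"
  assumes "Q (Q x) = Q x" "\<And>x y. cinner (Q x) y = cinner x (Q y)"
  shows "norm (Q x) \<le> norm x"
proof -
  have "cinner (Q x) (Q x) = cinner x (Q x)" by (simp add: assms)
  then have "cmod (cinner (Q x) (Q x)) \<le> norm x * norm (Q x)" using cinner_cauchy_schwarz[of x "Q x"] by simp
  then have "norm (Q x) * norm (Q x) \<le> norm x * norm (Q x)"
    unfolding cinner_self norm_of_real by (simp add: power2_eq_square)
  then show ?thesis by (cases "norm (Q x) = 0") auto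
qed

lemma adj_isometry_contraction:
  assumes "W \<in> bop" "\<And>x y. cinner (W x) (W y) = cinner x y" shows "norm (adj W u) \<le> norm u"
proof -
  have "cmod (cinner (adj W u) (adj W u)) \<le> norm u * norm (W (adj W u))"
    unfolding cinner_adj[OF assms(1)] by (rule cinner_cauchy_schwarz)
  also have "norm (W (adj W u)) = norm (adj W u)" by (rule norm_eq_if_cinner_eq) (rule assms(2))
  finally have "norm (adj W u) * norm (adj W u) \<le> norm u * norm (adj W u)"
    unfolding cinner_self norm_of_real by (simp add: power2_eq_square)
  then show ?thesis by (cases "norm (adj W u) = 0") auto
qed

lemma range_compl_basis_projection:
  assumes J: "complex_conjugation J" and P: "basis_projection J P"
  shows "range (compl P) = J ` range P"
proof -
  have "bar J P = compl P" using P by (simp add: basis_projection_def compl_def fun_eq_iff) (metis add_diff_cancel_left')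
  then show ?thesis by (metis range_bar[OF J])
qed

lemma compl_projection_props:
  assumes "complex_conjugation J" "basis_projection J P"
  shows "compl P (compl P x) = compl P x" "cinner (compl P x) y = cinner x (compl P y)" "P x + compl P x = x"
  using basis_projection_props[OF assms] by (simp_all add: compl_def bop_diff cinner_simps)

text \<open>$(VW)_{12} = V_{11}W_{12} + V_{12}W_{22}$, and the Hilbert--Schmidt operators form a
  two-sided ideal; for the right factor the ideal property is obtained by passing to adjoints.\<close>

lemma implementable_comp:
  assumes J: "complex_conjugation J" and P1: "basis_projection J P1"
    and V: "V \<in> implementable J P1" and W: "W \<in> implementable J P1"
  shows "V \<circ> W \<in> implementable J P1"
proof -
  define P2 where "P2 = compl P1"
  have Vb: "V \<in> bogoliubov J" and Wb: "W \<in> bogoliubov J" using V W by (auto simp: implementable_def)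
  note Vbop = bogoliubov_bop[OF Vb] and Wbop = bogoliubov_bop[OF Wb]
  note Viso = bogoliubov_isometry[OF Vb] and Wiso = bogoliubov_isometry[OF Wb]
  note P1p = basis_projection_props[OF J P1] and P2p = compl_projection_props[OF J P1, folded P2_def]
  obtain E1 where E1: "is_onb (range P2) E1" "(\<lambda>e. (norm (corner P1 V P2 e))\<^sup>2) summable_on E1"
    using V by (auto simp: implementable_def hilbert_schmidt_on_def P2_def)
  obtain E2 where E2: "is_onb (range P2) E2" "(\<lambda>e. (norm (corner P1 W P2 e))\<^sup>2) summable_on E2"
    using W by (auto simp: implementable_def hilbert_schmidt_on_def P2_def)
  have "J ` range P2 = range P1"
    unfolding P2_def range_compl_basis_projection[OF J P1] by (rule conj_image_conj_image[OF J])
  then have F: "is_onb (range P1) (J ` E1)" using is_onb_conj[OF J E1(1)] by simp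
  define A where "A x = P1 (V (P2 x))" for x
  define A' where "A' y = P2 (adj V (P1 y))" for y
  have AA': "cinner y (A x) = cinner (A' y) x" for x y
    by (simp add: A_def A'_def P1p(3)[symmetric] P2p(2) cinner_adj[OF Vbop])
  have "(\<lambda>f. (norm (A' f))\<^sup>2) summable_on J ` E1"
    by (rule hilbert_schmidt_adjoint[OF E1(1) F, of A])
       (use E1(2) AA' in \<open>auto simp: A_def A'_def corner_def o_def\<close>)
  then have "(\<lambda>f. (norm (P2 (adj W (A' f))))\<^sup>2) summable_on J ` E1"
  proof (rule summable_on_comparison_test)
    fix f
    have "norm (P2 (adj W (A' f))) \<le> norm (A' f)"
      using symmetric_idempotent_contraction[of P2 "adj W (A' f)", OF P2p(1,2)]
        adj_isometry_contraction[OF Wbop Wiso, of "A' f"] by (rule order_trans)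
    then show "(norm (P2 (adj W (A' f))))\<^sup>2 \<le> (norm (A' f))\<^sup>2" by (simp add: power_mono)
  qed simp
  then have 1: "(\<lambda>e. (norm (A (W e)))\<^sup>2) summable_on E2"
  proof (rule hilbert_schmidt_adjoint[OF F E2(1), rotated 3])
    fix x y assume "y \<in> range P2"
    then have y: "P2 y = y" using P2p(1) by auto
    show "cinner y (P2 (adj W (A' x))) = cinner (A (W y)) x"
      using AA'[of x "W y"] cinner_commute[of "A (W y)" x] cinner_commute[of "W y" "A' x"]
      by (simp add: P2p(2)[symmetric] y cinner_adj_right[OF Wbop])
  qed (auto simp: A_def)
  have 2: "(\<lambda>e. (norm (P1 (V (P1 (W e)))))\<^sup>2) summable_on E2"
  proof (rule summable_on_comparison_test[OF E2(2)])
    fix e assume "e \<in> E2"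
    then have "e \<in> range P2" using E2(1) by (auto simp: is_onb_def)
    then have e: "P2 e = e" using P2p(1) by auto
    have "norm (P1 (V (P1 (W e)))) \<le> norm (V (P1 (W e)))"
      by (rule symmetric_idempotent_contraction[OF P1p(2,3)])
    also have "\<dots> = norm (P1 (W e))" by (rule norm_eq_if_cinner_eq) (rule Viso)
    finally show "(norm (P1 (V (P1 (W e)))))\<^sup>2 \<le> (norm (corner P1 W P2 e))\<^sup>2"
      by (simp add: corner_def e power_mono)
  qed simp
  have "(\<lambda>e. (norm (corner P1 (V \<circ> W) P2 e))\<^sup>2) summable_on E2"
  proof (rule summable_on_comparison_test)
    show "(\<lambda>e. 2 * (norm (P1 (V (P1 (W e)))))\<^sup>2 + 2 * (norm (A (W e)))\<^sup>2) summable_on E2"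
      by (intro summable_on_add summable_on_cmult_right 1 2)
    fix e assume "e \<in> E2"
    then have "e \<in> range P2" using E2(1) by (auto simp: is_onb_def)
    then have e: "P2 e = e" using P2p(1) by auto
    have "corner P1 (V \<circ> W) P2 e = P1 (V (P1 (W e) + P2 (W e)))" by (simp add: corner_def e P2p(3))
    also have "\<dots> = P1 (V (P1 (W e))) + A (W e)"
      by (simp add: A_def bop_add[OF Vbop] bop_add[OF P1p(1)])
    finally have split: "corner P1 (V \<circ> W) P2 e = P1 (V (P1 (W e))) + A (W e)" .
    show "(norm (corner P1 (V \<circ> W) P2 e))\<^sup>2 \<le> 2 * (norm (P1 (V (P1 (W e)))))\<^sup>2 + 2 * (norm (A (W e)))\<^sup>2"
      unfolding split by (rule norm_add_sq_le)
  qed simp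
  then show ?thesis
    using E2(1) bogoliubov_comp[OF J Vb Wb] unfolding implementable_def hilbert_schmidt_on_def P2_def by blast
qed

context
  fixes K :: "'k::chilbert_space \<Rightarrow> 'k"
  assumes K: "complex_conjugation K"
begin

lemma bogoliubov_bar:
  assumes J: "complex_conjugation J" and JK: "\<And>x. J (K x) = K (J x)" and V: "V \<in> bogoliubov J"
  shows "bar K V \<in> bogoliubov J"
proof (rule bogoliubovI)
  show "bar K V \<in> bop" by (rule bar_bop[OF K bogoliubov_bop[OF V]])
  show "cinner (bar K V x) (bar K V y) = cinner x y" for x y
    by (simp add: bar_def cinner_conj[OF K] bogoliubov_isometry[OF V])
  show "J (bar K V (J f)) = bar K V f" for f
    by (simp add: bar_def JK bogoliubov_conj[OF J V] conj_conj[OF J])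
qed

lemma implementable_bar:
  assumes J: "complex_conjugation J" and JK: "\<And>x. J (K x) = K (J x)" and KP: "bar K P1 = P1"
    and V: "V \<in> implementable J P1"
  shows "bar K V \<in> implementable J P1"
proof -
  have Vb: "V \<in> bogoliubov J" using V by (simp add: implementable_def)
  obtain E where E: "is_onb (range (compl P1)) E" "(\<lambda>e. (norm (corner P1 V (compl P1) e))\<^sup>2) summable_on E"
    using V by (auto simp: implementable_def hilbert_schmidt_on_def)
  have KP2: "bar K (compl P1) = compl P1" using compl_bar[OF K, of P1] KP by simp
  then have KE: "is_onb (range (compl P1)) (K ` E)"
    using is_onb_conj[OF K E(1)] range_bar[OF K, of "compl P1"] by simp
  have "corner P1 (bar K V) (compl P1) = bar K (corner P1 V (compl P1))"
    using corner_bar[OF K, of P1 V "compl P1"] by (simp add: KP KP2)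
  then have "norm (corner P1 (bar K V) (compl P1) (K e)) = norm (corner P1 V (compl P1) e)" for e
    by (simp add: bar_def conj_conj[OF K] norm_conj[OF K])
  moreover have "inj_on K E" by (rule inj_on_inverseI[of _ K]) (rule conj_conj[OF K])
  ultimately have "(\<lambda>e. (norm (corner P1 (bar K V) (compl P1) e))\<^sup>2) summable_on K ` E"
    using E(2) by (simp add: summable_on_reindex o_def)
  then show ?thesis
    using KE bogoliubov_bar[OF J JK Vb] unfolding implementable_def hilbert_schmidt_on_def by blast
qed

text \<open>An antilinear bijection maps bases to bases.\<close>

lemma cdim_conj: "cdim (K ` S) = cdim S"
proof -
  have inj: "inj_on K B" for B by (rule inj_on_inverseI[of _ K]) (rule conj_conj[OF K])
  obtain B where B: "B \<subseteq> S" "\<not> cvec.dependent B" "S \<subseteq> cspan B" "card B = cdim S"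
    using cvec.basis_exists by blast
  show ?thesis
  proof (rule cvec.dim_unique[of "K ` B"])
    show "K ` B \<subseteq> K ` S" using B(1) by blast
    show "K ` S \<subseteq> cspan (K ` B)" unfolding conj_image_cspan[OF K, symmetric] using B(3) by blast
    show "card (K ` B) = cdim S" using card_image[OF inj] B(4) by simp
    show "\<not> cvec.dependent (K ` B)"
    proof
      assume "cvec.dependent (K ` B)"
      then obtain x where x: "x \<in> B" "K x \<in> cspan (K ` B - {K x})" unfolding cvec.dependent_def by blast
      have "K ` B - {K x} = K ` (B - {x})" using inj[of UNIV] by (auto simp: inj_eq)
      then have "x \<in> cspan (B - {x})"
        using x(2) by (simp add: conj_image_cspan[OF K, symmetric] mem_conj_image[OF K] conj_conj[OF K])
      then show False using B(2) x(1) unfolding cvec.dependent_def by blast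
    qed
  qed
qed

lemma hilbert_dim_conj: "hilbert_dim (K ` S) = hilbert_dim S"
proof -
  have "\<exists>B. finite B \<and> cspan B = K ` S" if "finite B" "cspan B = S" for B S
    using that conj_image_cspan[OF K, of B] by (intro exI[of _ "K ` B"]) simp
  then have "(\<exists>B. finite B \<and> cspan B = K ` S) \<longleftrightarrow> (\<exists>B. finite B \<and> cspan B = S)"
    using conj_image_conj_image[OF K, of S] by metis
  then show ?thesis by (simp add: hilbert_dim_def cdim_conj)
qed

lemma statistics_dim_bar: "statistics_dim (bar K V) = statistics_dim V"
proof -
  have "range K = UNIV" using conj_conj[OF K] by (metis surjI)
  then have "ker_on UNIV (adj (bar K V)) = K ` ker_on UNIV (adj V)"
    using ker_on_bar[OF K, of UNIV "adj V"] adj_bar[OF K, of V] by simp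
  then show ?thesis by (simp add: statistics_dim_def minus_ind_def hilbert_dim_conj)
qed

end

section \<open>The charge conjugation operator\<close>

locale charge_setting =
  fixes J P1 P Cpm :: "'k::chilbert_space \<Rightarrow> 'k"
  assumes J: "complex_conjugation J" and P1: "basis_projection J P1" and P: "basis_projection J P"
    and PP1: "P \<circ> P1 = P1 \<circ> P"
    and Cpm: "unitary_between (range (P \<circ> compl P1)) (range (P \<circ> P1)) Cpm"
begin

definition "pm x = P (compl P1 x)"
definition "pp x = P (P1 x)"

lemmas P1p = basis_projection_props[OF J P1]
lemmas Pp = basis_projection_props[OF J P]
lemmas Qp = compl_projection_props[OF J P1]

lemma PP1': "P (P1 x) = P1 (P x)" using fun_cong[OF PP1, of x] by simp

lemma PQ: "P (compl P1 x) = compl P1 (P x)" by (simp add: compl_def bop_diff[OF Pp(1)] PP1')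

lemma range_pm: "x \<in> range pm \<longleftrightarrow> pm x = x"
  by (auto simp: pm_def PQ Pp(2) Qp(1)) (metis pm_def PQ rangeI)

lemma range_pp: "x \<in> range pp \<longleftrightarrow> pp x = x"
  by (auto simp: pp_def PP1' Pp(2) P1p(2)) (metis pp_def PP1' rangeI)

lemma pm_pp: "pm (pp x) = 0" "pp (pm x) = 0" "pm (pm x) = pm x" "pp (pp x) = pp x"
  by (simp_all add: pm_def pp_def PQ PP1' P1p(5,6) P1p(2) Pp(2) Qp(1))
     (simp_all add: bop_zero[OF Pp(1)])

lemma pm_linear: "pm (x + y) = pm x + pm y" "pm (c *\<^sub>C x) = c *\<^sub>C pm x" "pm (x - y) = pm x - pm y" "pm 0 = 0"
  using bop_compl[OF P1p(1)] Pp(1) by (simp_all add: pm_def bop_add bop_scaleC bop_diff bop_zero)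

lemma pp_linear: "pp (x + y) = pp x + pp y" "pp (c *\<^sub>C x) = c *\<^sub>C pp x" "pp 0 = 0"
  using P1p(1) Pp(1) by (simp_all add: pp_def bop_add bop_scaleC bop_zero)

lemma pm_symmetric: "cinner (pm x) y = cinner x (pm y)"
  by (simp only: pm_def Pp(3) Qp(2) PQ)

lemma pp_symmetric: "cinner (pp x) y = cinner x (pp y)"
  by (simp only: pp_def Pp(3) P1p(3) PP1')

lemma pp_plus_pm: "pp x + pm x = P x"
  by (simp add: pp_def pm_def Qp(3) flip: bop_add[OF Pp(1)])

lemma ranges: "range (P \<circ> compl P1) = range pm" "range (P \<circ> P1) = range pp"
  by (simp_all add: pm_def pp_def o_def)

lemma Cpm_props:
  assumes "x \<in> range pm" "y \<in> range pm"
  shows "Cpm x \<in> range pp" "Cpm (x + y) = Cpm x + Cpm y" "Cpm (c *\<^sub>C x) = c *\<^sub>C Cpm x"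
    "cinner (Cpm x) (Cpm y) = cinner x y"
  using Cpm assms unfolding unitary_between_def ranges by blast+

lemma Cpm_onto: "y \<in> range pp \<Longrightarrow> \<exists>x\<in>range pm. Cpm x = y"
  using Cpm unfolding unitary_between_def ranges by (metis imageE)

text \<open>The adjoint of the unitary \<open>Cpm\<close>, which on the range of \<open>pp\<close> is its inverse.\<close>

definition "Cmp y = adj_on (range pm) Cpm y"

lemma pm_mem: "pm x \<in> range pm" and pp_mem: "pp x \<in> range pp" by auto

lemma Cmp_Cpm: assumes "x \<in> range pm" shows "Cmp (Cpm x) = x"
  unfolding Cmp_def adj_on_def
proof (rule the_or_eqI)
  show "x \<in> range pm \<and> (\<forall>z\<in>range pm. cinner x z = cinner (Cpm x) (Cpm z))"
    using Cpm_props(4)[OF assms] assms by simp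
  fix x' assume x': "x' \<in> range pm \<and> (\<forall>z\<in>range pm. cinner x' z = cinner (Cpm x) (Cpm z))"
  have "pm (x' - x) = x' - x" using x' assms unfolding range_pm pm_linear by simp
  then have mem: "x' - x \<in> range pm" unfolding range_pm .
  have "cinner x' z = cinner x z" if "z \<in> range pm" for z
    using bspec[OF conjunct2[OF x'] that] Cpm_props(4)[OF assms that] by (simp only:)
  from this[OF mem] have "cinner (x' - x) (x' - x) = 0" by (simp add: cinner_diff_left)
  then show "x' = x" using chs.ip_definite[of "x' - x"] by simp
qed

lemma Cmp_props:
  assumes y: "y \<in> range pp"
  shows "Cmp y \<in> range pm" "Cpm (Cmp y) = y"
proof -
  obtain x where "x \<in> range pm" "Cpm x = y" using Cpm_onto[OF y] by blast
  then show "Cmp y \<in> range pm" "Cpm (Cmp y) = y" using Cmp_Cpm by auto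
qed

lemma Cmp_eqI: "x \<in> range pm \<Longrightarrow> Cpm x = y \<Longrightarrow> Cmp y = x"
  using Cmp_Cpm by blast

lemma pm_add_mem: "x \<in> range pm \<Longrightarrow> y \<in> range pm \<Longrightarrow> x + y \<in> range pm"
  unfolding range_pm by (simp add: pm_linear)

lemma pm_sc_mem: "x \<in> range pm \<Longrightarrow> c *\<^sub>C x \<in> range pm"
  unfolding range_pm by (simp add: pm_linear)

lemma Cmp_linear:
  assumes "x \<in> range pp" "y \<in> range pp"
  shows "Cmp (x + y) = Cmp x + Cmp y" "Cmp (c *\<^sub>C x) = c *\<^sub>C Cmp x"
  by (rule Cmp_eqI, rule pm_add_mem[OF Cmp_props(1)[OF assms(1)] Cmp_props(1)[OF assms(2)]],
      simp only: Cpm_props(2)[OF Cmp_props(1)[OF assms(1)] Cmp_props(1)[OF assms(2)]] Cmp_props(2)[OF assms(1)] Cmp_props(2)[OF assms(2)])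
     (rule Cmp_eqI, rule pm_sc_mem[OF Cmp_props(1)[OF assms(1)]],
      simp only: Cpm_props(3)[OF Cmp_props(1)[OF assms(1)] Cmp_props(1)[OF assms(1)]] Cmp_props(2)[OF assms(1)])

lemma cinner_Cpm: assumes "x \<in> range pm" "y \<in> range pp" shows "cinner (Cpm x) y = cinner x (Cmp y)"
  using Cpm_props(4)[OF assms(1) Cmp_props(1)[OF assms(2)]] Cmp_props(2)[OF assms(2)] by simp

text \<open>The corner $P\mathcal CP$, extended by zero.\<close>

definition "D f = Cpm (pm f) + Cmp (pp f)"

lemma pm_D: "pm (D f) = Cmp (pp f)" and pp_D: "pp (D f) = Cpm (pm f)"
proof -
  have 1: "pp (Cpm (pm f)) = Cpm (pm f)" using Cpm_props(1)[OF pm_mem pm_mem] unfolding range_pp .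
  have 2: "pm (Cmp (pp f)) = Cmp (pp f)" using Cmp_props(1)[OF pp_mem] unfolding range_pm .
  have "pm (Cpm (pm f)) = 0" using pm_pp(1)[of "Cpm (pm f)"] 1 by simp
  moreover have "pp (Cmp (pp f)) = 0" using pm_pp(2)[of "Cmp (pp f)"] 2 by simp
  ultimately show "pm (D f) = Cmp (pp f)" "pp (D f) = Cpm (pm f)"
    by (simp_all add: D_def pm_linear pp_linear 1 2)
qed

lemma D_add: "D (x + y) = D x + D y"
  unfolding D_def pm_linear pp_linear Cpm_props(2)[OF pm_mem pm_mem] Cmp_linear(1)[OF pp_mem pp_mem]
  by (simp add: algebra_simps)

lemma D_scaleC: "D (c *\<^sub>C x) = c *\<^sub>C D x"
  unfolding D_def pm_linear pp_linear Cpm_props(3)[OF pm_mem pm_mem] Cmp_linear(2)[OF pp_mem pp_mem]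
  by (simp add: scaleC_add_right)

lemma D_zero: "D 0 = 0" using D_scaleC[of 0 0] by simp

lemma D_diff: "D (x - y) = D x - D y" using D_add[of "x - y" y] by simp

lemma D_P: "D (P f) = D f"
proof -
  have "pm (P f) = pm f" "pp (P f) = pp f"
    by (simp_all add: pm_def pp_def PP1'[symmetric] PQ[symmetric] Pp(2))
  then show ?thesis by (simp add: D_def)
qed

lemma P_D: "P (D f) = D f"
  unfolding pp_plus_pm[symmetric, of "D f"] pm_D pp_D by (simp add: D_def)

lemma D_D: "D (D f) = P f"
  unfolding D_def[of "D f"] pm_D pp_D Cmp_props(2)[OF pp_mem] Cmp_Cpm[OF pm_mem] by (rule pp_plus_pm)

lemma D_symmetric: "cinner (D f) g = cinner f (D g)"
proof -
  have 1: "cinner (Cpm (pm f)) g = cinner f (Cmp (pp g))" for f g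
  proof -
    have "cinner (Cpm (pm f)) g = cinner (pp (Cpm (pm f))) g"
      using Cpm_props(1)[OF pm_mem pm_mem, of f] unfolding range_pp by simp
    also have "\<dots> = cinner (pm f) (Cmp (pp g))" unfolding pp_symmetric by (rule cinner_Cpm[OF pm_mem pp_mem])
    also have "\<dots> = cinner f (Cmp (pp g))"
      using Cmp_props(1)[OF pp_mem, of g] unfolding range_pm pm_symmetric by simp
    finally show ?thesis .
  qed
  have "cinner (Cmp (pp f)) g = cnj (cinner (Cpm (pm g)) f)"
    unfolding 1 by (rule cinner_commute)
  then have "cinner (Cmp (pp f)) g = cinner f (Cpm (pm g))" by (metis cinner_commute)
  then show ?thesis by (simp add: D_def cinner_simps 1)
qed

text \<open>The matrix of \<open>D\<close> is off-diagonal with respect to \<open>P1\<close>.\<close>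

lemma D_P1: "D (P1 f) = compl P1 (D f)"
proof -
  have "pm (P1 f) = 0" "pp (P1 f) = pp f" by (simp_all add: pm_def pp_def P1p(2) P1p(6) bop_zero[OF Pp(1)])
  moreover have "Cpm 0 = 0" using Cpm_props(3)[of 0 0 0] by (simp add: range_pm pm_linear)
  ultimately have 1: "D (P1 f) = Cmp (pp f)" by (simp add: D_def)
  have "compl P1 (Cpm (pm f)) = compl P1 (P (P1 (Cpm (pm f))))"
    using Cpm_props(1)[OF pm_mem pm_mem, of f] unfolding range_pp pp_def by simp
  also have "\<dots> = 0" unfolding PP1' P1p(6) ..
  finally have "compl P1 (Cpm (pm f)) = 0" .
  moreover have "compl P1 (Cmp (pp f)) = Cmp (pp f)"
  proof -
    have "pm (Cmp (pp f)) = Cmp (pp f)" using Cmp_props(1)[OF pp_mem, of f] unfolding range_pm .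
    then have "compl P1 (P (Cmp (pp f))) = Cmp (pp f)" unfolding pm_def PQ .
    then show ?thesis by (metis Qp(1))
  qed
  ultimately show ?thesis
    unfolding 1 by (simp add: D_def bop_add[OF bop_compl[OF P1p(1)]])
qed

text \<open>A real operator commuting with \<open>P\<close> is determined by its restriction to the range of \<open>P\<close>, since
  \<open>J\<close> maps the complement of this range onto it.\<close>

definition "C f = D f + J (D (J f))"

lemma P_J_D: "P (J (D f)) = 0"
proof -
  have "P (J (P (D f))) = 0" unfolding Pp(4) Pp(5) ..
  then show ?thesis unfolding P_D .
qed

lemma D_J_D: "D (J (D f)) = 0"
  using D_P[of "J (D f)"] by (simp add: P_J_D D_zero)

lemma J_C: "J (C f) = C (J f)"
  by (simp add: C_def conj_add[OF J] conj_conj[OF J] add.commute)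

lemma C_C: "C (C f) = f"
proof -
  have "P f + J (P (J f)) = f" using P by (simp add: basis_projection_def bar_def)
  then show ?thesis
    unfolding C_def D_add conj_add[OF J] conj_conj[OF J] D_D D_J_D conj_zero[OF J] by simp
qed

lemma C_symmetric: "cinner (C f) g = cinner f (C g)"
  unfolding C_def cinner_add_left cinner_add_right cinner_conj_left[OF J, of "D (J f)"] D_symmetric[of f]
  using D_symmetric[of "J g" "J f"] cinner_conj[OF J, of "J f" "D (J g)"]
  by (simp add: conj_conj[OF J])

lemma C_isometry: "cinner (C f) (C g) = cinner f g"
  unfolding C_symmetric C_C ..

lemma C_bop: "C \<in> bop"
proof (rule bopI[of _ 1])
  show "norm (C x) \<le> 1 * norm x" for x using norm_eq_if_cinner_eq[OF C_isometry, of x] by simp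
qed (simp_all add: C_def D_add D_scaleC conj_add[OF J] conj_scaleC[OF J] scaleC_add_right)

lemma adj_C: "adj C = C"
  by (rule ext) (rule adj_eqI, rule C_symmetric)

lemma C_bogoliubov: "C \<in> bogoliubov J"
  by (rule bogoliubovI[OF C_bop C_isometry]) (simp add: J_C conj_conj[OF J])

lemma C_unitary: "is_unitary C"
  by (simp add: is_unitary_def C_bop adj_C fun_eq_iff C_C)

lemma C_P: "C (P f) = D f"
proof -
  have "D (J (P f)) = D (P (J (P f)))" by (simp only: D_P)
  also have "P (J (P f)) = 0" unfolding Pp(4) Pp(5) ..
  finally show ?thesis by (simp add: C_def D_P D_zero conj_zero[OF J])
qed

lemma P_C: "P (C f) = D f"
  by (simp add: C_def bop_add[OF Pp(1)] P_D P_J_D)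

lemma C_P1: "C (P1 f) = compl P1 (C f)"
proof -
  have D_Q: "D (compl P1 x) = P1 (D x)" for x
    by (simp add: compl_def D_diff D_P1)
  show ?thesis
    unfolding C_def P1p(4) D_Q D_P1 bop_add[OF bop_compl[OF P1p(1)]] ..
qed

text \<open>Uniqueness: on $f = Pf + J P J f$ both summands are fixed by the prescribed corner and reality.\<close>

lemma charge_conjugation_iff: "charge_conjugation J P1 P Cpm C' \<longleftrightarrow> C' = C"
proof
  have D: "D f = Cpm ((P \<circ> compl P1) f) + adj_on (range (P \<circ> compl P1)) Cpm ((P \<circ> P1) f)" for f
    by (simp add: D_def Cmp_def pm_def pp_def o_def)
  show "charge_conjugation J P1 P Cpm C'" if "C' = C"
    unfolding charge_conjugation_def Let_def that D[symmetric]
    by (simp add: C_bogoliubov fun_eq_iff C_P P_C P_D)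
  assume *: "charge_conjugation J P1 P Cpm C'"
  then have C': "C' \<in> bogoliubov J" "C' \<circ> P = P \<circ> C'" "\<And>f. P (C' (P f)) = D f"
    unfolding charge_conjugation_def Let_def D[symmetric] by blast+
  have CP: "C' (P f) = D f" for f
    using fun_cong[OF C'(2), of "P f"] C'(3)[of f] by (simp add: Pp(2))
  show "C' = C"
  proof (rule ext)
    fix f
    have "P f + J (P (J f)) = f" using P by (simp add: basis_projection_def bar_def)
    then have "C' f = C' (P f) + C' (J (P (J f)))" by (metis bop_add[OF bogoliubov_bop[OF C'(1)]])
    then show "C' f = C f" by (simp add: CP C_def bogoliubov_conj[OF J C'(1), symmetric])
  qed
qed

lemma C_commute:
  assumes U: "U \<in> bogoliubov J" "U \<circ> P1 = P1 \<circ> U" "P \<circ> U = U \<circ> P" "\<And>f. f \<in> range (P \<circ> compl P1) \<Longrightarrow> Cpm (U f) = U (Cpm f)"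
  shows "C (U f) = U (C f)"
proof -
  note Ubop = bogoliubov_bop[OF U(1)]
  have UP1: "P1 (U x) = U (P1 x)" and UP: "P (U x) = U (P x)" for x
    using fun_cong[OF U(2), of x] fun_cong[OF U(3), of x] by simp_all
  have pmU: "pm (U x) = U (pm x)" and ppU: "pp (U x) = U (pp x)" for x
    by (simp_all add: pm_def pp_def compl_def UP1 UP flip: bop_diff[OF Ubop])
  have CpmU: "Cpm (U x) = U (Cpm x)" if "x \<in> range pm" for x using U(4) that unfolding ranges by blast
  have "Cmp (U y) = U (Cmp y)" if y: "y \<in> range pp" for y
  proof (rule Cmp_eqI)
    show "U (Cmp y) \<in> range pm" using Cmp_props(1)[OF y] unfolding range_pm pmU by simp
    show "Cpm (U (Cmp y)) = U y" using CpmU[OF Cmp_props(1)[OF y]] Cmp_props(2)[OF y] by simp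
  qed
  then have DU: "D (U f) = U (D f)" for f
    by (simp add: D_def pmU ppU CpmU bop_add[OF Ubop])
  show ?thesis
    by (simp add: C_def DU bogoliubov_conj[OF J U(1)] bop_add[OF Ubop])
qed

text \<open>The antiunitary involution which reduces all claims to transport of structure.\<close>

definition "K f = C (J f)"

lemma K_conjugation: "complex_conjugation K"
  unfolding complex_conjugation_def K_def
  by (simp add: conj_add[OF J] conj_scaleC[OF J] bop_add[OF C_bop] bop_scaleC[OF C_bop] J_C C_C
      conj_conj[OF J] C_isometry cinner_conj[OF J])

lemma J_K: "J (K f) = K (J f)"
  by (simp add: K_def J_C conj_conj[OF J])

text \<open>Both \<open>C\<close> and \<open>J\<close> exchange the ranges of $P_1$ and $\mathbf 1 - P_1$.\<close>

lemma K_P1: "K (P1 f) = P1 (K f)"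
proof -
  have "C (compl P1 x) = P1 (C x)" for x
    by (simp add: compl_def bop_diff[OF C_bop] C_P1)
  then show ?thesis by (simp add: K_def P1p(4))
qed

lemma bar_K_P1: "bar K P1 = P1"
  by (rule ext) (simp add: bar_def K_P1 conj_conj[OF K_conjugation])

lemma bar_K: assumes "V \<in> bogoliubov J" shows "bar K V = C \<circ> V \<circ> C"
  by (rule ext) (simp add: bar_def K_def J_C[symmetric] bogoliubov_conj[OF J assms, symmetric] conj_conj[OF J])

end

theorem proposition4p7:
  fixes J :: "'k::chilbert_space \<Rightarrow> 'k"
    and car :: "'k \<Rightarrow> 'a::cstar_algebra"
    and P1 P Cpm :: "'k \<Rightarrow> 'k"
    and G :: "('k \<Rightarrow> 'k) set"
  assumes "\<nexists>B :: 'k set. finite B \<and> cspan B = UNIV"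
    and "separable_space (euclidean :: 'k topology)"
    and "complex_conjugation J"
    and "CAR_algebra J car"
    and "basis_projection J P1"
    and "gauge_group J P1 G"
    and "basis_projection J P"
    and "P \<circ> P1 = P1 \<circ> P"
    and "\<forall>U\<in>G. P \<circ> U = U \<circ> P"
    and "unitary_between (range (P \<circ> compl P1)) (range (P \<circ> P1)) Cpm"
    and "\<forall>U\<in>G. \<forall>f\<in>range (P \<circ> compl P1). Cpm (U f) = U (Cpm f)"
  shows "(\<exists>!C. charge_conjugation J P1 P Cpm C) \<and>
    (\<forall>C. charge_conjugation J P1 P Cpm C \<longrightarrow>
      (let S = implementable_inv J P1 G; c = (\<lambda>V. C \<circ> V \<circ> C) in
        (\<forall>U\<in>G. C \<circ> U = U \<circ> C) \<and> is_unitary C \<and> adj C = C \<and>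
        (\<forall>V\<in>S. \<forall>W\<in>S. V \<circ> W \<in> S) \<and>
        bij_betw c S S \<and> (\<forall>V\<in>S. \<forall>W\<in>S. c (V \<circ> W) = c V \<circ> c W) \<and> (\<forall>V\<in>S. c (c V) = V) \<and>
        (\<forall>V\<in>S. statistics_dim (c V) = statistics_dim V) \<and>
        (\<forall>V\<in>S. frak_h P1 (c V) = C ` J ` frak_h P1 V) \<and>
        (\<forall>V\<in>S. frak_k J P1 (c V) = C ` J ` frak_k J P1 V) \<and>
        (\<forall>V\<in>S. unitarily_equivalent G
          (implementer_space J P1 car (c V)) (gauge_action P1)
          (hconj (implementer_space J P1 car V)) (gauge_action P1))))"
proof -
  note J = assms(3) and P1 = assms(5)
  interpret charge_setting J P1 P Cpm
    by unfold_locales (use assms in auto)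
  define S where "S = implementable_inv J P1 G"
  define c where "c = (\<lambda>V. C \<circ> V \<circ> C)"
  note K = K_conjugation
  have G: "U \<in> bogoliubov J" "is_unitary U" "U \<circ> P1 = P1 \<circ> U" if "U \<in> G" for U
    using assms(6) that unfolding gauge_group_def by blast+
  have CU: "C \<circ> U = U \<circ> C" if "U \<in> G" for U
    using C_commute[OF G(1,3)[OF that]] assms(9,11) that by (simp add: fun_eq_iff)
  have UK: "U \<circ> K = K \<circ> U" if "U \<in> G" for U
    using fun_cong[OF CU[OF that]] bogoliubov_conj[OF J G(1)[OF that]] by (simp add: fun_eq_iff K_def)
  have S: "V \<in> implementable J P1" "V \<in> bogoliubov J" if "V \<in> S" for V
    using that by (simp_all add: S_def implementable_inv_def implementable_def)
  have SU: "V (U x) = U (V x)" if "V \<in> S" "U \<in> G" for V U x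
  proof -
    have "V \<circ> U = U \<circ> V" using that unfolding S_def implementable_inv_def by blast
    from fun_cong[OF this, of x] show ?thesis by simp
  qed
  have SI: "V \<in> S" if "V \<in> implementable J P1" "\<And>U x. U \<in> G \<Longrightarrow> V (U x) = U (V x)" for V
    using that by (simp add: S_def implementable_inv_def fun_eq_iff)
  have c: "c V = bar K V" if "V \<in> S" for V using bar_K[OF S(2)[OF that]] by (simp add: c_def)
  have CUx: "C (U x) = U (C x)" if "U \<in> G" for U x using fun_cong[OF CU[OF that], of x] by simp
  have cS: "c V \<in> S" if V: "V \<in> S" for V
  proof (rule SI)
    show "c V \<in> implementable J P1"
      unfolding c[OF V] by (rule implementable_bar[OF K J J_K bar_K_P1 S(1)[OF V]])
    show "c V (U x) = U (c V x)" if "U \<in> G" for U x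
      by (simp add: c_def CUx[OF that] SU[OF V that])
  qed
  have cc: "c (c V) = V" for V by (simp add: c_def fun_eq_iff C_C)
  have mult: "V \<circ> W \<in> S" if "V \<in> S" "W \<in> S" for V W
    by (rule SI[OF implementable_comp[OF J P1 S(1)[OF that(1)] S(1)[OF that(2)]]])
       (simp add: SU[OF that(1)] SU[OF that(2)])
  have bij: "bij_betw c S S"
    by (rule bij_betwI[of c S S c, OF _ _ cc cc]) (use cS in blast)+
  have hom: "c (V \<circ> W) = c V \<circ> c W" for V W by (rule ext) (simp add: c_def C_C)
  have stat: "statistics_dim (c V) = statistics_dim V" if "V \<in> S" for V
    unfolding c[OF that] by (rule statistics_dim_bar[OF K])
  have fh: "frak_h P1 (c V) = C ` J ` frak_h P1 V" if "V \<in> S" for V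
    using frak_h_bar[OF K, of P1 V] unfolding c[OF that] bar_K_P1 by (simp add: image_image K_def)
  have fk: "frak_k J P1 (c V) = C ` J ` frak_k J P1 V" if "V \<in> S" for V
    using frak_k_bar[OF K, of J P1 V, OF J_K] unfolding c[OF that] bar_K_P1 by (simp add: image_image K_def)
  have ue: "unitarily_equivalent G (implementer_space J P1 car (c V)) (gauge_action P1)
      (hconj (implementer_space J P1 car V)) (gauge_action P1)" if V: "V \<in> S" for V
  proof -
    obtain E where "is_onb (range (compl P1)) E"
      using S(1)[OF V] by (auto simp: implementable_def hilbert_schmidt_on_def)
    from is_onb_conj[OF J this] have "is_onb (range P1) (J ` E)"
      unfolding range_compl_basis_projection[OF J P1] conj_image_conj_image[OF J] .
    then interpret fock_setting J car P1
      by unfold_locales (use assms in auto)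
    show ?thesis
      unfolding c[OF V]
    proof (rule implementers_conjugate[OF K K_P1 J_K S(2)[OF V]])
      show "bar K V \<in> bogoliubov J" by (rule bogoliubov_bar[OF K J J_K S(2)[OF V]])
    qed (use G UK in blast)
  qed
  have "(\<forall>U\<in>G. C \<circ> U = U \<circ> C) \<and> is_unitary C \<and> adj C = C \<and>
        (\<forall>V\<in>S. \<forall>W\<in>S. V \<circ> W \<in> S) \<and>
        bij_betw c S S \<and> (\<forall>V\<in>S. \<forall>W\<in>S. c (V \<circ> W) = c V \<circ> c W) \<and> (\<forall>V\<in>S. c (c V) = V) \<and>
        (\<forall>V\<in>S. statistics_dim (c V) = statistics_dim V) \<and>
        (\<forall>V\<in>S. frak_h P1 (c V) = C ` J ` frak_h P1 V) \<and>
        (\<forall>V\<in>S. frak_k J P1 (c V) = C ` J ` frak_k J P1 V) \<and>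
        (\<forall>V\<in>S. unitarily_equivalent G
          (implementer_space J P1 car (c V)) (gauge_action P1)
          (hconj (implementer_space J P1 car V)) (gauge_action P1))"
    by (intro conjI ballI CU C_unitary adj_C mult bij hom cc stat fh fk ue)
  then show ?thesis
    unfolding charge_conjugation_iff Let_def c_def S_def by simp
qed

end
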